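(* Let $d\geq 2$ and $2\leq\alpha_2<\alpha_3$ be integers with $\gcd(\alpha_2,\alpha_3)=1$, and let $X=\{x+x^{d}y+z^{\alpha_{2}}+t^{\alpha_{3}}=0\}\subset\mathbb{A}^{4}=\mathrm{Spec}(\mathbb{C}[x,y,z,t])$ be the corresponding Koras-Russell threefold, with the $\mathbb{C}^*$-action induced by the linear action on $\mathbb{A}^4$ with weights $(\alpha_2\alpha_3,-(d-1)\alpha_2\alpha_3,\alpha_3,\alpha_2)$ on $(x,y,z,t)$. Let $(a,b)\in\mathbb{Z}^2$ be such that $a\alpha_3+b\alpha_2=1$, and let $$\mathcal{D}=\left\{ \tfrac{a}{\alpha_{2}}\right\} D_{\alpha_{3}}+\left\{ \tfrac{b}{\alpha_{3}}\right\} D_{\alpha_{2}}+\left[0,\tfrac{1}{\alpha_{2}\alpha_{3}}\right]E$$ on the blow-up $\tilde{\mathbb{A}}^2_{(u,v)}$ of $\mathbb{A}^2=\mathrm{Spec}(\mathbb{C}[u,v])$ at the origin, where $E$ is the exceptional divisor and $D_{\alpha_2}$, $D_{\alpha_3}$ are the strict transforms of the curves $\{u=0\}$ and $\{u+v+v^d=0\}$ respectively. Let $\mu_{d-1}$ act on $\tilde{\mathbb{A}}^2_{(u,v)}$ via $\xi\cdot(u,v)=(\xi u,\xi v)$, with quotient morphism $\varphi_{\mu_{d-1}}:\tilde{\mathbb{A}}^2_{(u,v)}\to\tilde{\mathbb{A}}^2_{(u,v)}/\!/\mu_{d-1}$. Then $X$ is isomorphic, as a $\mathbb{C}^*$-variety,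 to $\mathbb{S}(\tilde{\mathbb{A}}_{(u,v)}^{2}/\!/\mu_{d-1},\mathcal{D}')$ for $$\mathcal{D}'=\left\{ \tfrac{a}{\alpha_{2}}\right\} D'_{\alpha_{3}}+\left\{ \tfrac{b}{\alpha_{3}}\right\} D'_{\alpha_{2}}+\left[0,\tfrac{1}{(d-1)\alpha_{2}\alpha_{3}}\right]E',$$ where $\mathcal{D}=\varphi_{\mu_{d-1}}^{*}(\mathcal{D}')$, $D'_{\alpha_{3}}$ and $D'_{\alpha_{2}}$ are prime divisors, and $E'$ is the exceptional divisor of the blow-up of the singularity in $\mathbb{A}^{2}/\!/\mu_{d-1}$.
   Context: $\mu_m$ denotes the group of complex $m$-th roots of unity and $/\!/$ the algebraic quotient. $\tilde{\mathbb{A}}^2_{(u,v)}$ is the blow-up of the ideal $(u,v)$ in $\mathbb{A}^2$; its quotient $\tilde{\mathbb{A}}^2_{(u,v)}/\!/\mu_{d-1}$ maps birationally to $\mathbb{A}^2/\!/\mu_{d-1}$, where $\mu_{d-1}$ acts on $\mathbb{A}^2$ by $\xi\cdot(u,v)=(\xi u,\xi v)$, and $E'$ is the exceptional divisor of this map (the image of $E$). For $\mathbb{T}=\mathbb{C}^*$ the character lattice and its dual are $M=N=\mathbb{Z}$. A polyhedral divisor with tail cone $\{0\}$ on a normal variety $Y$ is a finite formal sum $\mathcal{D}=\sum\Delta_i D_i$ (also written $\sum \Delta_i\otimes D_i$), with $D_i$ prime divisors and $\Delta_i=[a_i,b_i]\subset\mathbb{Q}$ closed bounded intervals with rational endpoints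 ($\{q\}$ denotes the single point interval $[q,q]$). For $n\in\mathbb{Z}$, $\mathcal{D}(n)=\sum\min_{v\in\Delta_i}(nv)\,D_i$, a Weil $\mathbb{Q}$-divisor, and $$\mathbb{S}(Y,\mathcal{D})=\mathrm{Spec}\Big(\bigoplus_{n\in\mathbb{Z}}\Gamma(Y,\mathcal{O}_Y(\mathcal{D}(n)))\Big)$$ with the $\mathbb{C}^*$-action given by the $\mathbb{Z}$-grading, where sections of $\mathcal{O}_Y(D)$ for a $\mathbb{Q}$-divisor $D$ are the sections of $\mathcal{O}_Y(\lfloor D\rfloor)$. For a $\mathbb{C}^*$-variety $X=\mathrm{Spec}(A)$ the grading is $A_n=\{f\in A\mid f(\lambda\cdot x)=\lambda^n f(x)\}$. The pull-back of $\mathcal{D}'=\sum\Delta'_i\otimes D'_i$ by a dominant morphism $\varphi$ is $\varphi^*(\mathcal{D}')=\sum\Delta'_i\otimes\varphi^*(D'_i)$, with $\varphi^*(D'_i)$ the usual pull-back (so $\Delta\otimes mD=m\Delta\otimes D$). *)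

theory Defs
  imports
    "HOL-Analysis.Abstract_Topology"
    "HOL-Analysis.Function_Topology"
    "HOL-Library.Set_Algebras"
    "HOL-Library.FuncSet"
    "HOL-Algebra.Module"
begin

section \<open>Spaces with functions\<close>

text \<open>
  Complex varieties are treated classically, as sets of closed points with the Zariski topology
  and the sheaf of regular \<^typ>\<open>complex\<close>-valued functions. \<open>regular X U f\<close> says that \<open>U\<close> is open and
  \<open>f\<close> restricts to a regular function on \<open>U\<close>; the values of \<open>f\<close> outside \<open>U\<close> are irrelevant.
\<close>

record 'a fspace =
  ztop :: "'a topology"
  regular :: "'a set \<Rightarrow> ('a \<Rightarrow> complex) \<Rightarrow> bool"

abbreviation points :: "'a fspace \<Rightarrow> 'a set"
  where "points X \<equiv> topspace (ztop X)"

inductive_set polynomials :: "('a \<Rightarrow> complex) set \<Rightarrow> ('a \<Rightarrow> complex) set"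
  for C :: "('a \<Rightarrow> complex) set" where
  coord: "f \<in> C \<Longrightarrow> f \<in> polynomials C"
| const: "(\<lambda>_. c) \<in> polynomials C"
| add: "f \<in> polynomials C \<Longrightarrow> g \<in> polynomials C \<Longrightarrow> (\<lambda>p. f p + g p) \<in> polynomials C"
| mult: "f \<in> polynomials C \<Longrightarrow> g \<in> polynomials C \<Longrightarrow> (\<lambda>p. f p * g p) \<in> polynomials C"

definition zariski :: "'a set \<Rightarrow> ('a \<Rightarrow> complex) set \<Rightarrow> 'a topology" where
  "zariski V C = topology_generated_by {{p \<in> V. f p \<noteq> 0} | f. f \<in> polynomials C}"

text \<open>\<open>C\<close> is a set of coordinate functions generating the coordinate ring (as functions on \<open>V\<close>).\<close>

definition affine :: "'a set \<Rightarrow> ('a \<Rightarrow> complex) set \<Rightarrow> 'a fspace" where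
  "affine V C = \<lparr> ztop = zariski V C,
     regular = (\<lambda>U f. openin (zariski V C) U \<and>
       (\<forall>p\<in>U. \<exists>W g h. openin (zariski V C) W \<and> p \<in> W \<and> W \<subseteq> U \<and>
          g \<in> polynomials C \<and> h \<in> polynomials C \<and>
          (\<forall>q\<in>W. h q \<noteq> 0 \<and> f q = g q / h q))) \<rparr>"

definition subspace :: "'a fspace \<Rightarrow> 'a set \<Rightarrow> 'a fspace" where
  "subspace X Z = \<lparr> ztop = subtopology (ztop X) Z,
     regular = (\<lambda>U f. openin (subtopology (ztop X) Z) U \<and>
       (\<forall>p\<in>U. \<exists>W g. p \<in> W \<and> regular X W g \<and> (\<forall>q\<in>U \<inter> W. f q = g q))) \<rparr>"

text \<open>The quotient of \<open>X\<close> along \<open>\<pi>\<close>: the open sets and regular functions are those whose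
  pull-back along \<open>\<pi>\<close> is open, respectively regular. If \<open>\<pi>\<close> maps a point to its orbit, the regular
  functions on the quotient are the invariant regular functions.\<close>

definition preim :: "'a fspace \<Rightarrow> ('a \<Rightarrow> 'b) \<Rightarrow> 'b set \<Rightarrow> 'a set" where
  "preim X \<pi> U = {p \<in> points X. \<pi> p \<in> U}"

definition quot_top :: "'a fspace \<Rightarrow> ('a \<Rightarrow> 'b) \<Rightarrow> 'b topology" where
  "quot_top X \<pi> = topology (\<lambda>U. U \<subseteq> \<pi> ` points X \<and> openin (ztop X) (preim X \<pi> U))"

lemma openin_quot_top:
  "openin (quot_top X \<pi>) U \<longleftrightarrow> U \<subseteq> \<pi> ` points X \<and> openin (ztop X) (preim X \<pi> U)"
proof -
  have "istopology (\<lambda>U. U \<subseteq> \<pi> ` points X \<and> openin (ztop X) (preim X \<pi> U))"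
    unfolding istopology_def
  proof (intro conjI allI impI)
    fix S T assume *: "S \<subseteq> \<pi> ` points X \<and> openin (ztop X) (preim X \<pi> S)"
      "T \<subseteq> \<pi> ` points X \<and> openin (ztop X) (preim X \<pi> T)"
    show "S \<inter> T \<subseteq> \<pi> ` points X" using * by blast
    have "preim X \<pi> (S \<inter> T) = preim X \<pi> S \<inter> preim X \<pi> T" by (auto simp: preim_def)
    then show "openin (ztop X) (preim X \<pi> (S \<inter> T))" using * by auto
  next
    fix K assume *: "\<forall>U\<in>K. U \<subseteq> \<pi> ` points X \<and> openin (ztop X) (preim X \<pi> U)"
    show "\<Union>K \<subseteq> \<pi> ` points X" using * by blast
    have "preim X \<pi> (\<Union>K) = (\<Union>U\<in>K. preim X \<pi> U)" by (auto simp: preim_def)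
    then show "openin (ztop X) (preim X \<pi> (\<Union>K))" using * by auto
  qed
  then show ?thesis by (simp add: quot_top_def topology_inverse')
qed

definition quot :: "'a fspace \<Rightarrow> ('a \<Rightarrow> 'b) \<Rightarrow> 'b fspace" where
  "quot X \<pi> = \<lparr> ztop = quot_top X \<pi>,
     regular = (\<lambda>U f. openin (quot_top X \<pi>) U \<and> regular X (preim X \<pi> U) (f \<circ> \<pi>)) \<rparr>"

definition isomorphism :: "'a fspace \<Rightarrow> 'b fspace \<Rightarrow> ('a \<Rightarrow> 'b) \<Rightarrow> bool" where
  "isomorphism X Y h \<longleftrightarrow> homeomorphic_map (ztop X) (ztop Y) h \<and>
     (\<forall>U f. openin (ztop Y) U \<longrightarrow> (regular Y U f \<longleftrightarrow> regular X (preim X h U) (f \<circ> h)))"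

definition isomorphic_Cstar ::
    "'a fspace \<Rightarrow> (complex \<Rightarrow> 'a \<Rightarrow> 'a) \<Rightarrow> 'b fspace \<Rightarrow> (complex \<Rightarrow> 'b \<Rightarrow> 'b) \<Rightarrow> bool" where
  "isomorphic_Cstar X actX Y actY \<longleftrightarrow>
     (\<exists>h. isomorphism X Y h \<and> (\<forall>l. l \<noteq> 0 \<longrightarrow> (\<forall>p\<in>points X. h (actX l p) = actY l (h p))))"

definition orbit :: "('g \<Rightarrow> 'a \<Rightarrow> 'a) \<Rightarrow> 'g set \<Rightarrow> 'a \<Rightarrow> 'a set" where
  "orbit act G p = (\<lambda>g. act g p) ` G"

definition roots_of_unity :: "nat \<Rightarrow> complex set" where
  "roots_of_unity m = {z. z ^ m = 1}"


section \<open>Rational functions, prime divisors, orders\<close>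

text \<open>A rational function on an irreducible \<open>X\<close> is an equivalence class of pairs \<open>(U, f)\<close> with
  \<open>U\<close> nonempty open and \<open>f\<close> regular on \<open>U\<close>, two pairs being equivalent iff they agree on the
  intersection of their domains.\<close>

type_synonym 'a ratfun = "('a set \<times> ('a \<Rightarrow> complex)) set"

definition ratclass :: "'a fspace \<Rightarrow> 'a set \<Rightarrow> ('a \<Rightarrow> complex) \<Rightarrow> 'a ratfun" where
  "ratclass X U f = {(V, g). V \<noteq> {} \<and> regular X V g \<and> (\<forall>p\<in>U \<inter> V. g p = f p)}"

definition function_field :: "'a fspace \<Rightarrow> (complex, 'a ratfun) module" where
  "function_field X = \<lparr>
     carrier = {ratclass X U f | U f. U \<noteq> {} \<and> regular X U f},
     mult = (\<lambda>a b. \<Union>(U, f)\<in>a. \<Union>(V, g)\<in>b. ratclass X (U \<inter> V) (\<lambda>p. f p * g p)),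
     one = ratclass X (points X) (\<lambda>_. 1),
     zero = ratclass X (points X) (\<lambda>_. 0),
     add = (\<lambda>a b. \<Union>(U, f)\<in>a. \<Union>(V, g)\<in>b. ratclass X (U \<inter> V) (\<lambda>p. f p + g p)),
     smult = (\<lambda>c a. \<Union>(U, f)\<in>a. ratclass X U (\<lambda>p. c * f p)) \<rparr>"

text \<open>Meaningful for dominant \<open>\<phi>\<close> only, as the preimage of \<open>V\<close> has to be nonempty.\<close>

definition pullback_ratfun :: "'a fspace \<Rightarrow> ('a \<Rightarrow> 'b) \<Rightarrow> 'b ratfun \<Rightarrow> 'a ratfun" where
  "pullback_ratfun X \<phi> a = (\<Union>(V, g)\<in>a. ratclass X (preim X \<phi> V) (g \<circ> \<phi>))"

definition irreducible_closed :: "'a fspace \<Rightarrow> 'a set \<Rightarrow> bool" where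
  "irreducible_closed X Z \<longleftrightarrow> closedin (ztop X) Z \<and> Z \<noteq> {} \<and>
     (\<forall>A B. closedin (ztop X) A \<longrightarrow> closedin (ztop X) B \<longrightarrow> Z \<subseteq> A \<union> B \<longrightarrow> Z \<subseteq> A \<or> Z \<subseteq> B)"

text \<open>Codimension one in an irreducible space: no irreducible closed set lies strictly between.\<close>

definition prime_divisor :: "'a fspace \<Rightarrow> 'a set \<Rightarrow> bool" where
  "prime_divisor X P \<longleftrightarrow> irreducible_closed X P \<and> P \<noteq> points X \<and>
     \<not> (\<exists>Q. irreducible_closed X Q \<and> P \<subset> Q \<and> Q \<subset> points X)"

definition local_ring :: "'a fspace \<Rightarrow> 'a set \<Rightarrow> 'a ratfun set" where
  "local_ring X P = {a \<in> carrier (function_field X). \<exists>(U, f)\<in>a. U \<inter> P \<noteq> {}}"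

definition local_ideal :: "'a fspace \<Rightarrow> 'a set \<Rightarrow> 'a ratfun set" where
  "local_ideal X P =
     {a \<in> carrier (function_field X). \<exists>(U, f)\<in>a. U \<inter> P \<noteq> {} \<and> (\<forall>p\<in>U \<inter> P. f p = 0)}"

definition uniformizer :: "'a fspace \<Rightarrow> 'a set \<Rightarrow> 'a ratfun \<Rightarrow> bool" where
  "uniformizer X P t \<longleftrightarrow> t \<in> carrier (function_field X) \<and>
     local_ideal X P = (\<lambda>b. t \<otimes>\<^bsub>function_field X\<^esub> b) ` local_ring X P"

text \<open>The order of a nonzero rational function along a prime divisor of a normal variety, i.e. its
  valuation with respect to the discrete valuation ring \<^term>\<open>local_ring X P\<close>.\<close>

definition ord_along :: "'a fspace \<Rightarrow> 'a set \<Rightarrow> 'a ratfun \<Rightarrow> int" where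
  "ord_along X P a = (THE n. \<exists>t e. uniformizer X P t \<and> e \<in> local_ring X P - local_ideal X P \<and>
     a = e \<otimes>\<^bsub>function_field X\<^esub> (t [^]\<^bsub>function_field X\<^esub> n))"


section \<open>Polyhedral divisors and their affine varieties\<close>

text \<open>\<open>\<rat>\<close>-divisors and polyhedral divisors with tail cone \<open>{0}\<close> are formal sums, encoded by their
  coefficient functions. The zero coefficient of a polyhedral divisor is the interval \<open>{0}\<close>,
  which is the zero for the Minkowski addition of sets of rationals.\<close>

type_synonym 'a qdivisor = "'a set \<Rightarrow> rat"
type_synonym 'a pdivisor = "'a set \<Rightarrow> rat set"

definition formal_sum :: "(rat set \<times> 'a set) list \<Rightarrow> 'a pdivisor" where
  "formal_sum xs = (\<lambda>P. \<Sum>(\<Delta>, Z)\<leftarrow>xs. if Z = P then \<Delta> else 0)"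

definition polyhedral_divisor :: "'a fspace \<Rightarrow> 'a pdivisor \<Rightarrow> bool" where
  "polyhedral_divisor Y D \<longleftrightarrow> finite {P. D P \<noteq> 0} \<and> (\<forall>P. D P \<noteq> 0 \<longrightarrow> prime_divisor Y P) \<and>
     (\<forall>P. \<exists>a b. a \<le> b \<and> D P = {a..b})"

definition eval_pdivisor :: "'a pdivisor \<Rightarrow> int \<Rightarrow> 'a qdivisor" where
  "eval_pdivisor D n = (\<lambda>P. LEAST w. \<exists>v\<in>D P. w = of_int n * v)"

definition sections :: "'a fspace \<Rightarrow> 'a qdivisor \<Rightarrow> 'a ratfun set" where
  "sections Y D = {a \<in> carrier (function_field Y). a = \<zero>\<^bsub>function_field Y\<^esub> \<or>
     (\<forall>P. prime_divisor Y P \<longrightarrow> 0 \<le> ord_along Y P a + \<lfloor>D P\<rfloor>)}"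

text \<open>The graded algebra \<open>\<Oplus>\<^sub>n \<Gamma>(Y, \<O>(D(n)))\<close>; \<open>s n\<close> is the component of degree \<open>n\<close> of \<open>s\<close>.\<close>

definition section_algebra :: "'a fspace \<Rightarrow> 'a pdivisor \<Rightarrow> (complex, int \<Rightarrow> 'a ratfun) module" where
  "section_algebra Y D = (let K = function_field Y in \<lparr>
     carrier = {s. (\<forall>n. s n \<in> sections Y (eval_pdivisor D n)) \<and> finite {n. s n \<noteq> \<zero>\<^bsub>K\<^esub>}},
     mult = (\<lambda>s t n. finsum K (\<lambda>i. s i \<otimes>\<^bsub>K\<^esub> t (n - i)) {i. s i \<noteq> \<zero>\<^bsub>K\<^esub>}),
     one = (\<lambda>n. if n = 0 then \<one>\<^bsub>K\<^esub> else \<zero>\<^bsub>K\<^esub>),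
     zero = (\<lambda>n. \<zero>\<^bsub>K\<^esub>),
     add = (\<lambda>s t n. s n \<oplus>\<^bsub>K\<^esub> t n),
     smult = (\<lambda>c s n. c \<odot>\<^bsub>K\<^esub> s n) \<rparr>)"

definition complex_ring :: "complex ring" where
  "complex_ring = \<lparr> carrier = UNIV, mult = (*), one = 1, zero = 0, add = (+) \<rparr>"

text \<open>\<open>Spec B\<close> as a variety: its closed points are the \<open>\<complex>\<close>-algebra homomorphisms from \<open>B\<close> to the
  complex numbers, and the elements of \<open>B\<close> are functions on it by evaluation.\<close>

definition spec_points :: "(complex, 'b) module \<Rightarrow> ('b \<Rightarrow> complex) set" where
  "spec_points B = {h \<in> ring_hom B complex_ring \<inter> extensional (carrier B).
     \<forall>c. \<forall>b\<in>carrier B. h (c \<odot>\<^bsub>B\<^esub> b) = c * h b}"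

definition Spec :: "(complex, 'b) module \<Rightarrow> ('b \<Rightarrow> complex) fspace" where
  "Spec B = affine (spec_points B) {\<lambda>h. h b | b. b \<in> carrier B}"

definition SS :: "'a fspace \<Rightarrow> 'a pdivisor \<Rightarrow> ((int \<Rightarrow> 'a ratfun) \<Rightarrow> complex) fspace" where
  "SS Y D = Spec (section_algebra Y D)"

text \<open>The \<open>\<complex>\<^sup>*\<close>-action for which a homogeneous \<open>f\<close> of degree \<open>n\<close> satisfies
  \<open>f (l \<cdot> p) = l\<^sup>n f p\<close>.\<close>

definition SS_act :: "'a fspace \<Rightarrow> 'a pdivisor \<Rightarrow> complex \<Rightarrow>
    ((int \<Rightarrow> 'a ratfun) \<Rightarrow> complex) \<Rightarrow> ((int \<Rightarrow> 'a ratfun) \<Rightarrow> complex)" where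
  "SS_act Y D l h =
     restrict (\<lambda>s. h (\<lambda>n. (l powi n) \<odot>\<^bsub>function_field Y\<^esub> s n)) (carrier (section_algebra Y D))"

text \<open>The multiplicity of \<open>P\<close> in the pull-back of the Cartier divisor \<open>Z\<close> along \<open>\<phi>\<close>: choose a local
  equation \<open>g\<close> of \<open>Z\<close> on an open set \<open>V\<close> meeting the image of \<open>P\<close>, and take the order of the
  pull-back of \<open>g\<close> along \<open>P\<close>.\<close>

definition pullback_mult ::
    "'a fspace \<Rightarrow> 'b fspace \<Rightarrow> ('a \<Rightarrow> 'b) \<Rightarrow> 'b set \<Rightarrow> 'a set \<Rightarrow> int" where
  "pullback_mult X Y \<phi> Z P = (THE m. \<exists>V g. openin (ztop Y) V \<and> V \<inter> \<phi> ` P \<noteq> {} \<and>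
     g \<in> carrier (function_field Y) \<and> g \<noteq> \<zero>\<^bsub>function_field Y\<^esub> \<and>
     (\<forall>W. prime_divisor Y W \<longrightarrow> W \<inter> V \<noteq> {} \<longrightarrow> ord_along Y W g = (if W = Z then 1 else 0)) \<and>
     m = ord_along X P (pullback_ratfun X \<phi> g))"

definition pullback_pdivisor ::
    "'a fspace \<Rightarrow> 'b fspace \<Rightarrow> ('a \<Rightarrow> 'b) \<Rightarrow> 'b pdivisor \<Rightarrow> 'a pdivisor" where
  "pullback_pdivisor X Y \<phi> D' = (\<lambda>P. if prime_divisor X P
     then \<Sum>Z | D' Z \<noteq> 0. (\<lambda>v. of_int (pullback_mult X Y \<phi> Z P) * v) ` D' Z else 0)"


section \<open>The blow-up of the affine plane and its quotient\<close>

type_synonym C2 = "complex \<times> complex"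

definition scale2 :: "complex \<Rightarrow> C2 \<Rightarrow> C2" where
  "scale2 c = (\<lambda>(u, v). (c * u, c * v))"

definition line :: "C2 \<Rightarrow> C2 set" where
  "line s = range (\<lambda>c. scale2 c s)"

definition A2xA2 :: "(C2 \<times> C2) fspace" where
  "A2xA2 = affine UNIV
     {\<lambda>(p, s). fst p, \<lambda>(p, s). snd p, \<lambda>(p, s). fst s, \<lambda>(p, s). snd s}"

text \<open>\<open>\<A>\<^sup>2 \<times> \<P>\<^sup>1\<close> is the quotient of \<open>\<A>\<^sup>2 \<times> (\<A>\<^sup>2 - {0})\<close> by scaling the second factor;
  a point of \<open>\<P>\<^sup>1\<close> is a line through the origin.\<close>

definition A2xP1 :: "(C2 \<times> C2 set) fspace" where
  "A2xP1 = quot (subspace A2xA2 {(p, s). s \<noteq> (0, 0)}) (\<lambda>(p, s). (p, line s))"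

definition Bl :: "(C2 \<times> C2 set) fspace" where
  "Bl = subspace A2xP1 {(p, L). p \<in> L}"

definition exc :: "(C2 \<times> C2 set) set" where
  "exc = {(p, L) \<in> points Bl. p = (0, 0)}"

definition strict_transform :: "C2 set \<Rightarrow> (C2 \<times> C2 set) set" where
  "strict_transform C = ztop Bl closure_of {(p, L) \<in> points Bl. p \<in> C \<and> p \<noteq> (0, 0)}"

text \<open>The lift of \<open>\<xi> \<cdot> (u, v) = (\<xi> u, \<xi> v)\<close> to the blow-up.\<close>

definition Bl_act :: "complex \<Rightarrow> C2 \<times> C2 set \<Rightarrow> C2 \<times> C2 set" where
  "Bl_act \<xi> = (\<lambda>(p, L). (scale2 \<xi> p, scale2 \<xi> ` L))"

definition quot_map_mu :: "nat \<Rightarrow> C2 \<times> C2 set \<Rightarrow> (C2 \<times> C2 set) set" where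
  "quot_map_mu m = orbit Bl_act (roots_of_unity m)"

definition Bl_quot :: "nat \<Rightarrow> (C2 \<times> C2 set) set fspace" where
  "Bl_quot m = quot Bl (quot_map_mu m)"

text \<open>The exceptional divisor of \<open>Bl//\<mu>\<^sub>m \<rightarrow> \<A>\<^sup>2//\<mu>\<^sub>m\<close>.\<close>

definition exc_quot :: "nat \<Rightarrow> (C2 \<times> C2 set) set set" where
  "exc_quot m = quot_map_mu m ` exc"


section \<open>Koras-Russell threefolds\<close>

type_synonym C4 = "complex \<times> complex \<times> complex \<times> complex"

definition koras_russell :: "nat \<Rightarrow> nat \<Rightarrow> nat \<Rightarrow> C4 fspace" where
  "koras_russell d \<alpha>\<^sub>2 \<alpha>\<^sub>3 = affine {(x, y, z, t). x + x ^ d * y + z ^ \<alpha>\<^sub>2 + t ^ \<alpha>\<^sub>3 = 0}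
     {\<lambda>(x, y, z, t). x, \<lambda>(x, y, z, t). y, \<lambda>(x, y, z, t). z, \<lambda>(x, y, z, t). t}"

definition koras_russell_act :: "nat \<Rightarrow> nat \<Rightarrow> nat \<Rightarrow> complex \<Rightarrow> C4 \<Rightarrow> C4" where
  "koras_russell_act d \<alpha>\<^sub>2 \<alpha>\<^sub>3 l = (\<lambda>(x, y, z, t).
     (l powi (int \<alpha>\<^sub>2 * int \<alpha>\<^sub>3) * x, l powi (- (int d - 1) * int \<alpha>\<^sub>2 * int \<alpha>\<^sub>3) * y,
      l powi int \<alpha>\<^sub>3 * z, l powi int \<alpha>\<^sub>2 * t))"

end

theory Submission
  imports Defs
    "HOL-Computational_Algebra.Computational_Algebra"
    "HOL-Computational_Algebra.Field_as_Ring"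
begin

text \<open>
  Put \<open>m = d - 1\<close>. On the part of the threefold where no coordinate vanishes, the functions
  \<open>s = x\<^sup>m y\<close> and \<open>w = t^\<alpha>\<^sub>3 / x\<close> are invariant, and the equation of the threefold becomes
  \<open>1 + s + w = - z^\<alpha>\<^sub>2 / x\<close>. On the blow-up, \<open>s = v\<^sup>m\<close> and \<open>w = u / v\<close> are coordinates of an affine
  plane inside the quotient by the roots of unity, and there \<open>s\<close>, \<open>w\<close> and \<open>\<theta> = 1 + s + w\<close> are local
  equations of the exceptional divisor and of the images of the strict transforms of \<open>u = 0\<close> and of
  \<open>u + v + v\<^sup>d = 0\<close>. Because \<open>a \<alpha>\<^sub>3 + b \<alpha>\<^sub>2 = 1\<close>, the function \<open>\<chi> = z\<^sup>a t\<^sup>b\<close> has weight one, so a rational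
  function of weight \<open>n\<close> on the threefold is \<open>h \<chi>\<^sup>n\<close> for a unique rational function \<open>h\<close> of \<open>s\<close>, \<open>w\<close>.

  The theorem is the statement that \<open>h \<chi>\<^sup>n\<close> is a polynomial in \<open>x, y, z, t\<close> exactly if \<open>h\<close> is a
  section of the \<open>n\<close>-th evaluation of the polyhedral divisor. Let \<open>e, l, k\<close> be the rounded-down
  coefficients of that evaluation at the divisors \<open>s = 0\<close>, \<open>w = 0\<close> and \<open>\<theta> = 0\<close>. The sections are the
  functions \<open>g s\<^sup>-\<^sup>e w\<^sup>-\<^sup>l \<theta>\<^sup>-\<^sup>k\<close> with a polynomial \<open>g\<close>, subject to one more condition at the only curve
  that the plane misses, the image of the strict transform of \<open>v = 0\<close>, which is a fibre of the ruled
  surface: every monomial \<open>s\<^sup>i w\<^sup>j\<close> of \<open>g\<close> has \<open>j \<le> m (i - e) + l + k\<close>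
  (\<open>Sec_decompose\<close>). Substituting, such a monomial contributes
  \<open>\<plusminus> x^(m (i - e) + l + k - j) y^(i - e) z^(a n - \<alpha>\<^sub>2 k) t^(b n - \<alpha>\<^sub>3 l + \<alpha>\<^sub>3 j)\<close>,
  and all four exponents are nonnegative: the first by the condition at the fibre, the others by
  the definition of \<open>e\<close>, \<open>l\<close>, \<open>k\<close> (\<open>Sec_polynomial\<close>). Conversely \<open>x, y, z, t\<close> come from
  sections (\<open>gens_in_Fin\<close>), so the graded algebra of sections is the coordinate ring, and its
  characters are the points of the threefold.

  The geometry enters only through two affine planes. Both the blow-up and its quotient are glued
  from two planes along \<open>w \<mapsto> 1 / w\<close>. Unique factorization of polynomials in two variables and the
  Nullstellensatz for plane curves (\<open>ev_nullstellensatz\<close>) then determine, for any such surface, the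
  function field, the prime divisors, which are the closures of irreducible plane curves, and the
  orders of vanishing, which are multiplicities of irreducible factors (\<open>ord_along_curve\<close>).
  That the quotient by the roots of unity is again covered by planes rests on splitting a polynomial
  in \<open>v\<close> by the residue of the exponent modulo \<open>m\<close> (\<open>isotypic_decomposition\<close>).
\<close>

section \<open>Polynomials in two variables\<close>

type_synonym bpoly = "complex poly poly"

definition ev :: "bpoly \<Rightarrow> C2 \<Rightarrow> complex" where
  "ev P q = poly (poly P [:snd q:]) (fst q)"

definition bX :: bpoly where "bX = [:[:0, 1:]:]"
definition bY :: bpoly where "bY = [:0, 1:]"
definition bC :: "complex \<Rightarrow> bpoly" where "bC c = [:[:c:]:]"

lemma ev_simps [simp]:
  "ev 0 q = 0" "ev 1 q = 1" "ev (P + Q) q = ev P q + ev Q q" "ev (P * Q) q = ev P q * ev Q q"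
  "ev (P - Q) q = ev P q - ev Q q" "ev (- P) q = - ev P q"
  "ev (P ^ n) q = ev P q ^ n" "ev bX q = fst q" "ev bY q = snd q" "ev (bC c) q = c"
  by (simp_all add: ev_def bX_def bY_def bC_def poly_power)

lemma ev_sum: "ev (\<Sum>i\<in>A. f i) q = (\<Sum>i\<in>A. ev (f i) q)"
  by (induction A rule: infinite_finite_induct) auto

lemma ev_monom: "ev (monom (monom c i) j) (x, y) = c * x ^ i * y ^ j"
  by (simp add: ev_def poly_monom flip: power_Suc)

lemma bC_simps [simp]: "bC 0 = 0" "bC 1 = 1" "bC (c * c') = bC c * bC c'" "bC c = 0 \<longleftrightarrow> c = 0"
  by (simp_all add: bC_def one_pCons)

lemma ev_nonzero:
  assumes "P \<noteq> 0" obtains q where "ev P q \<noteq> 0"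
proof -
  have "infinite (range (\<lambda>y::complex. [:y:]))"
    using finite_imageD[of "\<lambda>y::complex. [:y:]" UNIV] infinite_UNIV_char_0 by (auto simp: inj_on_def)
  with poly_roots_finite[OF assms] have "\<not> range (\<lambda>y::complex. [:y:]) \<subseteq> {c. poly P c = 0}"
    using finite_subset by blast
  then obtain y where "poly P [:y:] \<noteq> 0" by auto
  then obtain x where "poly (poly P [:y:]) x \<noteq> 0" using poly_all_0_iff_0 by blast
  then show thesis using that[of "(x, y)"] by (simp add: ev_def)
qed

lemma ev_eq_on_nonzero:
  assumes "H \<noteq> 0" and "\<And>q. ev H q \<noteq> 0 \<Longrightarrow> ev P q = ev Q q" shows "P = Q"
proof (rule ccontr)
  assume "P \<noteq> Q"
  then have "H * (P - Q) \<noteq> 0" using assms(1) by simp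
  then obtain q where "ev (H * (P - Q)) q \<noteq> 0" by (rule ev_nonzero)
  with assms(2)[of q] show False by simp
qed

text \<open>Division with remainder by \<open>r\<close> becomes possible after multiplication with a power of its
  leading coefficient; the remainder lies in the ideal and has smaller degree, so it vanishes.\<close>

lemma minimal_degree_divides:
  fixes p f r :: bpoly
  assumes r: "r \<noteq> 0" "\<exists>A B. r = A * p + B * f"
    and min: "\<And>A B. A * p + B * f \<noteq> 0 \<Longrightarrow> degree r \<le> degree (A * p + B * f)"
    and g: "\<exists>A B. g = A * p + B * f"
  shows "\<exists>c q. c \<noteq> 0 \<and> smult c g = r * q"
proof -
  define c where "c = coeff r (degree r) ^ (Suc (degree g) - degree r)"
  obtain q s where qs: "pseudo_divmod g r = (q, s)" by fastforce
  have eq: "smult c g = r * q + s" and s: "s = 0 \<or> degree s < degree r"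
    using pseudo_divmod[OF r(1) qs] by (simp_all add: c_def)
  obtain A B A' B' where "r = A * p + B * f" "g = A' * p + B' * f" using r g by blast
  then have "s = ([:c:] * A' - q * A) * p + ([:c:] * B' - q * B) * f"
    using eq by (simp add: algebra_simps smult_add_right)
  with min have "s = 0" using s leD by metis
  moreover have "c \<noteq> 0" using r by (simp add: c_def)
  ultimately show ?thesis using eq by auto
qed

text \<open>Take \<open>r\<close> of least degree in the ideal of \<open>p\<close> and \<open>f\<close>. Up to nonzero factors free of the second
  variable, \<open>r\<close> divides both \<open>p\<close> and \<open>f\<close>; as \<open>p\<close> is prime and does not divide \<open>f\<close>, this forces \<open>r\<close>
  itself to be free of the second variable.\<close>

lemma irreducible_bezout:
  fixes p f :: bpoly
  assumes p: "irreducible p" "degree p > 0" and ndvd: "\<not> p dvd f"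
  obtains A B c where "c \<noteq> 0" "A * p + B * f = [:c:]"
proof -
  have prime: "prime_elem p" using p(1) by (rule irreducible_imp_prime_elem)
  define I where "I = {g. g \<noteq> 0 \<and> (\<exists>A B. g = A * p + B * f)}"
  have p0: "p \<noteq> 0" using p by auto
  have "p = 1 * p + 0 * f" by simp
  then have "p \<in> I" unfolding I_def using p0 by blast
  define r where "r = (ARG_MIN degree g. g \<in> I)"
  have rI: "r \<in> I" and min: "\<And>g. g \<in> I \<Longrightarrow> degree r \<le> degree g"
    unfolding r_def using arg_min_natI[of "\<lambda>g. g \<in> I" p degree] arg_min_nat_le[of "\<lambda>g. g \<in> I" _ degree]
      \<open>p \<in> I\<close> by auto
  have r: "r \<noteq> 0" "\<exists>A B. r = A * p + B * f" using rI by (auto simp: I_def)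
  have min': "\<And>A B. A * p + B * f \<noteq> 0 \<Longrightarrow> degree r \<le> degree (A * p + B * f)"
    using min unfolding I_def by blast
  have "\<exists>A B. p = A * p + B * f" "\<exists>A B. f = A * p + B * f"
    by (rule exI[of _ 1], rule exI[of _ 0], simp, rule exI[of _ 0], rule exI[of _ 1], simp)
  then obtain c q c' q' where cq: "c \<noteq> 0" "smult c p = r * q" and cq': "c' \<noteq> 0" "smult c' f = r * q'"
    using minimal_degree_divides[OF r min'] by meson
  have not_const: "\<not> p dvd [:e:]" if "e \<noteq> 0" for e
    using dvd_imp_degree_le[of p "[:e:]"] that p by auto
  have "degree r = 0"
  proof -
    have "p dvd r * q" by (metis cq(2) dvd_smult dvd_refl)
    then consider "p dvd r" | "p dvd q" using prime by (auto simp: prime_elem_dvd_mult_iff)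
    then show ?thesis
    proof cases
      case 1
      then have "p dvd smult c' f" unfolding cq'(2) by simp
      then have "p dvd [:c':] * f" by simp
      then have "p dvd [:c':] \<or> p dvd f" by (rule prime_elem_dvd_multD[OF prime])
      then show ?thesis using ndvd not_const[OF cq'(1)] by blast
    next
      case 2
      then obtain q'' where "q = p * q''" by auto
      with cq(2) have "p * [:c:] = p * (r * q'')" by (simp add: ac_simps)
      then have "[:c:] = r * q''" using p0 mult_left_cancel by blast
      then have "r dvd [:c:]" by simp
      then show ?thesis using dvd_imp_degree_le[of r "[:c:]"] cq(1) by simp
    qed
  qed
  then obtain e where "r = [:e:]" using degree_eq_zeroE by blast
  then show thesis using r that by (metis pCons_eq_0_iff)
qed

text \<open>Nullstellensatz for a plane curve. If \<open>p\<close> does not divide \<open>f\<close>, then \<open>A p + B f = c(x)\<close> is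
  nonzero, so the common zeros of \<open>p\<close> and \<open>f\<close> lie over the finitely many roots of \<open>c\<close>, whereas the curve
  \<open>p = 0\<close> has a point over almost every \<open>x\<close>. The exception is a vertical line, where \<open>p\<close> does not
  involve the second variable.\<close>

lemma ev_nullstellensatz:
  assumes p: "irreducible p" and f: "\<And>q. ev p q = 0 \<Longrightarrow> ev f q = 0"
  shows "p dvd f"
proof (cases "degree p = 0")
  case True
  then obtain c where c: "p = [:c:]" by (rule degree_eq_zeroE)
  have irr: "irreducible c" using p c by (simp add: irreducible_const_poly_iff)
  then have "degree c \<noteq> 0"
    by (metis degree_eq_zeroE irreducible_not_unit irreducible_def is_unit_pCons_iff not_is_unit_0 pCons_0_0)
  then obtain x0 where x0: "poly c x0 = 0"
    using fundamental_theorem_of_algebra[of c] constant_degree[of c] by auto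
  have "[:- x0, 1:] dvd c" using x0 by (simp add: poly_eq_0_iff_dvd)
  moreover have "\<not> is_unit [:- x0, 1:]" by (simp add: is_unit_poly_iff)
  ultimately have cdvd: "c dvd [:- x0, 1:]"
    using irr irreducibleD' by blast
  have "map_poly (\<lambda>c. poly c x0) f = 0"
  proof -
    have "poly (map_poly (\<lambda>c. poly c x0) f) y = ev f (x0, y)" for y
      unfolding ev_def by (induction f) (auto simp: map_poly_pCons)
    moreover have "ev f (x0, y) = 0" for y by (rule f) (simp add: c ev_def x0)
    ultimately show ?thesis by (metis poly_all_0_iff_0)
  qed
  then have "poly (coeff f n) x0 = 0" for n by (metis coeff_map_poly coeff_0 poly_0)
  then have "c dvd coeff f n" for n using cdvd dvd_trans poly_eq_0_iff_dvd by blast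
  then show ?thesis using c by (simp add: const_poly_dvd_iff)
next
  case False
  show ?thesis
  proof (rule ccontr)
    assume ndvd: "\<not> p dvd f"
    obtain A B c where c: "c \<noteq> 0" "A * p + B * f = [:c:]"
      by (rule irreducible_bezout[OF p _ ndvd]) (use False in auto)
    have "c * lead_coeff p \<noteq> 0" using c False by auto
    then obtain x0 where x0: "poly (c * lead_coeff p) x0 \<noteq> 0" using poly_all_0_iff_0 by blast
    define p0 where "p0 = map_poly (\<lambda>c. poly c x0) p"
    have "coeff p0 (degree p) \<noteq> 0" using x0 by (simp add: p0_def coeff_map_poly)
    then have "degree p0 \<noteq> 0" using False by (metis coeff_eq_0 gr0I)
    then obtain y0 where "poly p0 y0 = 0"
      using fundamental_theorem_of_algebra[of p0] constant_degree[of p0] by auto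
    moreover have "poly p0 y = ev p (x0, y)" for y
      unfolding ev_def p0_def by (induction p) (auto simp: map_poly_pCons)
    ultimately have "ev p (x0, y0) = 0" by simp
    then have "ev (A * p + B * f) (x0, y0) = 0" using f by simp
    then show False using c x0 by (simp add: ev_def)
  qed
qed

definition zeros :: "bpoly \<Rightarrow> C2 set" where "zeros p = {q. ev p q = 0}"

lemma zeros_subset_iff: "irreducible p \<Longrightarrow> zeros p \<subseteq> zeros f \<longleftrightarrow> p dvd f"
  using ev_nullstellensatz[of p f] by (auto simp: zeros_def elim!: dvdE)

lemma zeros_nonempty: "irreducible p \<Longrightarrow> zeros p \<noteq> {}"
  using zeros_subset_iff[of p 1] by (auto simp: irreducible_def)

section \<open>Zariski-open sets and regular functions on the affine plane\<close>

definition zopen :: "C2 set \<Rightarrow> bool" where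
  "zopen U \<longleftrightarrow> (\<forall>q\<in>U. \<exists>P. ev P q \<noteq> 0 \<and> {q'. ev P q' \<noteq> 0} \<subseteq> U)"

text \<open>Regular functions are given as quotients with one numerator and one denominator on the whole set;
  \<open>zregI\<close> shows that this agrees with the local definition.\<close>

definition zreg :: "C2 set \<Rightarrow> (C2 \<Rightarrow> complex) \<Rightarrow> bool" where
  "zreg U f \<longleftrightarrow> zopen U \<and> (\<exists>G H. \<forall>q\<in>U. ev H q \<noteq> 0 \<and> f q = ev G q / ev H q)"

lemma zopen_Int: "zopen U \<Longrightarrow> zopen V \<Longrightarrow> zopen (U \<inter> V)"
  unfolding zopen_def
proof
  fix q assume "\<forall>q\<in>U. \<exists>P. ev P q \<noteq> 0 \<and> {q'. ev P q' \<noteq> 0} \<subseteq> U"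
    "\<forall>q\<in>V. \<exists>P. ev P q \<noteq> 0 \<and> {q'. ev P q' \<noteq> 0} \<subseteq> V" "q \<in> U \<inter> V"
  then obtain P Q where "ev P q \<noteq> 0 \<and> {q'. ev P q' \<noteq> 0} \<subseteq> U" "ev Q q \<noteq> 0 \<and> {q'. ev Q q' \<noteq> 0} \<subseteq> V"
    by blast
  then show "\<exists>P. ev P q \<noteq> 0 \<and> {q'. ev P q' \<noteq> 0} \<subseteq> U \<inter> V"
    by (intro exI[of _ "P * Q"]) auto
qed

lemma zopen_basic [simp]: "zopen {q. ev P q \<noteq> 0}" by (auto simp: zopen_def)
lemma zopen_UNIV [simp]: "zopen UNIV" by (auto simp: zopen_def intro!: exI[of _ 1])

lemma zopen_meet: assumes "zopen U" "zopen V" "U \<noteq> {}" "V \<noteq> {}" shows "U \<inter> V \<noteq> {}"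
proof -
  obtain P Q q q' where "ev P q \<noteq> 0" "{q'. ev P q' \<noteq> 0} \<subseteq> U" "ev Q q' \<noteq> 0" "{q'. ev Q q' \<noteq> 0} \<subseteq> V"
    using assms unfolding zopen_def by blast
  moreover then have "P * Q \<noteq> 0" by auto
  then obtain r where "ev (P * Q) r \<noteq> 0" by (rule ev_nonzero)
  ultimately show ?thesis by auto
qed

lemma poly_eq_on_zopen:
  assumes "zopen U" "U \<noteq> {}" "\<And>q. q \<in> U \<Longrightarrow> ev P q = ev Q q" shows "P = Q"
proof -
  obtain H q where "ev H q \<noteq> 0" "{q. ev H q \<noteq> 0} \<subseteq> U" using assms unfolding zopen_def by blast
  then show ?thesis using ev_eq_on_nonzero[of H P Q] assms by (metis (mono_tags) ev_simps(1) mem_Collect_eq subset_iff)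
qed

lemma coprime_quotient:
  fixes G H :: bpoly assumes "H \<noteq> 0"
  obtains G' H' where "coprime G' H'" "H' \<noteq> 0" "G * H' = G' * H"
  by (rule that[of "G div gcd G H" "H div gcd G H"])
    (use assms in \<open>simp_all add: div_gcd_coprime dvd_div_eq_0_iff dvd_div_mult div_mult_swap mult.commute\<close>)

text \<open>Unique factorization turns local quotients into a global one: the reduced quotients
  representing a function near two points have associated denominators.\<close>

lemma zregI:
  assumes U: "zopen U"
    and loc: "\<And>q. q \<in> U \<Longrightarrow> \<exists>W G H. zopen W \<and> q \<in> W \<and> (\<forall>r\<in>U \<inter> W. ev H r \<noteq> 0 \<and> f r = ev G r / ev H r)"
  shows "zreg U f"
proof (cases "U = {}")
  case True then show ?thesis using U by (auto simp: zreg_def)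
next
  case False
  then obtain q0 where q0: "q0 \<in> U" by blast
  obtain W0 G0 H0 where 0: "zopen W0" "q0 \<in> W0" "\<And>r. r \<in> U \<inter> W0 \<Longrightarrow> ev H0 r \<noteq> 0 \<and> f r = ev G0 r / ev H0 r"
    using loc[OF q0] by blast
  have "H0 \<noteq> 0" using 0 q0 by fastforce
  then obtain G H where GH: "coprime G H" "H \<noteq> 0" "G0 * H = G * H0" by (rule coprime_quotient)
  have "ev H q \<noteq> 0 \<and> f q = ev G q / ev H q" if q: "q \<in> U" for q
  proof -
    obtain W G1 H1 where 1: "zopen W" "q \<in> W" "\<And>r. r \<in> U \<inter> W \<Longrightarrow> ev H1 r \<noteq> 0 \<and> f r = ev G1 r / ev H1 r"
      using loc[OF q] by blast
    have "G0 * H1 = G1 * H0"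
    proof (rule poly_eq_on_zopen[of "(U \<inter> W) \<inter> (U \<inter> W0)"])
      show "zopen ((U \<inter> W) \<inter> (U \<inter> W0))" using 0 1 U by (intro zopen_Int)
      show "(U \<inter> W) \<inter> (U \<inter> W0) \<noteq> {}" using 0 1 U q q0 by (intro zopen_meet zopen_Int) auto
      fix r assume "r \<in> U \<inter> W \<inter> (U \<inter> W0)"
      then have "ev H0 r \<noteq> 0" "f r = ev G0 r / ev H0 r" "ev H1 r \<noteq> 0" "f r = ev G1 r / ev H1 r"
        using 0(3) 1(3) by blast+
      then show "ev (G0 * H1) r = ev (G1 * H0) r" by (simp add: field_simps)
    qed
    have "H0 * (G * H1) = (G * H0) * H1" by (simp add: ac_simps)
    also have "\<dots> = (G0 * H1) * H" unfolding GH(3)[symmetric] by (simp add: ac_simps)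
    also have "\<dots> = H0 * (G1 * H)" unfolding \<open>G0 * H1 = G1 * H0\<close> by (simp add: ac_simps)
    finally have "H0 * (G * H1) = H0 * (G1 * H)" .
    then have eq: "G * H1 = G1 * H" using \<open>H0 \<noteq> 0\<close> mult_left_cancel by blast
    then have "H dvd G * H1" by simp
    then have "H dvd H1" using GH(1) by (simp add: coprime_commute coprime_dvd_mult_right_iff)
    then obtain K where "H1 = H * K" by (elim dvdE)
    moreover have "ev H1 q \<noteq> 0" using 1(2,3) q by blast
    ultimately have "ev H q \<noteq> 0" by auto
    moreover have "ev G q * ev H1 q = ev G1 q * ev H q" using eq by (metis ev_simps(4))
    ultimately show ?thesis using 1(2) 1(3)[of q] q by (simp add: frac_eq_eq)
  qed
  then show ?thesis using U unfolding zreg_def by blast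
qed

lemma zreg_subset: "zreg U f \<Longrightarrow> zopen V \<Longrightarrow> V \<subseteq> U \<Longrightarrow> zreg V f" by (fastforce simp: zreg_def)

lemma zreg_cong: "(\<And>q. q \<in> U \<Longrightarrow> f q = g q) \<Longrightarrow> zreg U f \<Longrightarrow> zreg U g" by (fastforce simp: zreg_def)

lemma zreg_const: "zopen U \<Longrightarrow> zreg U (\<lambda>_. c)"
  unfolding zreg_def by (intro conjI exI[of _ "bC c"] exI[of _ 1]) auto

lemma zreg_mult: assumes "zreg U f" "zreg U g" shows "zreg U (\<lambda>q. f q * g q)"
proof -
  obtain G H G' H' where "\<forall>q\<in>U. ev H q \<noteq> 0 \<and> f q = ev G q / ev H q" "\<forall>q\<in>U. ev H' q \<noteq> 0 \<and> g q = ev G' q / ev H' q"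
    using assms by (auto simp: zreg_def)
  then show ?thesis using assms(1) unfolding zreg_def by (intro conjI exI[of _ "G * G'"] exI[of _ "H * H'"]) auto
qed

lemma zreg_add: assumes "zreg U f" "zreg U g" shows "zreg U (\<lambda>q. f q + g q)"
proof -
  obtain G H G' H' where "\<forall>q\<in>U. ev H q \<noteq> 0 \<and> f q = ev G q / ev H q" "\<forall>q\<in>U. ev H' q \<noteq> 0 \<and> g q = ev G' q / ev H' q"
    using assms by (auto simp: zreg_def)
  then show ?thesis using assms(1) unfolding zreg_def
    by (intro conjI exI[of _ "G * H' + G' * H"] exI[of _ "H * H'"]) (simp_all add: add_frac_eq)
qed

lemma zreg_identity:
  assumes "zreg U f" "zreg U g" "zopen W" "W \<noteq> {}" "W \<subseteq> U" "\<And>q. q \<in> W \<Longrightarrow> f q = g q" "q \<in> U"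
  shows "f q = g q"
proof -
  obtain G H G' H' where fg: "\<forall>q\<in>U. ev H q \<noteq> 0 \<and> f q = ev G q / ev H q" "\<forall>q\<in>U. ev H' q \<noteq> 0 \<and> g q = ev G' q / ev H' q"
    using assms by (auto simp: zreg_def)
  have "G * H' = G' * H"
  proof (rule poly_eq_on_zopen[OF assms(3,4)])
    fix q assume q: "q \<in> W"
    then have "ev H q \<noteq> 0" "f q = ev G q / ev H q" "ev H' q \<noteq> 0" "g q = ev G' q / ev H' q" "f q = g q"
      using assms(5) assms(6)[OF q] fg by blast+
    then show "ev (G * H') q = ev (G' * H) q" by (simp add: frac_eq_eq)
  qed
  then have "ev G q * ev H' q = ev G' q * ev H q" by (metis ev_simps(4))
  then show ?thesis using fg assms(7) by (simp add: frac_eq_eq)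
qed

section \<open>The Zariski topology of an affine set\<close>

lemma polynomials_power: "f \<in> polynomials C \<Longrightarrow> (\<lambda>p. f p ^ n) \<in> polynomials C"
  by (induction n) (auto intro: polynomials.intros)

lemma polynomials_sum: "(\<And>i. i \<in> A \<Longrightarrow> f i \<in> polynomials C) \<Longrightarrow> (\<lambda>p. \<Sum>i\<in>A. f i p) \<in> polynomials C"
  by (induction A rule: infinite_finite_induct) (auto intro: polynomials.intros)

text \<open>Principal open sets form a basis, as a product of polynomials vanishes where a factor does.\<close>

lemma openin_zariski:
  "openin (zariski V C) U \<longleftrightarrow> U \<subseteq> V \<and> (\<forall>p\<in>U. \<exists>f\<in>polynomials C. f p \<noteq> 0 \<and> {q\<in>V. f q \<noteq> 0} \<subseteq> U)" (is "?L \<longleftrightarrow> ?R U")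
proof
  assume ?L
  then have "generate_topology_on {{p \<in> V. f p \<noteq> 0} | f. f \<in> polynomials C} U"
    by (simp add: zariski_def openin_topology_generated_by_iff)
  then show "?R U"
  proof (induction rule: generate_topology_on.induct)
    case (Int a b)
    show ?case
    proof (intro conjI ballI)
      show "a \<inter> b \<subseteq> V" using Int by blast
      fix p assume "p \<in> a \<inter> b"
      then obtain f g where "f \<in> polynomials C" "f p \<noteq> 0" "{q\<in>V. f q \<noteq> 0} \<subseteq> a"
         "g \<in> polynomials C" "g p \<noteq> 0" "{q\<in>V. g q \<noteq> 0} \<subseteq> b" using Int.IH(1)[THEN conjunct2, THEN bspec, of p] Int.IH(2)[THEN conjunct2, THEN bspec, of p]
        by auto
      then show "\<exists>f\<in>polynomials C. f p \<noteq> 0 \<and> {q\<in>V. f q \<noteq> 0} \<subseteq> a \<inter> b"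
        by (intro bexI[of _ "\<lambda>p. f p * g p"]) (auto intro: polynomials.mult)
    qed
  next
    case (UN K)
    show ?case
    proof (intro conjI ballI)
      show "\<Union>K \<subseteq> V" using UN.IH by auto
      fix p assume "p \<in> \<Union>K"
      then obtain a where a: "a \<in> K" "p \<in> a" by blast
      then show "\<exists>f\<in>polynomials C. f p \<noteq> 0 \<and> {q\<in>V. f q \<noteq> 0} \<subseteq> \<Union>K"
        using UN.IH[OF a(1), THEN conjunct2, THEN bspec, OF a(2)] by blast
    qed
  qed auto
next
  assume R: "?R U"
  have "U = \<Union>{{q\<in>V. f q \<noteq> 0} | f. f \<in> polynomials C \<and> {q\<in>V. f q \<noteq> 0} \<subseteq> U}"
    using R by blast
  moreover have "openin (zariski V C) \<dots>"
    unfolding zariski_def by (intro openin_Union) (auto intro!: topology_generated_by_Basis)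
  ultimately show ?L by simp
qed

lemma topspace_zariski [simp]: "topspace (zariski V C) = V"
proof -
  have "openin (zariski V C) V"
    unfolding openin_zariski by (auto intro!: bexI[of _ "\<lambda>_. 1"] polynomials.const)
  moreover have "topspace (zariski V C) \<subseteq> V" using openin_topspace[of "zariski V C"] unfolding openin_zariski by blast
  ultimately show ?thesis using openin_subset by blast
qed

lemma polynomials_plane_ev: "f \<in> polynomials {fst, snd} \<Longrightarrow> \<exists>P. f = ev P"
proof (induction rule: polynomials.induct)
  case (coord f)
  have "fst = ev bX" "snd = ev bY" by (simp_all add: fun_eq_iff)
  with coord show ?case by blast
next
  case (const c) then show ?case by (intro exI[of _ "bC c"]) auto
next
  case (add f g) then show ?case by (metis (no_types, opaque_lifting) ev_simps(3) ext)
next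
  case (mult f g) then show ?case by (metis (no_types, opaque_lifting) ev_simps(4) ext)
qed

lemma ev_subst_polynomials:
  assumes "X \<in> polynomials C" "Y \<in> polynomials C" shows "(\<lambda>p. ev P (X p, Y p)) \<in> polynomials C"
proof -
  have "(\<lambda>p. poly c (X p)) \<in> polynomials C" for c
    by (induction c) (auto intro!: polynomials.const polynomials.add polynomials.mult assms)
  then show ?thesis unfolding ev_def fst_conv snd_conv
  proof (induction P)
    case (pCons a P)
    have "(\<lambda>p. poly a (X p) + Y p * poly (poly P [:Y p:]) (X p)) \<in> polynomials C"
      using pCons by (intro polynomials.add polynomials.mult assms) auto
    then show ?case by simp
  qed (auto intro: polynomials.intros)
qed

section \<open>Valuations on the field of rational functions of the plane\<close>

type_synonym ratpoly = "bpoly fract"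

text \<open>The order of vanishing along the curve \<open>p = 0\<close>.\<close>

definition val :: "bpoly \<Rightarrow> ratpoly \<Rightarrow> int" where
  "val p x = int (multiplicity p (fst (quot_of_fract x))) - int (multiplicity p (snd (quot_of_fract x)))"

lemma Fract_reducedE:
  fixes x :: ratpoly
  obtains G H where "x = Fract G H" "H \<noteq> 0" "coprime G H"
proof -
  obtain G0 H0 where 0: "x = Fract G0 H0" "H0 \<noteq> 0" by (cases x)
  obtain G H where GH: "coprime G H" "H \<noteq> 0" "G0 * H = G * H0" by (rule coprime_quotient[OF 0(2)])
  then have "x = Fract G H" using 0 by (simp add: eq_fract)
  with GH show thesis using that by blast
qed

lemma val_Fract:
  assumes p: "irreducible p" and nz: "G \<noteq> 0" "H \<noteq> 0"
  shows "val p (Fract G H) = int (multiplicity p G) - int (multiplicity p H)"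
proof -
  define a b where "a = fst (quot_of_fract (Fract G H))" and "b = snd (quot_of_fract (Fract G H))"
  have b: "b \<noteq> 0" by (simp add: b_def)
  have "Fract a b = Fract G H"
    using quot_to_fract_quot_of_fract[of "Fract G H"] by (simp add: quot_to_fract_def a_def b_def case_prod_unfold)
  then have eq: "a * H = G * b" using b nz by (simp add: eq_fract)
  have prime: "prime_elem p" using p by (rule irreducible_imp_prime_elem)
  have "a \<noteq> 0" using eq b nz by auto
  then have "multiplicity p a + multiplicity p H = multiplicity p G + multiplicity p b"
    using arg_cong[OF eq, of "multiplicity p"] prime_elem_multiplicity_mult_distrib[OF prime] b nz by simp
  then show ?thesis by (simp add: val_def flip: a_def b_def)
qed

lemma Fract_eq_0_iff: "H \<noteq> 0 \<Longrightarrow> Fract G H = 0 \<longleftrightarrow> G = 0"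
  by (simp add: Zero_fract_def eq_fract)

lemma val_mult:
  assumes p: "irreducible p" and "x \<noteq> 0" "y \<noteq> 0"
  shows "val p (x * y) = val p x + val p y"
proof -
  obtain a b c d where xy: "x = Fract a b" "b \<noteq> 0" "y = Fract c d" "d \<noteq> 0" by (metis Fract_cases)
  then have nz: "a \<noteq> 0" "c \<noteq> 0" using assms by (auto simp: Fract_eq_0_iff)
  have "prime_elem p" using p by (rule irreducible_imp_prime_elem)
  then show ?thesis
    using nz xy by (simp add: val_Fract[OF p] prime_elem_multiplicity_mult_distrib)
qed

lemma val_one [simp]: "irreducible p \<Longrightarrow> val p 1 = 0"
  by (simp add: One_fract_def val_Fract)

lemma val_inverse:
  assumes p: "irreducible p" and "x \<noteq> 0" shows "val p (inverse x) = - val p x"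
  using val_mult[OF p assms(2), of "inverse x"] assms by simp

lemma val_power: "irreducible p \<Longrightarrow> x \<noteq> 0 \<Longrightarrow> val p (x ^ n) = int n * val p x"
  by (induction n) (auto simp: val_mult algebra_simps)

lemma val_powi: "irreducible p \<Longrightarrow> x \<noteq> 0 \<Longrightarrow> val p (x powi n) = n * val p x"
  by (cases n rule: int_cases4) (auto simp: power_int_minus val_inverse val_power)

lemma val_add:
  assumes p: "irreducible p" and nz: "x \<noteq> 0" "y \<noteq> 0" "x + y \<noteq> 0" and n: "n \<le> val p x" "n \<le> val p y"
  shows "n \<le> val p (x + y)"
proof -
  obtain a b c d where xy: "x = Fract a b" "b \<noteq> 0" "y = Fract c d" "d \<noteq> 0" by (metis Fract_cases)
  have ac: "a \<noteq> 0" "c \<noteq> 0" using xy nz by (auto simp: Fract_eq_0_iff)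
  have s: "x + y = Fract (a * d + c * b) (b * d)" using xy by simp
  have snz: "a * d + c * b \<noteq> 0" using s nz(3) xy by (auto simp: Fract_eq_0_iff)
  have prime: "prime_elem p" using p by (rule irreducible_imp_prime_elem)
  then have nu: "\<not> is_unit p" by auto
  define m where "m = min (multiplicity p (a * d)) (multiplicity p (c * b))"
  have "p ^ m dvd a * d" "p ^ m dvd c * b" unfolding m_def by (auto intro: multiplicity_dvd')
  then have "p ^ m dvd a * d + c * b" by (rule dvd_add)
  then have "m \<le> multiplicity p (a * d + c * b)" using snz nu by (intro multiplicity_geI)
  moreover have "int m \<ge> n + int (multiplicity p b) + int (multiplicity p d)"
    using n ac xy unfolding m_def
    by (auto simp: val_Fract[OF p] prime_elem_multiplicity_mult_distrib[OF prime] min_def)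
  ultimately show ?thesis
    using snz xy unfolding s by (simp add: val_Fract[OF p] prime_elem_multiplicity_mult_distrib[OF prime])
qed

lemma val_poly: "irreducible p \<Longrightarrow> f \<noteq> 0 \<Longrightarrow> val p (to_fract f) = int (multiplicity p f)"
  by (simp add: to_fract_def val_Fract)

lemma val_self: "irreducible p \<Longrightarrow> val p (to_fract p) = 1"
  using multiplicity_prime[OF irreducible_imp_prime_elem, of p] irreducible_imp_prime_elem[of p]
  by (simp add: val_poly)

lemma val_coprime_nonneg_iff:
  assumes p: "irreducible p" and GH: "coprime G H" "H \<noteq> 0" "G \<noteq> 0"
  shows "0 \<le> val p (Fract G H) \<longleftrightarrow> \<not> p dvd H" "0 < val p (Fract G H) \<longleftrightarrow> p dvd G"
proof -
  have nu: "\<not> is_unit p" using p by (auto simp: irreducible_def)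
  have "\<not> (p dvd G \<and> p dvd H)" using GH(1) nu coprime_common_divisor by blast
  moreover have "p dvd f \<longleftrightarrow> multiplicity p f > 0" if "f \<noteq> 0" for f
    using that nu by (simp add: multiplicity_gt_zero_iff)
  ultimately show "0 \<le> val p (Fract G H) \<longleftrightarrow> \<not> p dvd H" "0 < val p (Fract G H) \<longleftrightarrow> p dvd G"
    using GH by (auto simp: val_Fract[OF p])
qed

lemma irreducible_factor_exists:
  fixes f :: bpoly assumes "f \<noteq> 0" "\<not> is_unit f" obtains p where "irreducible p" "p dvd f"
  using prime_divisor_exists[OF assms] that by (auto intro: prime_elem_imp_irreducible)

text \<open>In a reduced quotient every irreducible factor of the denominator is a pole.\<close>

lemma val_nonneg_imp_poly:
  fixes x :: ratpoly
  assumes "\<And>p. irreducible p \<Longrightarrow> 0 \<le> val p x" obtains g where "x = to_fract g"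
proof -
  obtain G H where x: "x = Fract G H" "H \<noteq> 0" "coprime G H" by (rule Fract_reducedE)
  show thesis
  proof (cases "G = 0")
    case True then show ?thesis using that[of 0] x by (simp add: Zero_fract_def eq_fract to_fract_def)
  next
    case False
    have "is_unit H"
    proof (rule ccontr)
      assume "\<not> is_unit H"
      then obtain p where "irreducible p" "p dvd H" using irreducible_factor_exists[OF x(2)] by blast
      then show False using assms[of p] val_coprime_nonneg_iff(1)[of p G H] x False by auto
    qed
    then obtain K where "H * K = 1" by (metis dvdE)
    then have "x = to_fract (G * K)"
      using x by (simp add: to_fract_def eq_fract ac_simps)
    then show ?thesis by (rule that)
  qed
qed

lemma val_associated:
  assumes "irreducible p" "irreducible q" "p dvd q" shows "val p x = val q x"
proof -
  have "q dvd p" using assms irreducibleD'[of q p] by (auto simp: irreducible_def)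
  then have "p ^ n dvd f \<longleftrightarrow> q ^ n dvd f" for n f
    using assms(3) by (meson dvd_power_same dvd_trans)
  then have "multiplicity p f = multiplicity q f" for f by (simp add: multiplicity_def)
  then show ?thesis by (simp add: val_def)
qed

text \<open>The local ring of the plane at \<open>q\<close>, and evaluation of its elements. The denominator may depend
  on \<open>q\<close>, which makes \<open>evf\<close> a ring homomorphism without reference to reduced quotients.\<close>

definition at_point :: "C2 \<Rightarrow> ratpoly set" where
  "at_point q = {Fract G H | G H. ev H q \<noteq> 0}"

definition evf :: "ratpoly \<Rightarrow> C2 \<Rightarrow> complex" where
  "evf x q = (THE c. \<exists>G H. x = Fract G H \<and> ev H q \<noteq> 0 \<and> c = ev G q / ev H q)"

lemma evf_Fract: assumes "ev H q \<noteq> 0" shows "evf (Fract G H) q = ev G q / ev H q"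
  unfolding evf_def
proof (rule the_equality)
  fix c assume "\<exists>G' H'. Fract G H = Fract G' H' \<and> ev H' q \<noteq> 0 \<and> c = ev G' q / ev H' q"
  then obtain G' H' where *: "Fract G H = Fract G' H'" "ev H' q \<noteq> 0" "c = ev G' q / ev H' q" by blast
  have "H \<noteq> 0" "H' \<noteq> 0" using assms * by auto
  then have "G * H' = G' * H" using * by (simp add: eq_fract)
  then have "ev G q * ev H' q = ev G' q * ev H q" by (metis ev_simps(4))
  then show "c = ev G q / ev H q" using * assms by (simp add: frac_eq_eq)
qed (use assms in blast)

lemma at_pointI: "ev H q \<noteq> 0 \<Longrightarrow> Fract G H \<in> at_point q" by (auto simp: at_point_def)

lemma at_pointE:
  assumes "x \<in> at_point q" obtains G H where "x = Fract G H" "ev H q \<noteq> 0" "H \<noteq> 0" "evf x q = ev G q / ev H q"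
proof -
  obtain G H where "x = Fract G H" "ev H q \<noteq> 0" using assms by (auto simp: at_point_def)
  moreover from this have "H \<noteq> 0" by auto
  ultimately show thesis using that evf_Fract by blast
qed

lemma at_point_mult:
  assumes "x \<in> at_point q" "y \<in> at_point q"
  shows "x * y \<in> at_point q" "evf (x * y) q = evf x q * evf y q"
proof -
  obtain G H where x: "x = Fract G H" "ev H q \<noteq> 0" "H \<noteq> 0" "evf x q = ev G q / ev H q" using assms(1) by (rule at_pointE)
  obtain G' H' where y: "y = Fract G' H'" "ev H' q \<noteq> 0" "H' \<noteq> 0" "evf y q = ev G' q / ev H' q" using assms(2) by (rule at_pointE)
  have "x * y = Fract (G * G') (H * H')" using x y by simp
  with x y show "x * y \<in> at_point q" "evf (x * y) q = evf x q * evf y q" by (auto simp: at_pointI evf_Fract)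
qed

lemma at_point_add:
  assumes "x \<in> at_point q" "y \<in> at_point q"
  shows "x + y \<in> at_point q" "evf (x + y) q = evf x q + evf y q"
proof -
  obtain G H where x: "x = Fract G H" "ev H q \<noteq> 0" "H \<noteq> 0" "evf x q = ev G q / ev H q" using assms(1) by (rule at_pointE)
  obtain G' H' where y: "y = Fract G' H'" "ev H' q \<noteq> 0" "H' \<noteq> 0" "evf y q = ev G' q / ev H' q" using assms(2) by (rule at_pointE)
  have "x + y = Fract (G * H' + G' * H) (H * H')" using x y by simp
  with x y show "x + y \<in> at_point q" "evf (x + y) q = evf x q + evf y q"
    by (auto simp: at_pointI evf_Fract add_frac_eq)
qed

lemma at_point_poly [simp]: "to_fract f \<in> at_point q" "evf (to_fract f) q = ev f q"
  by (simp_all add: to_fract_def at_pointI evf_Fract)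

lemma at_point_inverse:
  assumes "x \<in> at_point q" "evf x q \<noteq> 0"
  shows "inverse x \<in> at_point q" "evf (inverse x) q = inverse (evf x q)"
proof -
  obtain G H where x: "x = Fract G H" "ev H q \<noteq> 0" "H \<noteq> 0" "evf x q = ev G q / ev H q" using assms(1) by (rule at_pointE)
  then have "inverse x = Fract H G" "ev G q \<noteq> 0" using assms(2) by auto
  with x show "inverse x \<in> at_point q" "evf (inverse x) q = inverse (evf x q)" by (auto simp: at_pointI evf_Fract)
qed

lemma at_point_power:
  "x \<in> at_point q \<Longrightarrow> x ^ n \<in> at_point q \<and> evf (x ^ n) q = evf x q ^ n"
  using at_point_poly[of 1 q] by (induction n) (auto simp: at_point_mult)

lemma at_point_powi:
  assumes "x \<in> at_point q" "evf x q \<noteq> 0"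
  shows "x powi n \<in> at_point q" "evf (x powi n) q = evf x q powi n"
  using at_point_power[OF assms(1)] at_point_inverse[OF assms]
    at_point_power[OF at_point_inverse(1)[OF assms]]
  by (cases n rule: int_cases4; simp add: power_int_minus power_inverse[symmetric])+

lemma at_point_sum:
  "(\<And>i. i \<in> A \<Longrightarrow> f i \<in> at_point q) \<Longrightarrow> sum f A \<in> at_point q \<and> evf (sum f A) q = (\<Sum>i\<in>A. evf (f i) q)"
  using at_point_poly[of 0 q] by (induction A rule: infinite_finite_induct) (auto simp: at_point_add)

lemma evf_eqI:
  assumes W: "zopen W" "W \<noteq> {}"
    and eq: "\<And>q. q \<in> W \<Longrightarrow> x \<in> at_point q \<and> y \<in> at_point q \<and> evf x q = evf y q"
  shows "x = y"
proof -
  obtain a b c d where xy: "x = Fract a b" "b \<noteq> 0" "y = Fract c d" "d \<noteq> 0" by (metis Fract_cases)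
  have "a * d = c * b"
  proof (rule poly_eq_on_zopen)
    show "zopen (W \<inter> {q. ev (b * d) q \<noteq> 0})" using W by (intro zopen_Int zopen_basic)
    obtain q where "ev (b * d) q \<noteq> 0" using xy by (metis ev_nonzero no_zero_divisors)
    then have "{q. ev (b * d) q \<noteq> 0} \<noteq> {}" by blast
    then show "W \<inter> {q. ev (b * d) q \<noteq> 0} \<noteq> {}" using W by (intro zopen_meet zopen_basic)
    fix q assume q: "q \<in> W \<inter> {q. ev (b * d) q \<noteq> 0}"
    then have "ev b q \<noteq> 0" "ev d q \<noteq> 0" "evf x q = evf y q" using eq by auto
    then show "ev (a * d) q = ev (c * b) q" using xy by (simp add: evf_Fract frac_eq_eq)
  qed
  then show ?thesis using xy by (simp add: eq_fract)
qed

lemma zeros_irreducible: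
  assumes p: "irreducible p" and "zopen U" "zopen V" "U \<inter> zeros p \<noteq> {}" "V \<inter> zeros p \<noteq> {}"
  shows "U \<inter> V \<inter> zeros p \<noteq> {}"
proof -
  obtain q r where qr: "q \<in> U" "q \<in> zeros p" "r \<in> V" "r \<in> zeros p" using assms by blast
  obtain P Q where PQ: "ev P q \<noteq> 0" "{q. ev P q \<noteq> 0} \<subseteq> U" "ev Q r \<noteq> 0" "{q. ev Q q \<noteq> 0} \<subseteq> V"
    using assms(2,3) qr unfolding zopen_def by blast
  have "\<not> p dvd P" "\<not> p dvd Q" using qr PQ by (auto simp: zeros_def elim!: dvdE)
  then have "\<not> p dvd P * Q" using prime_elem_dvd_multD[OF irreducible_imp_prime_elem[OF p]] by blast
  then have "\<not> zeros p \<subseteq> zeros (P * Q)" using zeros_subset_iff[OF p] by blast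
  then show ?thesis using PQ by (auto simp: zeros_def)
qed

lemma zeros_cong_irreducible:
  assumes "irreducible p" "irreducible q" "p dvd q" shows "zeros p = zeros q"
proof -
  have "q dvd p" using assms irreducibleD'[of q p] by (auto simp: irreducible_def)
  then show ?thesis using assms zeros_subset_iff by (metis subset_antisym)
qed

text \<open>Quantified points of the plane are kept as single variables rather than split into coordinates.\<close>

declare split_paired_All [simp del] split_paired_Ex [simp del]

section \<open>Surfaces glued from two affine planes\<close>

text \<open>An irreducible surface covered by two open affine planes. The transition between the charts is
  not recorded: compatibility is expressed by letting each chart see the same open sets and regular
  functions. The boolean index names the chart.\<close>

locale plane_atlas =
  fixes Y :: "'a fspace" and \<psi> :: "bool \<Rightarrow> C2 \<Rightarrow> 'a"
  assumes inj: "inj (\<psi> i)"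
    and cover: "points Y = range (\<psi> True) \<union> range (\<psi> False)"
    and open_preim: "openin (ztop Y) V \<Longrightarrow> zopen (\<psi> i -` V)"
    and open_image: "zopen W \<Longrightarrow> openin (ztop Y) (\<psi> i ` W)"
    and regular_open: "regular Y V f \<Longrightarrow> openin (ztop Y) V"
    and regular_preim: "regular Y V f \<Longrightarrow> zreg (\<psi> i -` V) (f \<circ> \<psi> i)"
    and regular_chart: "openin (ztop Y) V \<Longrightarrow> V \<subseteq> range (\<psi> i) \<Longrightarrow> zreg (\<psi> i -` V) (f \<circ> \<psi> i) \<Longrightarrow> regular Y V f"
    and charts_meet: "range (\<psi> True) \<inter> range (\<psi> False) \<noteq> {}"
begin

abbreviation K where "K \<equiv> function_field Y"

lemma range_points: "range (\<psi> i) \<subseteq> points Y" using cover by (cases i) auto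

lemma pointsE: assumes "p \<in> points Y" obtains j q where "p = \<psi> j q" using assms cover by auto

lemma dense: assumes U: "openin (ztop Y) U" "U \<noteq> {}" shows "\<psi> i -` U \<noteq> {}"
proof -
  obtain p where p: "p \<in> U" using U by blast
  then obtain j q where q: "p = \<psi> j q" using U openin_subset pointsE by blast
  have "\<psi> j -` U \<inter> \<psi> j -` range (\<psi> i) \<noteq> {}"
  proof (rule zopen_meet)
    show "zopen (\<psi> j -` U)" "zopen (\<psi> j -` range (\<psi> i))"
      using U open_preim open_image[OF zopen_UNIV] by auto
    show "\<psi> j -` U \<noteq> {}" using p q by auto
    obtain r r' where "\<psi> True r = \<psi> False r'" using charts_meet by (auto simp: image_def)
    then have "\<psi> True r \<in> range (\<psi> False)" "\<psi> False r' \<in> range (\<psi> True)" by (simp, metis rangeI)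
    then have "\<exists>s. \<psi> j s \<in> range (\<psi> i)" by (cases i; cases j; simp; blast)
    then show "\<psi> j -` range (\<psi> i) \<noteq> {}" by blast
  qed
  then show ?thesis by auto
qed

lemma open_meet: assumes "openin (ztop Y) U" "openin (ztop Y) V" "U \<noteq> {}" "V \<noteq> {}" shows "U \<inter> V \<noteq> {}"
proof -
  have "\<psi> True -` U \<inter> \<psi> True -` V \<noteq> {}" using assms by (intro zopen_meet open_preim dense)
  then show ?thesis by auto
qed

text \<open>Sums and products of regular functions are easily seen to be chartwise regular, and this suffices
  for the identity principle \<open>chartwise_identity\<close>.\<close>

definition chartwise_regular where
  "chartwise_regular V f \<longleftrightarrow> openin (ztop Y) V \<and> (\<forall>i. zreg (\<psi> i -` V) (f \<circ> \<psi> i))"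

lemma regular_chartwise: "regular Y V f \<Longrightarrow> chartwise_regular V f"
  using regular_open regular_preim by (auto simp: chartwise_regular_def)

lemma chartwise_subset: "chartwise_regular V f \<Longrightarrow> openin (ztop Y) W \<Longrightarrow> W \<subseteq> V \<Longrightarrow> chartwise_regular W f"
  unfolding chartwise_regular_def using zreg_subset open_preim by (metis vimage_mono)

lemma chartwise_mult: "chartwise_regular V f \<Longrightarrow> chartwise_regular V g \<Longrightarrow> chartwise_regular V (\<lambda>p. f p * g p)"
  unfolding chartwise_regular_def using zreg_mult[of "\<psi> i -` V" "f \<circ> \<psi> i" "g \<circ> \<psi> i" for i] by (auto simp: o_def)

lemma chartwise_add: "chartwise_regular V f \<Longrightarrow> chartwise_regular V g \<Longrightarrow> chartwise_regular V (\<lambda>p. f p + g p)"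
  unfolding chartwise_regular_def using zreg_add[of "\<psi> i -` V" "f \<circ> \<psi> i" "g \<circ> \<psi> i" for i] by (auto simp: o_def)

lemma chartwise_const: "openin (ztop Y) V \<Longrightarrow> chartwise_regular V (\<lambda>_. c)"
  unfolding chartwise_regular_def using zreg_const open_preim by (auto simp: o_def)

lemma chartwise_identity:
  assumes f: "chartwise_regular V f" "chartwise_regular V g" and W: "openin (ztop Y) W" "W \<noteq> {}" "W \<subseteq> V"
    and eq: "\<And>p. p \<in> W \<Longrightarrow> f p = g p" and p: "p \<in> V"
  shows "f p = g p"
proof -
  have "p \<in> points Y" using p f(1) openin_subset by (auto simp: chartwise_regular_def)
  then obtain j q where q: "p = \<psi> j q" by (rule pointsE)
  have "(f \<circ> \<psi> j) q = (g \<circ> \<psi> j) q"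
  proof (rule zreg_identity)
    show "zreg (\<psi> j -` V) (f \<circ> \<psi> j)" "zreg (\<psi> j -` V) (g \<circ> \<psi> j)" using f by (auto simp: chartwise_regular_def)
    show "zopen (\<psi> j -` W)" "\<psi> j -` W \<noteq> {}" using W open_preim dense by auto
  qed (use W eq p q in auto)
  then show ?thesis using q by simp
qed

text \<open>The rational function on the surface whose expression in the chart \<open>i\<close> is \<open>x\<close>.\<close>

definition \<Phi> :: "bool \<Rightarrow> ratpoly \<Rightarrow> 'a ratfun" where
  "\<Phi> i x = {(V, f). V \<noteq> {} \<and> regular Y V f \<and> (\<forall>q. \<psi> i q \<in> V \<longrightarrow> x \<in> at_point q \<and> evf x q = f (\<psi> i q))}"

lemma \<Phi>D:
  assumes "(V, f) \<in> \<Phi> i x"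
  shows "V \<noteq> {}" "regular Y V f" "openin (ztop Y) V"
    "\<psi> i q \<in> V \<Longrightarrow> x \<in> at_point q" "\<psi> i q \<in> V \<Longrightarrow> evf x q = f (\<psi> i q)"
  using assms by (auto simp: \<Phi>_def regular_open)

text \<open>A regular function that agrees with \<open>x\<close> on a nonempty open set agrees with it throughout the
  chart, because its expression in the chart is a single quotient.\<close>

lemma \<Phi>_ext:
  assumes "regular Y V f" "V \<noteq> {}" and W: "zopen W" "W \<noteq> {}" "W \<subseteq> \<psi> i -` V"
    and eq: "\<And>q. q \<in> W \<Longrightarrow> x \<in> at_point q \<and> evf x q = f (\<psi> i q)"
  shows "(V, f) \<in> \<Phi> i x"
proof -
  obtain G H where GH: "\<And>q. q \<in> \<psi> i -` V \<Longrightarrow> ev H q \<noteq> 0 \<and> f (\<psi> i q) = ev G q / ev H q"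
    using regular_preim[OF assms(1), of i] by (auto simp: zreg_def)
  have "Fract G H \<in> at_point q \<and> evf (Fract G H) q = f (\<psi> i q)" if "q \<in> \<psi> i -` V" for q
    using GH[OF that] by (auto simp: at_pointI evf_Fract)
  moreover from this have "x = Fract G H" using eq W by (intro evf_eqI[OF W(1,2)]) auto
  ultimately show ?thesis using assms by (auto simp: \<Phi>_def)
qed

lemma regular_in_\<Phi>:
  assumes "regular Y V f" "V \<noteq> {}" obtains x where "(V, f) \<in> \<Phi> i x"
proof -
  obtain G H where GH: "\<And>q. q \<in> \<psi> i -` V \<Longrightarrow> ev H q \<noteq> 0 \<and> f (\<psi> i q) = ev G q / ev H q"
    using regular_preim[OF assms(1), of i] by (auto simp: zreg_def)
  have "Fract G H \<in> at_point q \<and> evf (Fract G H) q = f (\<psi> i q)" if "q \<in> \<psi> i -` V" for q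
    using GH[OF that] by (auto simp: at_pointI evf_Fract)
  then show thesis using assms by (intro that[of "Fract G H"]) (auto simp: \<Phi>_def)
qed

lemma ratclass_eq_\<Phi>:
  assumes U: "chartwise_regular U f" "U \<noteq> {}"
    and eq: "\<And>q. \<psi> i q \<in> U \<Longrightarrow> x \<in> at_point q \<and> evf x q = f (\<psi> i q)"
  shows "ratclass Y U f = \<Phi> i x"
proof (intro equalityI subsetI)
  have oU: "openin (ztop Y) U" using U by (simp add: chartwise_regular_def)
  fix Vg assume "Vg \<in> ratclass Y U f"
  then obtain V g where V: "Vg = (V, g)" "V \<noteq> {}" "regular Y V g" "\<forall>p\<in>U \<inter> V. g p = f p" by (auto simp: ratclass_def)
  have o: "openin (ztop Y) (U \<inter> V)" "U \<inter> V \<noteq> {}" using oU V regular_open open_meet U by auto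
  have "(V, g) \<in> \<Phi> i x"
    by (rule \<Phi>_ext[OF V(3,2) open_preim[OF o(1)] dense[OF o]]) (use V eq in auto)
  then show "Vg \<in> \<Phi> i x" using V by simp
next
  have oU: "openin (ztop Y) U" using U by (simp add: chartwise_regular_def)
  fix Vg assume "Vg \<in> \<Phi> i x"
  then obtain V g where V: "Vg = (V, g)" "V \<noteq> {}" "regular Y V g"
    "\<And>q. \<psi> i q \<in> V \<Longrightarrow> x \<in> at_point q \<and> evf x q = g (\<psi> i q)" by (auto simp: \<Phi>_def)
  have o: "openin (ztop Y) (U \<inter> V)" "U \<inter> V \<noteq> {}" using oU V regular_open open_meet U by auto
  have "g p = f p" if p: "p \<in> U \<inter> V" for p
  proof (rule chartwise_identity[OF _ _ _ _ _ _ p])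
    show "chartwise_regular (U \<inter> V) g" "chartwise_regular (U \<inter> V) f"
      using chartwise_subset o U regular_chartwise[OF V(3)] by blast+
    show "openin (ztop Y) (U \<inter> V \<inter> range (\<psi> i))" using o open_image[OF zopen_UNIV] by blast
    show "U \<inter> V \<inter> range (\<psi> i) \<noteq> {}" using dense[OF o, of i] by auto
    show "g p = f p" if "p \<in> U \<inter> V \<inter> range (\<psi> i)" for p
      using that eq V(4) by force
  qed auto
  then show "Vg \<in> ratclass Y U f" using V by (auto simp: ratclass_def)
qed

lemma \<Phi>_in_chart:
  assumes "H \<noteq> 0"
  shows "(\<psi> i ` {q. ev H q \<noteq> 0}, \<lambda>p. evf (Fract G H) (inv_into UNIV (\<psi> i) p)) \<in> \<Phi> i (Fract G H)"
proof -
  obtain q where "ev H q \<noteq> 0" using assms by (rule ev_nonzero)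
  moreover have "regular Y (\<psi> i ` {q. ev H q \<noteq> 0}) (\<lambda>p. evf (Fract G H) (inv_into UNIV (\<psi> i) p))"
  proof (rule regular_chart)
    show "zreg (\<psi> i -` \<psi> i ` {q. ev H q \<noteq> 0}) ((\<lambda>p. evf (Fract G H) (inv_into UNIV (\<psi> i) p)) \<circ> \<psi> i)"
      unfolding zreg_def inj_vimage_image_eq[OF inj]
      by (intro conjI exI[of _ G] exI[of _ H]) (auto simp: inv_f_f[OF inj] evf_Fract)
  qed (auto simp: open_image)
  ultimately show ?thesis
    by (auto simp: \<Phi>_def inj_image_mem_iff[OF inj] inv_f_f[OF inj] at_pointI)
qed

lemma \<Phi>_nonempty: "\<exists>V f. (V, f) \<in> \<Phi> i x"
  using \<Phi>_in_chart by (metis Fract_cases)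

lemma \<Phi>_eqI: assumes "(V, f) \<in> \<Phi> i x" shows "ratclass Y V f = \<Phi> i x"
  using \<Phi>D[OF assms] by (intro ratclass_eq_\<Phi> regular_chartwise) auto

lemma inj_\<Phi>: "inj (\<Phi> i)"
proof (rule injI)
  fix x y assume eq: "\<Phi> i x = \<Phi> i y"
  obtain V f where V: "(V, f) \<in> \<Phi> i x" using \<Phi>_nonempty by blast
  then have o: "openin (ztop Y) V" "V \<noteq> {}" by (auto simp: \<Phi>_def regular_open)
  show "x = y"
    by (rule evf_eqI[OF open_preim[OF o(1)] dense[OF o]]) (use V V[unfolded eq] in \<open>auto simp: \<Phi>_def\<close>)
qed

lemma \<Phi>_eq_iff [simp]: "\<Phi> i x = \<Phi> i y \<longleftrightarrow> x = y" using inj_\<Phi> by (auto dest: injD)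

text \<open>The domain of a regular function meets either chart, and there the function is a quotient of
  polynomials.\<close>

lemma carrier_K: "carrier K = range (\<Phi> i)"
proof (intro equalityI subsetI)
  fix a assume "a \<in> carrier K"
  then obtain U f where a: "a = ratclass Y U f" "U \<noteq> {}" "regular Y U f" by (auto simp: function_field_def)
  obtain x where "(U, f) \<in> \<Phi> i x" using regular_in_\<Phi>[OF a(3,2)] by blast
  then show "a \<in> range (\<Phi> i)" using \<Phi>_eqI a by auto
next
  fix a assume "a \<in> range (\<Phi> i)"
  then obtain x where a: "a = \<Phi> i x" by blast
  obtain V f where V: "(V, f) \<in> \<Phi> i x" using \<Phi>_nonempty by blast
  then have "a = ratclass Y V f" "V \<noteq> {}" "regular Y V f" using \<Phi>_eqI[OF V] \<Phi>D[OF V] a by auto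
  then show "a \<in> carrier K" by (auto simp: function_field_def)
qed

lemma \<Phi>_carrier [simp]: "\<Phi> i x \<in> carrier K" using carrier_K by blast

lemma zero_K: "\<zero>\<^bsub>K\<^esub> = \<Phi> i 0" and one_K: "\<one>\<^bsub>K\<^esub> = \<Phi> i 1"
proof -
  have ne: "points Y \<noteq> {}" using range_points[of i] by auto
  have "ratclass Y (points Y) (\<lambda>_. 0) = \<Phi> i 0"
    by (intro ratclass_eq_\<Phi> chartwise_const ne) (use at_point_poly[of 0] in auto)
  then show "\<zero>\<^bsub>K\<^esub> = \<Phi> i 0" by (simp add: function_field_def)
  have "ratclass Y (points Y) (\<lambda>_. 1) = \<Phi> i 1"
    by (intro ratclass_eq_\<Phi> chartwise_const ne) (use at_point_poly[of 1] in auto)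
  then show "\<one>\<^bsub>K\<^esub> = \<Phi> i 1" by (simp add: function_field_def)
qed

lemma \<Phi>_binop:
  assumes cw: "\<And>V f g. chartwise_regular V f \<Longrightarrow> chartwise_regular V g \<Longrightarrow> chartwise_regular V (\<lambda>p. op (f p) (g p))"
    and at: "\<And>q. x \<in> at_point q \<Longrightarrow> y \<in> at_point q \<Longrightarrow> z \<in> at_point q \<and> evf z q = op (evf x q) (evf y q)"
  shows "(\<Union>(U, f)\<in>\<Phi> i x. \<Union>(V, g)\<in>\<Phi> i y. ratclass Y (U \<inter> V) (\<lambda>p. op (f p) (g p))) = \<Phi> i z"
proof -
  have *: "ratclass Y (U \<inter> V) (\<lambda>p. op (f p) (g p)) = \<Phi> i z" if U: "(U, f) \<in> \<Phi> i x" "(V, g) \<in> \<Phi> i y" for U V f g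
  proof (rule ratclass_eq_\<Phi>)
    have r: "regular Y U f" "regular Y V g" "U \<noteq> {}" "V \<noteq> {}" using U by (auto simp: \<Phi>_def)
    then have o: "openin (ztop Y) (U \<inter> V)" using regular_open by blast
    show "U \<inter> V \<noteq> {}" using r regular_open open_meet by blast
    show "chartwise_regular (U \<inter> V) (\<lambda>p. op (f p) (g p))"
      using r o by (intro cw) (auto intro: chartwise_subset regular_chartwise)
    show "z \<in> at_point q \<and> evf z q = op (f (\<psi> i q)) (g (\<psi> i q))" if "\<psi> i q \<in> U \<inter> V" for q
      using at[of q] that \<Phi>D(4,5)[OF U(1), of q] \<Phi>D(4,5)[OF U(2), of q] by auto
  qed
  obtain U f V g where "(U, f) \<in> \<Phi> i x" "(V, g) \<in> \<Phi> i y" using \<Phi>_nonempty by meson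
  then show ?thesis using * by (auto split: prod.splits) blast
qed

lemma mult_\<Phi>: "\<Phi> i x \<otimes>\<^bsub>K\<^esub> \<Phi> i y = \<Phi> i (x * y)"
  using \<Phi>_binop[where op = "(*)" and x = x and y = y and z = "x * y" and i = i] chartwise_mult at_point_mult
  by (simp add: function_field_def)

lemma add_\<Phi>: "\<Phi> i x \<oplus>\<^bsub>K\<^esub> \<Phi> i y = \<Phi> i (x + y)"
  using \<Phi>_binop[where op = "(+)" and x = x and y = y and z = "x + y" and i = i] chartwise_add at_point_add
  by (simp add: function_field_def)

lemma smult_\<Phi>: "c \<odot>\<^bsub>K\<^esub> \<Phi> i x = \<Phi> i (to_fract (bC c) * x)"
proof -
  have *: "ratclass Y U (\<lambda>p. c * f p) = \<Phi> i (to_fract (bC c) * x)" if U: "(U, f) \<in> \<Phi> i x" for U f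
  proof (rule ratclass_eq_\<Phi>)
    have r: "regular Y U f" "U \<noteq> {}" using U by (auto simp: \<Phi>_def)
    then show "U \<noteq> {}" "chartwise_regular U (\<lambda>p. c * f p)"
      using regular_open by (auto intro!: chartwise_mult chartwise_const intro: regular_chartwise)
    show "to_fract (bC c) * x \<in> at_point q \<and> evf (to_fract (bC c) * x) q = c * f (\<psi> i q)" if "\<psi> i q \<in> U" for q
      using that \<Phi>D(4,5)[OF U, of q] by (auto simp: at_point_mult)
  qed
  obtain U f where "(U, f) \<in> \<Phi> i x" using \<Phi>_nonempty by meson
  then have "(\<Union>(U, f)\<in>\<Phi> i x. ratclass Y U (\<lambda>p. c * f p)) = \<Phi> i (to_fract (bC c) * x)"
    using * by (auto split: prod.splits)
  then show ?thesis by (simp add: function_field_def)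
qed

lemma K_cases: assumes "a \<in> carrier K" obtains x where "a = \<Phi> i x" using assms carrier_K by blast

lemma cring_K: "cring K"
proof (intro cringI abelian_groupI comm_monoidI)
  show "\<exists>y\<in>carrier K. y \<oplus>\<^bsub>K\<^esub> x = \<zero>\<^bsub>K\<^esub>" if "x \<in> carrier K" for x
  proof -
    obtain t where "x = \<Phi> True t" using \<open>x \<in> carrier K\<close> by (rule K_cases)
    then show ?thesis by (intro bexI[of _ "\<Phi> True (- t)"]) (auto simp: add_\<Phi> zero_K[of True])
  qed
qed (auto simp: carrier_K[of True] add_\<Phi> mult_\<Phi> zero_K[of True] one_K[of True] algebra_simps)

lemma inv_\<Phi>: assumes "x \<noteq> 0" shows "inv\<^bsub>K\<^esub> (\<Phi> i x) = \<Phi> i (inverse x)"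
proof -
  interpret cring K by (rule cring_K)
  show ?thesis using assms by (intro comm_inv_char) (auto simp: mult_\<Phi> one_K[of i])
qed

lemma pow_nat_\<Phi>: "\<Phi> i x [^]\<^bsub>K\<^esub> (n::nat) = \<Phi> i (x ^ n)"
proof -
  interpret cring K by (rule cring_K)
  show ?thesis by (induction n) (auto simp: mult_\<Phi> one_K[of i] mult.commute)
qed

lemma pow_\<Phi>: "x \<noteq> 0 \<Longrightarrow> \<Phi> i x [^]\<^bsub>K\<^esub> (n::int) = \<Phi> i (x powi n)"
  by (auto simp: int_pow_def2 pow_nat_\<Phi> inv_\<Phi> power_int_def power_inverse)

lemma finsum_\<Phi>: "finite A \<Longrightarrow> finsum K (\<lambda>j. \<Phi> i (f j)) A = \<Phi> i (sum f A)"
proof -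
  interpret cring K by (rule cring_K)
  show "finite A \<Longrightarrow> ?thesis"
    by (induction A rule: finite_induct) (auto simp: zero_K[of i] add_\<Phi> finsum_insert)
qed

subsection \<open>Prime divisors\<close>

definition curve :: "bool \<Rightarrow> bpoly \<Rightarrow> 'a set" where
  "curve i p = ztop Y closure_of (\<psi> i ` zeros p)"

lemma zopen_compl_zeros: "zopen (- zeros p)"
proof -
  have "- zeros p = {q. ev p q \<noteq> 0}" by (auto simp: zeros_def)
  then show ?thesis by simp
qed

lemma closedin_curve: "closedin (ztop Y) (curve i p)" by (simp add: curve_def)

lemma zeros_in_curve: "\<psi> i ` zeros p \<subseteq> curve i p"
  unfolding curve_def by (intro closure_of_subset) (use range_points in blast)

lemma curve_meets:
  assumes "openin (ztop Y) U" "U \<inter> curve i p \<noteq> {}" shows "\<psi> i -` U \<inter> zeros p \<noteq> {}"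
  using openin_Int_closure_of_eq_empty[OF assms(1), of "\<psi> i ` zeros p"] assms(2) by (auto simp: curve_def)

lemma preim_curve: "\<psi> i -` curve i p = zeros p"
proof
  show "zeros p \<subseteq> \<psi> i -` curve i p" using zeros_in_curve by blast
  have "openin (ztop Y) (\<psi> i ` (- zeros p))" by (intro open_image zopen_compl_zeros)
  then have "\<psi> i ` (- zeros p) \<inter> curve i p = {}" using curve_meets[of "\<psi> i ` (- zeros p)" i p]
    by (auto simp: inj_vimage_image_eq[OF inj])
  then show "\<psi> i -` curve i p \<subseteq> zeros p" by blast
qed

lemma irreducible_closed_curve: assumes p: "irreducible p" shows "irreducible_closed Y (curve i p)"
  unfolding irreducible_closed_def
proof (intro conjI allI impI closedin_curve)
  show "curve i p \<noteq> {}" using zeros_in_curve zeros_nonempty[OF p] by blast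
  fix A B assume AB: "closedin (ztop Y) A" "closedin (ztop Y) B" "curve i p \<subseteq> A \<union> B"
  show "curve i p \<subseteq> A \<or> curve i p \<subseteq> B"
  proof (rule ccontr)
    assume "\<not> ?thesis"
    then have n: "(points Y - A) \<inter> curve i p \<noteq> {}" "(points Y - B) \<inter> curve i p \<noteq> {}"
      using closedin_subset[OF closedin_curve] by blast+
    have o: "openin (ztop Y) (points Y - A)" "openin (ztop Y) (points Y - B)" using AB by auto
    have "\<psi> i -` (points Y - A) \<inter> \<psi> i -` (points Y - B) \<inter> zeros p \<noteq> {}"
      by (intro zeros_irreducible[OF p] open_preim o curve_meets n)
    then show False using AB(3) zeros_in_curve by fastforce
  qed
qed

lemma curve_neq_points: assumes "irreducible p" shows "curve i p \<noteq> points Y"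
proof
  assume "curve i p = points Y"
  then have "zeros p = UNIV" using preim_curve[of i p] range_points[of i] by blast
  moreover have "p \<noteq> 0" using assms by auto
  then obtain q where "ev p q \<noteq> 0" by (rule ev_nonzero)
  ultimately show False by (auto simp: zeros_def)
qed

text \<open>Some nonzero polynomial vanishes on the trace of \<open>Q\<close> in the chart; by irreducibility one of its
  irreducible factors does.\<close>

lemma irreducible_closed_in_curve:
  assumes Q: "irreducible_closed Y Q" "Q \<noteq> points Y" "\<psi> i -` Q \<noteq> {}"
  obtains p where "irreducible p" "\<psi> i -` Q \<subseteq> zeros p" "Q \<subseteq> curve i p"
proof -
  have clQ: "closedin (ztop Y) Q" using Q by (simp add: irreducible_closed_def)
  have irr: "\<psi> i -` Q \<subseteq> zeros f \<or> \<psi> i -` Q \<subseteq> zeros g" if fg: "\<psi> i -` Q \<subseteq> zeros f \<union> zeros g" for f g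
  proof -
    have "closedin (ztop Y) (points Y - \<psi> i ` (- zeros h))" for h
      by (intro closedin_diff open_image zopen_compl_zeros) auto
    moreover have "Q \<subseteq> (points Y - \<psi> i ` (- zeros f)) \<union> (points Y - \<psi> i ` (- zeros g))"
    proof
      fix x assume x: "x \<in> Q"
      show "x \<in> (points Y - \<psi> i ` (- zeros f)) \<union> (points Y - \<psi> i ` (- zeros g))"
      proof (rule ccontr)
        assume "\<not> ?thesis"
        moreover have "x \<in> points Y" using x closedin_subset[OF clQ] by blast
        ultimately obtain q q' where "x = \<psi> i q" "q \<notin> zeros f" "x = \<psi> i q'" "q' \<notin> zeros g" by blast
        then show False using x fg injD[OF inj] by blast
      qed
    qed
    ultimately have "Q \<subseteq> points Y - \<psi> i ` (- zeros f) \<or> Q \<subseteq> points Y - \<psi> i ` (- zeros g)"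
      using Q(1) unfolding irreducible_closed_def by blast
    then show ?thesis by blast
  qed
  have "openin (ztop Y) (points Y - Q)" "points Y - Q \<noteq> {}" using clQ Q closedin_subset by blast+
  then have "zopen (\<psi> i -` (points Y - Q))" "\<psi> i -` (points Y - Q) \<noteq> {}" by (auto simp: open_preim dense)
  then obtain f q where f: "ev f q \<noteq> 0" "{q. ev f q \<noteq> 0} \<subseteq> \<psi> i -` (points Y - Q)" unfolding zopen_def by blast
  have "f \<noteq> 0 \<Longrightarrow> \<psi> i -` Q \<subseteq> zeros f \<Longrightarrow> \<exists>p. irreducible p \<and> \<psi> i -` Q \<subseteq> zeros p" for f
  proof (induction f rule: prime_divisors_induct)
    case (unit f)
    then obtain g where "f * g = 1" by (metis dvdE)
    then have "ev f q * ev g q = 1" for q by (metis ev_simps(2) ev_simps(4))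
    then have "zeros f = {}" by (auto simp: zeros_def) (metis mult_zero_left zero_neq_one)
    then show ?case using unit Q by auto
  next
    case (factor p f)
    have "\<psi> i -` Q \<subseteq> zeros p \<union> zeros f" using factor.prems by (auto simp: zeros_def)
    from irr[OF this] show ?case using factor by (auto dest: prime_elem_imp_irreducible)
  qed auto
  moreover have "\<psi> i -` Q \<subseteq> zeros f" using f by (auto simp: zeros_def)
  moreover have "f \<noteq> 0" using f by auto
  ultimately obtain p where p: "irreducible p" "\<psi> i -` Q \<subseteq> zeros p" by blast
  have "Q \<subseteq> curve i p \<union> (points Y - range (\<psi> i))" using p zeros_in_curve closedin_subset[OF clQ] by blast
  moreover have "closedin (ztop Y) (points Y - range (\<psi> i))" using open_image[OF zopen_UNIV] by (intro closedin_diff) auto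
  moreover have "\<not> Q \<subseteq> points Y - range (\<psi> i)" using Q(3) by blast
  ultimately have "Q \<subseteq> curve i p" using Q(1) closedin_curve unfolding irreducible_closed_def by blast
  then show thesis using p that by blast
qed

text \<open>Nothing irreducible fits between the curve and the surface: it would lie in another irreducible
  curve \<open>p' = 0\<close>, and then \<open>p\<close> divides \<open>p'\<close> by the Nullstellensatz.\<close>

lemma prime_divisor_curve: assumes p: "irreducible p" shows "prime_divisor Y (curve i p)"
  unfolding prime_divisor_def
proof (intro conjI notI)
  show "irreducible_closed Y (curve i p)" using p by (rule irreducible_closed_curve)
  show "curve i p = points Y \<Longrightarrow> False" using p curve_neq_points by blast
  assume "\<exists>Q. irreducible_closed Y Q \<and> curve i p \<subset> Q \<and> Q \<subset> points Y"
  then obtain Q where Q: "irreducible_closed Y Q" "curve i p \<subset> Q" "Q \<subset> points Y" by blast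
  have z: "zeros p \<subseteq> \<psi> i -` Q" using Q preim_curve by blast
  then have "\<psi> i -` Q \<noteq> {}" using zeros_nonempty[OF p] by blast
  then obtain p' where p': "irreducible p'" "\<psi> i -` Q \<subseteq> zeros p'" "Q \<subseteq> curve i p'"
    using irreducible_closed_in_curve[of Q i] Q by blast
  then have "p dvd p'" using zeros_subset_iff[OF p] z by blast
  then have "zeros p = zeros p'" using zeros_cong_irreducible p p' by blast
  then show False using p'(3) Q(2) by (auto simp: curve_def)
qed

text \<open>By codimension one, a prime divisor that meets the chart fills the irreducible curve containing it.\<close>

lemma prime_divisor_in_chart:
  assumes P: "prime_divisor Y P" "\<psi> i -` P \<noteq> {}" obtains p where "irreducible p" "P = curve i p"
proof -
  have irr: "irreducible_closed Y P" "P \<noteq> points Y" using P by (auto simp: prime_divisor_def)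
  then obtain p where p: "irreducible p" "P \<subseteq> curve i p" using irreducible_closed_in_curve P(2) by blast
  have "curve i p \<subset> points Y" using curve_neq_points[OF p(1)] closedin_subset[OF closedin_curve] by blast
  then have "P = curve i p" using P(1) p irreducible_closed_curve[OF p(1)] unfolding prime_divisor_def by blast
  with p that show thesis by blast
qed

lemma prime_divisorE:
  assumes P: "prime_divisor Y P" obtains i p where "irreducible p" "P = curve i p"
proof -
  have "P \<noteq> {}" "P \<subseteq> points Y" using P closedin_subset by (auto simp: prime_divisor_def irreducible_closed_def)
  then obtain i where "\<psi> i -` P \<noteq> {}" using cover by (metis (no_types, lifting) UnE disjoint_iff subset_eq rangeE vimage_eq ex_in_conv)
  then show thesis using prime_divisor_in_chart[OF P] that by blast
qed

lemma curve_eq_iff: "irreducible p \<Longrightarrow> irreducible q \<Longrightarrow> curve i p = curve i q \<longleftrightarrow> p dvd q"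
  by (metis preim_curve zeros_subset_iff zeros_cong_irreducible subset_refl curve_def)

subsection \<open>Orders of vanishing\<close>

lemma local_ring_curve:
  assumes p: "irreducible p"
  shows "local_ring Y (curve i p) = \<Phi> i ` {x. x = 0 \<or> 0 \<le> val p x}"
proof (intro equalityI subsetI)
  fix a assume "a \<in> local_ring Y (curve i p)"
  then obtain U f where a: "a \<in> carrier K" "(U, f) \<in> a" "U \<inter> curve i p \<noteq> {}" by (auto simp: local_ring_def)
  obtain x where x: "a = \<Phi> i x" using a(1) by (rule K_cases)
  have "openin (ztop Y) U" using a x by (auto simp: \<Phi>_def regular_open)
  then obtain q where q: "\<psi> i q \<in> U" "q \<in> zeros p" using curve_meets[OF _ a(3)] by blast
  then have "x \<in> at_point q" using a x \<Phi>D(4) by blast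
  then obtain G H where GH: "x = Fract G H" "ev H q \<noteq> 0" "H \<noteq> 0" by (rule at_pointE)
  then have "\<not> p dvd H" using q by (auto simp: zeros_def elim!: dvdE)
  then have "0 \<le> val p x" if "x \<noteq> 0"
    using that GH by (auto simp: val_Fract[OF p] Fract_eq_0_iff not_dvd_imp_multiplicity_0)
  then show "a \<in> \<Phi> i ` {x. x = 0 \<or> 0 \<le> val p x}" using x by blast
next
  fix a assume "a \<in> \<Phi> i ` {x. x = 0 \<or> 0 \<le> val p x}"
  then obtain x where x: "a = \<Phi> i x" "x = 0 \<or> 0 \<le> val p x" by blast
  obtain G H where GH: "x = Fract G H" "H \<noteq> 0" "coprime G H" by (rule Fract_reducedE)
  have "\<not> p dvd H"
  proof (cases "x = 0")
    case True
    then have "G = 0" using GH by (simp add: Fract_eq_0_iff)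
    then have "is_unit H" using GH by simp
    then show ?thesis using p dvd_unit_imp_unit by (auto simp: irreducible_def)
  next
    case False
    then show ?thesis using val_coprime_nonneg_iff(1)[OF p GH(3,2)] x GH by (auto simp: Fract_eq_0_iff)
  qed
  then obtain q where q: "q \<in> zeros p" "ev H q \<noteq> 0" using zeros_subset_iff[OF p, of H] by (auto simp: zeros_def)
  then have "\<psi> i q \<in> \<psi> i ` {q. ev H q \<noteq> 0} \<inter> curve i p" using zeros_in_curve by blast
  then have "\<psi> i ` {q. ev H q \<noteq> 0} \<inter> curve i p \<noteq> {}" by blast
  then show "a \<in> local_ring Y (curve i p)"
    unfolding local_ring_def using \<Phi>_in_chart[OF GH(2), of i G] x GH(1)
    by (intro CollectI conjI bexI[rotated]) auto
qed

lemma local_ideal_curve: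
  assumes p: "irreducible p"
  shows "local_ideal Y (curve i p) = \<Phi> i ` {x. x = 0 \<or> 1 \<le> val p x}"
proof (intro equalityI subsetI)
  fix a assume "a \<in> local_ideal Y (curve i p)"
  then obtain U f where a: "a \<in> carrier K" "(U, f) \<in> a" "U \<inter> curve i p \<noteq> {}" "\<forall>p\<in>U \<inter> curve i p. f p = 0"
    by (auto simp: local_ideal_def)
  then have "a \<in> local_ring Y (curve i p)" by (auto simp: local_ring_def)
  then obtain x where x: "a = \<Phi> i x" "x = 0 \<or> 0 \<le> val p x" using local_ring_curve[OF p] by blast
  have "1 \<le> val p x" if nz: "x \<noteq> 0"
  proof -
    obtain G H where GH: "x = Fract G H" "H \<noteq> 0" "coprime G H" by (rule Fract_reducedE)
    have G: "G \<noteq> 0" using GH nz by (auto simp: Fract_eq_0_iff)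
    note iff = val_coprime_nonneg_iff[OF p GH(3,2) G, folded GH(1)]
    have "p dvd G"
    proof (rule ccontr)
      assume "\<not> p dvd G"
      moreover have "\<not> p dvd H" using iff x nz by blast
      ultimately have "\<not> p dvd G * H" using prime_elem_dvd_multD[OF irreducible_imp_prime_elem[OF p]] by blast
      then have "{q. ev (G * H) q \<noteq> 0} \<inter> zeros p \<noteq> {}" using zeros_subset_iff[OF p, of "G * H"] by (auto simp: zeros_def)
      moreover have "openin (ztop Y) U" using a x by (auto simp: \<Phi>_def regular_open)
      ultimately obtain q where q: "q \<in> zeros p" "ev (G * H) q \<noteq> 0" "\<psi> i q \<in> U"
        using zeros_irreducible[OF p zopen_basic[of "G * H"] open_preim[of U i]] curve_meets a(3) by blast
      then have "evf x q = 0" using a x(1) zeros_in_curve[of i p] \<Phi>D(5)[of U f i x q] by auto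
      then show False using q GH by (simp add: evf_Fract)
    qed
    then show ?thesis using iff by simp
  qed
  then show "a \<in> \<Phi> i ` {x. x = 0 \<or> 1 \<le> val p x}" using x by blast
next
  fix a assume "a \<in> \<Phi> i ` {x. x = 0 \<or> 1 \<le> val p x}"
  then obtain x where x: "a = \<Phi> i x" "x = 0 \<or> 1 \<le> val p x" by blast
  obtain G H where GH: "x = Fract G H" "H \<noteq> 0" "coprime G H" by (rule Fract_reducedE)
  have d: "p dvd G \<and> \<not> p dvd H"
  proof (cases "x = 0")
    case True
    then have "G = 0" using GH by (simp add: Fract_eq_0_iff)
    moreover from this have "is_unit H" using GH by simp
    ultimately show ?thesis using p dvd_unit_imp_unit by (auto simp: irreducible_def)
  next
    case False
    then show ?thesis using val_coprime_nonneg_iff[OF p GH(3,2)] x GH by (auto simp: Fract_eq_0_iff)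
  qed
  then obtain q where q: "q \<in> zeros p" "ev H q \<noteq> 0" using zeros_subset_iff[OF p, of H] by (auto simp: zeros_def)
  then have "\<psi> i q \<in> \<psi> i ` {q. ev H q \<noteq> 0} \<inter> curve i p" using zeros_in_curve by blast
  then have ne: "\<psi> i ` {q. ev H q \<noteq> 0} \<inter> curve i p \<noteq> {}" by blast
  have "zeros p \<subseteq> zeros G" using d zeros_subset_iff[OF p] by blast
  moreover have "s \<in> zeros p" if "\<psi> i s \<in> curve i p" for s using that preim_curve[of i p] by blast
  ultimately have "evf (Fract G H) (inv_into UNIV (\<psi> i) r) = 0" if "r \<in> \<psi> i ` {q. ev H q \<noteq> 0} \<inter> curve i p" for r
    using that by (fastforce simp: inv_f_f[OF inj] evf_Fract zeros_def)
  then show "a \<in> local_ideal Y (curve i p)"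
    unfolding local_ideal_def using \<Phi>_in_chart[OF GH(2), of i G] x GH(1) ne
    by (intro CollectI conjI bexI[rotated]) auto
qed

lemma uniformizer_curve:
  assumes p: "irreducible p"
  shows "uniformizer Y (curve i p) (\<Phi> i t) \<longleftrightarrow> t \<noteq> 0 \<and> val p t = 1"
proof
  have p0: "to_fract p \<noteq> 0" using p by auto
  assume "uniformizer Y (curve i p) (\<Phi> i t)"
  then have eq: "\<Phi> i ` {x. x = 0 \<or> 1 \<le> val p x} = (\<lambda>b. \<Phi> i t \<otimes>\<^bsub>K\<^esub> b) ` \<Phi> i ` {x. x = 0 \<or> 0 \<le> val p x}"
    unfolding uniformizer_def local_ring_curve[OF p] local_ideal_curve[OF p] by blast
  have "\<Phi> i (to_fract p) \<in> \<Phi> i ` {x. x = 0 \<or> 1 \<le> val p x}" using val_self[OF p] by auto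
  then obtain b where b: "to_fract p = t * b" "b = 0 \<or> 0 \<le> val p b" unfolding eq by (auto simp only: mult_\<Phi> image_iff mem_Collect_eq \<Phi>_eq_iff) blast+
  then have nz: "t \<noteq> 0" "b \<noteq> 0" using p0 by auto
  have "\<Phi> i t \<otimes>\<^bsub>K\<^esub> \<Phi> i 1 \<in> (\<lambda>b. \<Phi> i t \<otimes>\<^bsub>K\<^esub> b) ` \<Phi> i ` {x. x = 0 \<or> 0 \<le> val p x}" using p by auto
  then have "1 \<le> val p t" unfolding eq[symmetric] mult_\<Phi> using nz by auto
  moreover have "val p t + val p b = 1" using val_mult[OF p nz] b val_self[OF p] by simp
  ultimately show "t \<noteq> 0 \<and> val p t = 1" using b nz by auto
next
  assume t: "t \<noteq> 0 \<and> val p t = 1"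
  have "{x. x = 0 \<or> 1 \<le> val p x} = (\<lambda>b. t * b) ` {x. x = 0 \<or> 0 \<le> val p x}"
  proof (intro equalityI subsetI)
    fix x assume x: "x \<in> {x. x = 0 \<or> 1 \<le> val p x}"
    have "x = t * (inverse t * x)" using t by simp
    moreover have "inverse t * x = 0 \<or> 0 \<le> val p (inverse t * x)"
      using x t by (cases "x = 0") (auto simp: val_mult[OF p] val_inverse[OF p])
    ultimately show "x \<in> (\<lambda>b. t * b) ` {x. x = 0 \<or> 0 \<le> val p x}" by blast
  next
    fix x assume "x \<in> (\<lambda>b. t * b) ` {x. x = 0 \<or> 0 \<le> val p x}"
    then obtain b where "x = t * b" "b = 0 \<or> 0 \<le> val p b" by blast
    then show "x \<in> {x. x = 0 \<or> 1 \<le> val p x}" using t by (cases "b = 0") (auto simp: val_mult[OF p])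
  qed
  then show "uniformizer Y (curve i p) (\<Phi> i t)"
    unfolding uniformizer_def local_ring_curve[OF p] local_ideal_curve[OF p] by (simp add: image_image mult_\<Phi>)
qed

text \<open>The local ring of the curve consists of the functions of nonnegative valuation, and its
  uniformizers are the functions of valuation one, so that the order is the valuation.\<close>

lemma ord_along_curve:
  assumes p: "irreducible p" and x: "x \<noteq> 0"
  shows "ord_along Y (curve i p) (\<Phi> i x) = val p x"
  unfolding ord_along_def
proof (rule the_equality)
  let ?t = "to_fract p" and ?n = "val p x"
  have t0: "?t \<noteq> 0" using p by auto
  have unit_iff: "\<Phi> i e \<in> local_ring Y (curve i p) - local_ideal Y (curve i p) \<longleftrightarrow> e \<noteq> 0 \<and> val p e = 0" for e
    unfolding local_ring_curve[OF p] local_ideal_curve[OF p] by auto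
  show "\<exists>t e. uniformizer Y (curve i p) t \<and> e \<in> local_ring Y (curve i p) - local_ideal Y (curve i p) \<and>
     \<Phi> i x = e \<otimes>\<^bsub>K\<^esub> (t [^]\<^bsub>K\<^esub> ?n)"
  proof (intro exI conjI)
    show "uniformizer Y (curve i p) (\<Phi> i ?t)" using t0 val_self[OF p] uniformizer_curve[OF p] by blast
    show "\<Phi> i (x * ?t powi (- ?n)) \<in> local_ring Y (curve i p) - local_ideal Y (curve i p)"
      unfolding unit_iff using x t0 by (simp add: val_mult[OF p] val_powi[OF p] val_self[OF p])
    show "\<Phi> i x = \<Phi> i (x * ?t powi (- ?n)) \<otimes>\<^bsub>K\<^esub> (\<Phi> i ?t [^]\<^bsub>K\<^esub> ?n)"
      using t0 by (simp add: pow_\<Phi> mult_\<Phi> power_int_minus)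
  qed
  fix n :: int assume "\<exists>t e. uniformizer Y (curve i p) t \<and> e \<in> local_ring Y (curve i p) - local_ideal Y (curve i p) \<and>
     \<Phi> i x = e \<otimes>\<^bsub>K\<^esub> (t [^]\<^bsub>K\<^esub> n)"
  then obtain t e where te: "uniformizer Y (curve i p) t" "e \<in> local_ring Y (curve i p) - local_ideal Y (curve i p)"
     "\<Phi> i x = e \<otimes>\<^bsub>K\<^esub> (t [^]\<^bsub>K\<^esub> n)" by blast
  have "t \<in> carrier K" "e \<in> carrier K" using te by (auto simp: uniformizer_def local_ring_def)
  then obtain t' e' where te': "t = \<Phi> i t'" "e = \<Phi> i e'" by (metis K_cases)
  have t': "t' \<noteq> 0" "val p t' = 1" using te(1) uniformizer_curve[OF p] te' by auto
  have e': "e' \<noteq> 0" "val p e' = 0" using te(2) te' unit_iff by auto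
  have "x = e' * t' powi n" using te(3) t' by (simp add: te' pow_\<Phi> mult_\<Phi>)
  then show "n = val p x" using t' e' by (simp add: val_mult[OF p] val_powi[OF p])
qed

end

section \<open>The blow-up of the plane\<close>

text \<open>The two charts differ by exchanging the coordinates. In the chart \<open>True\<close> the first coordinate \<open>u\<close> plays
  the main role, in the chart \<open>False\<close> the second coordinate \<open>v\<close>; \<open>ax\<close> selects it, \<open>ot\<close> selects the
  other one, and \<open>mk\<close> assembles a point from the two.\<close>

definition mk :: "bool \<Rightarrow> complex \<Rightarrow> complex \<Rightarrow> C2" where "mk i x y = (if i then (x, y) else (y, x))"
definition ax :: "bool \<Rightarrow> C2 \<Rightarrow> complex" where "ax i p = (if i then fst p else snd p)"
definition ot :: "bool \<Rightarrow> C2 \<Rightarrow> complex" where "ot i p = (if i then snd p else fst p)"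

lemma mk_simps [simp]: "ax i (mk i x y) = x" "ot i (mk i x y) = y" "mk i (ax i p) (ot i p) = p"
  "mk i x y = mk i x' y' \<longleftrightarrow> x = x' \<and> y = y'"
  by (auto simp: mk_def ax_def ot_def)

lemma mk_eqI: "ax i p = ax i q \<Longrightarrow> ot i p = ot i q \<Longrightarrow> p = q" by (metis mk_simps(3))

lemma scale2_mk [simp]: "scale2 c (mk i x y) = mk i (c * x) (c * y)" "ax i (scale2 c p) = c * ax i p" "ot i (scale2 c p) = c * ot i p"
  by (auto simp: scale2_def mk_def ax_def ot_def split: prod.splits)

lemma scale2_scale2: "scale2 c (scale2 c' p) = scale2 (c * c') p" by (auto simp: scale2_def split: prod.splits)

lemma line_scale2: assumes "c \<noteq> 0" shows "line (scale2 c s) = line s"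
proof (intro equalityI subsetI)
  fix p assume "p \<in> line s"
  then obtain c' where "p = scale2 c' s" by (auto simp: line_def)
  then have "p = scale2 (c' / c) (scale2 c s)" using assms by (simp add: scale2_scale2)
  then show "p \<in> line (scale2 c s)" by (auto simp: line_def)
qed (auto simp: line_def scale2_scale2)

lemma scale2_image_line: assumes "c \<noteq> 0" shows "scale2 c ` line s = line s"
proof -
  have "scale2 c ` line s = line (scale2 c s)" by (auto simp: line_def scale2_scale2 image_iff mult.commute)
  then show ?thesis using line_scale2[OF assms] by simp
qed

lemma in_line_mk: "p \<in> line (mk i 1 w) \<longleftrightarrow> ot i p = w * ax i p"
proof
  assume "ot i p = w * ax i p"
  then have "p = scale2 (ax i p) (mk i 1 w)" by (intro mk_eqI[of i]) auto
  then show "p \<in> line (mk i 1 w)" by (auto simp: line_def)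
qed (auto simp: line_def)

lemma line_mk_eq_iff [simp]: "line (mk i 1 w) = line (mk i 1 w') \<longleftrightarrow> w = w'"
proof
  assume *: "line (mk i 1 w) = line (mk i 1 w')"
  have "mk i 1 w \<in> line (mk i 1 w)" by (simp add: in_line_mk)
  then show "w = w'" unfolding * by (simp add: in_line_mk)
qed simp

lemma line_normal: assumes "ax i s \<noteq> 0" shows "line s = line (mk i 1 (ot i s / ax i s))"
proof -
  have "s = scale2 (ax i s) (mk i 1 (ot i s / ax i s))" using assms by (intro mk_eqI[of i]) auto
  then show ?thesis using line_scale2[OF assms] by metis
qed

definition coords4 :: "(C2 \<times> C2 \<Rightarrow> complex) set" where
  "coords4 = {\<lambda>(p, s). fst p, \<lambda>(p, s). snd p, \<lambda>(p, s). fst s, \<lambda>(p, s). snd s}"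

definition punctured :: "(C2 \<times> C2) set" where "punctured = {(p, s). s \<noteq> (0, 0)}"

definition proj :: "C2 \<times> C2 \<Rightarrow> C2 \<times> C2 set" where "proj = (\<lambda>(p, s). (p, line s))"

lemma A2xA2_eq: "A2xA2 = affine UNIV coords4" by (simp add: A2xA2_def coords4_def)

lemma A2xP1_eq: "A2xP1 = quot (subspace A2xA2 punctured) proj" by (simp add: A2xP1_def punctured_def proj_def)

lemma ax_ot_polynomials:
  "(\<lambda>ps. ax i (fst ps)) \<in> polynomials coords4" "(\<lambda>ps. ot i (fst ps)) \<in> polynomials coords4"
  "(\<lambda>ps. ax i (snd ps)) \<in> polynomials coords4" "(\<lambda>ps. ot i (snd ps)) \<in> polynomials coords4"
  by (cases i; auto intro!: polynomials.coord simp: coords4_def ax_def ot_def case_prod_unfold)+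

lemma openin_zariski_punctured: "openin (zariski UNIV coords4) punctured"
proof -
  have "(\<lambda>(p, s). fst s) \<in> polynomials coords4" "(\<lambda>(p, s). snd s) \<in> polynomials coords4"
    by (auto intro!: polynomials.coord simp: coords4_def)
  note coord = this
  show ?thesis unfolding openin_zariski
  proof (intro conjI ballI)
    fix ps assume ps: "ps \<in> punctured"
    show "\<exists>f\<in>polynomials coords4. f ps \<noteq> 0 \<and> {q\<in>UNIV. f q \<noteq> 0} \<subseteq> punctured"
    proof (cases "fst (snd ps) = 0")
      case True
      then have "snd (snd ps) \<noteq> 0" using ps by (cases ps) (auto simp: punctured_def)
      then show ?thesis by (intro bexI[OF _ coord(2)]) (auto simp: punctured_def split: prod.splits)
    next
      case False
      then show ?thesis by (intro bexI[OF _ coord(1)]) (auto simp: punctured_def split: prod.splits)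
    qed
  qed simp
qed

lemma punctured_iff: "ps \<in> punctured \<longleftrightarrow> (\<exists>i. ax i (snd ps) \<noteq> 0)"
  by (cases ps; cases "snd ps") (auto simp: punctured_def ax_def split: if_splits intro: exI[of _ True] exI[of _ False])

lemma points_A2xP1: "points A2xP1 = proj ` punctured"
proof -
  have "topspace (ztop (subspace A2xA2 punctured)) = punctured" by (simp add: subspace_def A2xA2_eq affine_def)
  moreover have "preim (subspace A2xA2 punctured) proj (proj ` punctured) = punctured" by (auto simp: preim_def calculation)
  ultimately have "openin (quot_top (subspace A2xA2 punctured) proj) (proj ` punctured)"
    by (simp add: openin_quot_top) (metis openin_topspace)
  moreover have "openin (quot_top (subspace A2xA2 punctured) proj) U \<Longrightarrow> U \<subseteq> proj ` punctured" for U
    using \<open>topspace _ = punctured\<close> by (simp add: openin_quot_top)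
  ultimately show ?thesis
    by (simp add: A2xP1_eq quot_def) (metis openin_subset openin_topspace subset_antisym)
qed

lemma openin_A2xP1:
  "openin (ztop A2xP1) V \<longleftrightarrow> V \<subseteq> proj ` punctured \<and> openin (zariski UNIV coords4) {ps\<in>punctured. proj ps \<in> V}"
proof -
  have "topspace (ztop (subspace A2xA2 punctured)) = punctured" by (simp add: subspace_def A2xA2_eq affine_def)
  then have "preim (subspace A2xA2 punctured) proj V = {ps\<in>punctured. proj ps \<in> V}" by (auto simp: preim_def)
  moreover have "openin (subtopology (zariski UNIV coords4) punctured) U \<longleftrightarrow> openin (zariski UNIV coords4) U \<and> U \<subseteq> punctured" for U
    using openin_zariski_punctured by (rule openin_open_subtopology)
  ultimately show ?thesis using \<open>topspace _ = punctured\<close>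
    by (auto simp: A2xP1_eq quot_def openin_quot_top subspace_def A2xA2_eq affine_def)
qed

lemma regular_A2xP1D:
  assumes "regular A2xP1 V f" "ps \<in> punctured" "proj ps \<in> V"
  obtains W a b where "openin (zariski UNIV coords4) W" "ps \<in> W" "a \<in> polynomials coords4" "b \<in> polynomials coords4"
    "\<And>r. r \<in> punctured \<Longrightarrow> r \<in> W \<Longrightarrow> proj r \<in> V \<Longrightarrow> b r \<noteq> 0 \<and> f (proj r) = a r / b r"
proof -
  have top: "topspace (ztop (subspace A2xA2 punctured)) = punctured" by (simp add: subspace_def A2xA2_eq affine_def)
  have pre: "preim (subspace A2xA2 punctured) proj V = {ps\<in>punctured. proj ps \<in> V}" by (auto simp: preim_def top)
  have "regular (subspace A2xA2 punctured) {ps\<in>punctured. proj ps \<in> V} (f \<circ> proj)"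
    using assms(1) by (simp add: A2xP1_eq quot_def pre)
  then obtain W g where W: "ps \<in> W" "regular A2xA2 W g" "\<forall>q\<in>{ps\<in>punctured. proj ps \<in> V} \<inter> W. (f \<circ> proj) q = g q"
    using assms(2,3) unfolding subspace_def fspace.select_convs by blast
  then obtain W' a b where W': "openin (zariski UNIV coords4) W'" "ps \<in> W'" "W' \<subseteq> W"
    "a \<in> polynomials coords4" "b \<in> polynomials coords4" "\<forall>q\<in>W'. b q \<noteq> 0 \<and> g q = a q / b q"
    unfolding A2xA2_eq affine_def fspace.select_convs by blast
  have "b r \<noteq> 0 \<and> f (proj r) = a r / b r" if "r \<in> punctured" "r \<in> W'" "proj r \<in> V" for r
  proof -
    have "r \<in> W" using that(2) W'(3) by (rule subsetD[rotated])
    then have "f (proj r) = g r" using W(3)[THEN bspec, of r] that(1,3) by simp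
    then show ?thesis using W'(6) that(2) by simp
  qed
  then show thesis by (rule that[OF W'(1,2,4,5)])
qed

lemma regular_A2xP1I:
  assumes V: "openin (ztop A2xP1) V" and ab: "a \<in> polynomials coords4" "b \<in> polynomials coords4"
    "\<And>r. r \<in> punctured \<Longrightarrow> proj r \<in> V \<Longrightarrow> b r \<noteq> 0 \<and> f (proj r) = a r / b r"
  shows "regular A2xP1 V f"
proof -
  have top: "topspace (ztop (subspace A2xA2 punctured)) = punctured" by (simp add: subspace_def A2xA2_eq affine_def)
  have pre: "preim (subspace A2xA2 punctured) proj V = {ps\<in>punctured. proj ps \<in> V}" by (auto simp: preim_def top)
  let ?U = "{ps\<in>punctured. proj ps \<in> V}"
  have o: "openin (zariski UNIV coords4) ?U" using V openin_A2xP1 by blast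
  have r: "regular A2xA2 ?U (f \<circ> proj)"
    unfolding A2xA2_eq affine_def fspace.select_convs
    by (intro conjI o ballI exI[of _ ?U] exI[of _ a] exI[of _ b]) (use o ab in auto)
  have "openin (subtopology (ztop A2xA2) punctured) ?U"
    using o by (auto simp: openin_open_subtopology[OF openin_zariski_punctured] A2xA2_eq affine_def)
  then have "regular (subspace A2xA2 punctured) ?U (f \<circ> proj)"
    unfolding subspace_def fspace.select_convs
    by (intro conjI ballI exI[of _ ?U] exI[of _ "f \<circ> proj"] r) auto
  then show ?thesis using V by (simp add: A2xP1_eq quot_def pre)
qed

text \<open>With \<open>i = True\<close> the coordinates are \<open>u\<close> and \<open>v / u\<close>, with \<open>i = False\<close> they are \<open>v\<close> and \<open>u / v\<close>.\<close>

definition chart :: "bool \<Rightarrow> C2 \<Rightarrow> C2 \<times> C2 set" where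
  "chart i q = (mk i (fst q) (fst q * snd q), line (mk i 1 (snd q)))"

text \<open>The chart lifted along the projection of \<open>A\<^sup>2 \<times> (A\<^sup>2 - {0})\<close> to \<open>A\<^sup>2 \<times> P\<^sup>1\<close>. Since its coordinates are
  polynomials, it transfers open sets and regular functions to the plane.\<close>

definition lift :: "bool \<Rightarrow> C2 \<Rightarrow> C2 \<times> C2" where
  "lift i q = (mk i (fst q) (fst q * snd q), mk i 1 (snd q))"

lemma proj_lift [simp]: "proj (lift i q) = chart i q" by (simp add: proj_def lift_def chart_def)

lemma lift_punctured [simp]: "lift i q \<in> punctured" unfolding punctured_iff by (auto simp: lift_def intro: exI[of _ i])

lemma points_Bl: "points Bl = {(p, L). p \<in> L} \<inter> proj ` punctured"
  by (auto simp: Bl_def subspace_def points_A2xP1)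

text \<open>These coordinates are defined beside the blow-up as well; they extend the inverse of the chart to
  an open subset of the ambient product, as is needed to exhibit open sets and regular functions there.\<close>

definition local_coords :: "bool \<Rightarrow> C2 \<times> C2 \<Rightarrow> C2" where
  "local_coords i ps = (ax i (fst ps), ot i (snd ps) / ax i (snd ps))"

lemma local_coords_lift [simp]: "local_coords i (lift i q) = q" by (simp add: local_coords_def lift_def)

lemma chart_local_coords:
  assumes "ax i (snd ps) \<noteq> 0" "fst ps \<in> line (snd ps)" shows "chart i (local_coords i ps) = proj ps"
proof -
  have l: "line (snd ps) = line (mk i 1 (ot i (snd ps) / ax i (snd ps)))" using assms(1) by (rule line_normal)
  then have "ot i (fst ps) = (ot i (snd ps) / ax i (snd ps)) * ax i (fst ps)" using assms(2) in_line_mk by blast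
  then show ?thesis using l by (auto simp: chart_def proj_def local_coords_def case_prod_unfold mult.commute intro!: mk_eqI[of i])
qed

lemma chart_in_Bl [simp]: "chart i q \<in> points Bl"
proof -
  have "chart i q \<in> proj ` punctured" using lift_punctured proj_lift by (metis image_eqI)
  then show ?thesis by (auto simp: points_Bl chart_def in_line_mk)
qed

lemma chart_inj: "chart i q = chart i q' \<longleftrightarrow> q = q'"
  unfolding chart_def prod.inject mk_simps line_mk_eq_iff by (auto intro: prod_eqI)

lemma Bl_cover: "points Bl = range (chart True) \<union> range (chart False)"
proof (intro equalityI subsetI)
  fix x assume "x \<in> points Bl"
  then obtain ps where ps: "ps \<in> punctured" "x = proj ps" "fst ps \<in> line (snd ps)" by (auto simp: points_Bl proj_def)
  then obtain i where i: "ax i (snd ps) \<noteq> 0" using punctured_iff by blast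
  then have "x = chart i (local_coords i ps)" using chart_local_coords ps by simp
  then show "x \<in> range (chart True) \<union> range (chart False)" by (cases i) auto
qed auto

lemma lift_polynomial:
  assumes "f \<in> polynomials coords4" obtains P where "\<And>q. f (lift i q) = ev P q"
proof -
  have fs: "fst \<in> polynomials {fst, snd}" "snd \<in> polynomials {fst, snd}" by (auto intro: polynomials.coord)
  have "(\<lambda>q. f (lift i q)) \<in> polynomials {fst, snd}" using assms
  proof (induction rule: polynomials.induct)
    case (coord f)
    have "(\<lambda>q. fst q * snd q) \<in> polynomials {fst, snd :: C2 \<Rightarrow> complex}" using fs by (intro polynomials.mult)
    with coord fs show ?case
      by (cases i) (auto simp: coords4_def lift_def mk_def case_prod_unfold intro: polynomials.const)
  qed (use fs in \<open>auto intro: polynomials.intros\<close>)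
  then show thesis using that polynomials_plane_ev by metis
qed

lemma zopen_lift:
  assumes "openin (zariski UNIV coords4) T" shows "zopen {q. lift i q \<in> T}"
  unfolding zopen_def
proof
  fix q assume "q \<in> {q. lift i q \<in> T}"
  then obtain f where f: "f \<in> polynomials coords4" "f (lift i q) \<noteq> 0" "{q\<in>UNIV. f q \<noteq> 0} \<subseteq> T"
    using assms unfolding openin_zariski by blast
  obtain P where P: "\<And>q. f (lift i q) = ev P q" using lift_polynomial[OF f(1)] by blast
  have "ev P q \<noteq> 0" using f(2) by (simp add: P)
  moreover have "lift i r \<in> T" if "ev P r \<noteq> 0" for r using f(3) that[folded P] by blast
  ultimately show "\<exists>P. ev P q \<noteq> 0 \<and> {q'. ev P q' \<noteq> 0} \<subseteq> {q. lift i q \<in> T}" by blast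
qed

text \<open>Clearing the denominator turns a polynomial in the local coordinates into a polynomial function
  on the ambient space.\<close>

lemma local_coords_polynomial:
  obtains g N where "g \<in> polynomials coords4"
    "\<And>ps. ax i (snd ps) \<noteq> 0 \<Longrightarrow> g ps = ax i (snd ps) ^ N * ev P (local_coords i ps)"
proof -
  note ax = ax_ot_polynomials
  have "\<exists>g\<in>polynomials coords4. \<exists>N. \<forall>ps. ax i (snd ps) \<noteq> 0 \<longrightarrow> g ps = ax i (snd ps) ^ N * f (local_coords i ps)"
    if "f \<in> polynomials {fst, snd}" for f
    using that
  proof (induction rule: polynomials.induct)
    case (coord f)
    then consider "f = fst" | "f = snd" by blast
    then show ?case
    proof cases
      case 1 then show ?thesis by (intro bexI[OF _ ax(1)[of i]] exI[of _ 0]) (auto simp: local_coords_def)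
    next
      case 2 then show ?thesis by (intro bexI[OF _ ax(4)[of i]] exI[of _ 1]) (auto simp: local_coords_def)
    qed
  next
    case (const c)
    show ?case by (intro bexI[of _ "\<lambda>_. c"] exI[of _ 0]) (auto intro: polynomials.const)
  next
    case (add f f')
    then obtain g N g' N' where g: "g \<in> polynomials coords4" "g' \<in> polynomials coords4"
      "\<forall>ps. ax i (snd ps) \<noteq> 0 \<longrightarrow> g ps = ax i (snd ps) ^ N * f (local_coords i ps)"
      "\<forall>ps. ax i (snd ps) \<noteq> 0 \<longrightarrow> g' ps = ax i (snd ps) ^ N' * f' (local_coords i ps)" by blast
    show ?case
    proof (intro bexI exI[of _ "N + N'"])
      show "(\<lambda>ps. ax i (snd ps) ^ N' * g ps + ax i (snd ps) ^ N * g' ps) \<in> polynomials coords4"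
        by (intro polynomials.add polynomials.mult polynomials_power ax g)
    qed (use g in \<open>auto simp: algebra_simps power_add\<close>)
  next
    case (mult f f')
    then obtain g N g' N' where g: "g \<in> polynomials coords4" "g' \<in> polynomials coords4"
      "\<forall>ps. ax i (snd ps) \<noteq> 0 \<longrightarrow> g ps = ax i (snd ps) ^ N * f (local_coords i ps)"
      "\<forall>ps. ax i (snd ps) \<noteq> 0 \<longrightarrow> g' ps = ax i (snd ps) ^ N' * f' (local_coords i ps)" by blast
    show ?case
    proof (intro bexI exI[of _ "N + N'"])
      show "(\<lambda>ps. g ps * g' ps) \<in> polynomials coords4" by (intro polynomials.mult g)
    qed (use g in \<open>auto simp: power_add\<close>)
  qed
  moreover have "ev P \<in> polynomials {fst, snd}"
    using ev_subst_polynomials[of fst "{fst, snd}" snd P] by (auto intro: polynomials.coord)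
  ultimately show thesis using that by blast
qed

definition chart_nbhd :: "bool \<Rightarrow> C2 set \<Rightarrow> (C2 \<times> C2 set) set" where
  "chart_nbhd i W = proj ` {ps. ax i (snd ps) \<noteq> 0 \<and> local_coords i ps \<in> W}"

lemma proj_eq_coords:
  assumes "proj ps = proj ps'" "ax i (snd ps) \<noteq> 0" "ps' \<in> punctured"
  shows "ax i (snd ps') \<noteq> 0" "local_coords i ps' = local_coords i ps"
proof -
  have eq: "fst ps' = fst ps" "line (snd ps') = line (mk i 1 (ot i (snd ps) / ax i (snd ps)))"
    using assms(1) line_normal[OF assms(2)] by (auto simp: proj_def case_prod_unfold)
  have "snd ps' = scale2 1 (snd ps')" by (simp add: scale2_def case_prod_unfold)
  then have "snd ps' \<in> line (snd ps')" unfolding line_def by blast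
  then have o: "ot i (snd ps') = ot i (snd ps) / ax i (snd ps) * ax i (snd ps')" using eq in_line_mk by blast
  show nz': "ax i (snd ps') \<noteq> 0"
  proof
    assume "ax i (snd ps') = 0"
    with o have "snd ps' = (0, 0)" by (intro mk_eqI[of i]) (auto simp: ax_def ot_def)
    then show False using assms(3) by (auto simp: punctured_def)
  qed
  then show "local_coords i ps' = local_coords i ps" using o eq by (simp add: local_coords_def)
qed

lemma preim_chart_nbhd: "{ps\<in>punctured. proj ps \<in> chart_nbhd i W} = {ps. ax i (snd ps) \<noteq> 0 \<and> local_coords i ps \<in> W}"
proof (intro equalityI subsetI)
  fix ps assume ps: "ps \<in> {ps\<in>punctured. proj ps \<in> chart_nbhd i W}"
  then obtain r where r: "proj r = proj ps" "ax i (snd r) \<noteq> 0" "local_coords i r \<in> W" by (force simp: chart_nbhd_def)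
  moreover have "ps \<in> punctured" using ps by blast
  ultimately show "ps \<in> {ps. ax i (snd ps) \<noteq> 0 \<and> local_coords i ps \<in> W}" using proj_eq_coords[of r ps i] by auto
next
  fix ps assume ps: "ps \<in> {ps. ax i (snd ps) \<noteq> 0 \<and> local_coords i ps \<in> W}"
  then have "ps \<in> punctured" using punctured_iff by blast
  with ps show "ps \<in> {ps\<in>punctured. proj ps \<in> chart_nbhd i W}" by (simp add: chart_nbhd_def)
qed

lemma openin_chart_nbhd: assumes "zopen W" shows "openin (ztop A2xP1) (chart_nbhd i W)"
  unfolding openin_A2xP1
proof
  show "chart_nbhd i W \<subseteq> proj ` punctured" unfolding chart_nbhd_def using punctured_iff by blast
  show "openin (zariski UNIV coords4) {ps\<in>punctured. proj ps \<in> chart_nbhd i W}"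
    unfolding preim_chart_nbhd openin_zariski
  proof (intro conjI ballI)
    fix ps assume ps: "ps \<in> {ps. ax i (snd ps) \<noteq> 0 \<and> local_coords i ps \<in> W}"
    then obtain P where P: "ev P (local_coords i ps) \<noteq> 0" "{q. ev P q \<noteq> 0} \<subseteq> W" using assms unfolding zopen_def by blast
    obtain g N where g: "g \<in> polynomials coords4"
       "\<And>ps. ax i (snd ps) \<noteq> 0 \<Longrightarrow> g ps = ax i (snd ps) ^ N * ev P (local_coords i ps)"
      using local_coords_polynomial by blast
    show "\<exists>f\<in>polynomials coords4. f ps \<noteq> 0 \<and> {q\<in>UNIV. f q \<noteq> 0} \<subseteq> {ps. ax i (snd ps) \<noteq> 0 \<and> local_coords i ps \<in> W}"
    proof (intro bexI conjI)
      show "(\<lambda>ps. ax i (snd ps) * g ps) \<in> polynomials coords4" by (intro polynomials.mult g ax_ot_polynomials)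
      show "ax i (snd ps) * g ps \<noteq> 0" using ps P g(2) by auto
      show "{q\<in>UNIV. ax i (snd q) * g q \<noteq> 0} \<subseteq> {ps. ax i (snd ps) \<noteq> 0 \<and> local_coords i ps \<in> W}"
        using P(2) g(2) by auto
    qed
  qed auto
qed

lemma chart_nbhd_Bl: "chart_nbhd i W \<inter> {(p, L). p \<in> L} = chart i ` W"
proof (intro equalityI subsetI)
  fix x assume x: "x \<in> chart_nbhd i W \<inter> {(p, L). p \<in> L}"
  then obtain ps where ps: "x = proj ps" "ax i (snd ps) \<noteq> 0" "local_coords i ps \<in> W" by (auto simp: chart_nbhd_def)
  moreover have "fst ps \<in> line (snd ps)" using x ps by (auto simp: proj_def case_prod_unfold)
  ultimately show "x \<in> chart i ` W" using chart_local_coords by (metis image_eqI)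
next
  fix x assume "x \<in> chart i ` W"
  then obtain q where q: "q \<in> W" "x = chart i q" by blast
  then have "x = proj (lift i q)" "ax i (snd (lift i q)) \<noteq> 0" "local_coords i (lift i q) \<in> W"
    by (simp, simp add: lift_def, simp)
  then have "x \<in> chart_nbhd i W" unfolding chart_nbhd_def by blast
  then show "x \<in> chart_nbhd i W \<inter> {(p, L). p \<in> L}" using q chart_in_Bl by (auto simp: points_Bl)
qed

lemma chart_flip: "w \<noteq> 0 \<Longrightarrow> chart i (x, w) = chart (\<not> i) (x * w, 1 / w)"
proof -
  assume w: "w \<noteq> 0"
  have "mk (\<not> i) y z = mk i z y" for y z by (simp add: mk_def)
  moreover have "line (mk i 1 w) = line (scale2 (1 / w) (mk i 1 w))" using w by (intro line_scale2[symmetric]) auto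
  ultimately show ?thesis using w by (simp add: chart_def)
qed

lemma Bl_atlas: "plane_atlas Bl chart"
proof
  show "inj (chart i)" for i by (auto simp: inj_def chart_inj)
  show "points Bl = range (chart True) \<union> range (chart False)" by (rule Bl_cover)
  show "zopen (chart i -` V)" if "openin (ztop Bl) V" for V i
  proof -
    obtain V' where V': "openin (ztop A2xP1) V'" "V = V' \<inter> {(p, L). p \<in> L}"
      using \<open>openin (ztop Bl) V\<close> by (auto simp: Bl_def subspace_def openin_subtopology)
    have "chart i q \<in> {(p, L). p \<in> L}" for q using chart_in_Bl[of i q] unfolding points_Bl by (rule IntD1)
    then have "chart i -` V = {q. lift i q \<in> {ps\<in>punctured. proj ps \<in> V'}}"
      unfolding V' by (simp add: vimage_def)
    moreover have "openin (zariski UNIV coords4) {ps\<in>punctured. proj ps \<in> V'}" using V'(1) openin_A2xP1 by blast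
    ultimately show ?thesis by (simp only: zopen_lift)
  qed
  show open_im: "openin (ztop Bl) (chart i ` W)" if "zopen W" for W i
    using openin_chart_nbhd[OF that, of i] chart_nbhd_Bl[of i W, symmetric]
    unfolding Bl_def subspace_def fspace.select_convs openin_subtopology by blast
  show "openin (ztop Bl) V" if "regular Bl V f" for V f using that by (simp add: Bl_def subspace_def)
  show "zreg (chart i -` V) (f \<circ> chart i)" if r: "regular Bl V f" for V f i
  proof (rule zregI)
    have "openin (ztop Bl) V" using r by (simp add: Bl_def subspace_def)
    then show "zopen (chart i -` V)" by fact
    fix q assume q: "q \<in> chart i -` V"
    then obtain W g where W: "chart i q \<in> W" "regular A2xP1 W g" "\<forall>p\<in>V \<inter> W. f p = g p"
      using r unfolding Bl_def subspace_def fspace.select_convs by blast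
    obtain T a b where T: "openin (zariski UNIV coords4) T" "lift i q \<in> T" "a \<in> polynomials coords4" "b \<in> polynomials coords4"
      "\<And>r. r \<in> punctured \<Longrightarrow> r \<in> T \<Longrightarrow> proj r \<in> W \<Longrightarrow> b r \<noteq> 0 \<and> g (proj r) = a r / b r"
      using regular_A2xP1D[OF W(2) lift_punctured[of i q]] W(1) proj_lift by metis
    obtain G where G: "\<And>q. a (lift i q) = ev G q" using lift_polynomial[OF T(3)] by blast
    obtain H where H: "\<And>q. b (lift i q) = ev H q" using lift_polynomial[OF T(4)] by blast
    have "openin (ztop A2xP1) W" using W(2) by (simp add: A2xP1_eq quot_def)
    then have "zopen {q. lift i q \<in> {ps\<in>punctured. proj ps \<in> W}}" using zopen_lift openin_A2xP1 by blast
    then have o: "zopen ({q. lift i q \<in> {ps\<in>punctured. proj ps \<in> W}} \<inter> {q. lift i q \<in> T})"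
      using zopen_lift[OF T(1)] zopen_Int by blast
    show "\<exists>W G H. zopen W \<and> q \<in> W \<and> (\<forall>r\<in>chart i -` V \<inter> W. ev H r \<noteq> 0 \<and> (f \<circ> chart i) r = ev G r / ev H r)"
    proof (intro exI conjI ballI)
      show "q \<in> {q. lift i q \<in> {ps\<in>punctured. proj ps \<in> W}} \<inter> {q. lift i q \<in> T}"
        using lift_punctured W T by simp
      fix r assume r: "r \<in> chart i -` V \<inter> ({q. lift i q \<in> {ps\<in>punctured. proj ps \<in> W}} \<inter> {q. lift i q \<in> T})"
      then have *: "chart i r \<in> V \<inter> W" "lift i r \<in> T" by simp_all
      have "b (lift i r) \<noteq> 0 \<and> g (proj (lift i r)) = a (lift i r) / b (lift i r)"
        by (rule T(5)) (use * lift_punctured in simp_all)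
      then show "ev H r \<noteq> 0" "(f \<circ> chart i) r = ev G r / ev H r" using W(3) * by (simp_all add: G H)
    qed (rule o)
  qed
  show "regular Bl V f" if V: "openin (ztop Bl) V" "V \<subseteq> range (chart i)" "zreg (chart i -` V) (f \<circ> chart i)" for V f i
  proof -
    obtain G H where GH: "\<And>q. q \<in> chart i -` V \<Longrightarrow> ev H q \<noteq> 0 \<and> f (chart i q) = ev G q / ev H q"
      using V(3) by (auto simp: zreg_def)
    define W where "W = chart i -` V"
    have W: "zopen W" "V = chart i ` W" using V by (auto simp: W_def zreg_def)
    obtain a M where a: "a \<in> polynomials coords4"
       "\<And>ps. ax i (snd ps) \<noteq> 0 \<Longrightarrow> a ps = ax i (snd ps) ^ M * ev G (local_coords i ps)"
      using local_coords_polynomial by blast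
    obtain b N where b: "b \<in> polynomials coords4"
       "\<And>ps. ax i (snd ps) \<noteq> 0 \<Longrightarrow> b ps = ax i (snd ps) ^ N * ev H (local_coords i ps)"
      using local_coords_polynomial by blast
    define lc where "lc x = local_coords i (SOME ps. ps \<in> punctured \<and> proj ps = x)" for x
    have lc: "lc (proj ps) = local_coords i ps" if "ax i (snd ps) \<noteq> 0" for ps
    proof -
      have "ps \<in> punctured" using that punctured_iff by blast
      then have "(SOME r. r \<in> punctured \<and> proj r = proj ps) \<in> punctured \<and> proj (SOME r. r \<in> punctured \<and> proj r = proj ps) = proj ps"
        by (intro someI_ex[where P = "\<lambda>r. r \<in> punctured \<and> proj r = proj ps"]) blast
      then show ?thesis unfolding lc_def by (intro proj_eq_coords(2)[OF _ that]) auto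
    qed
    let ?g = "\<lambda>x. ev G (lc x) / ev H (lc x)"
    have "regular A2xP1 (chart_nbhd i W) ?g"
    proof (rule regular_A2xP1I[OF openin_chart_nbhd[OF W(1)]])
      show "(\<lambda>ps. a ps * ax i (snd ps) ^ N) \<in> polynomials coords4" "(\<lambda>ps. b ps * ax i (snd ps) ^ M) \<in> polynomials coords4"
        by (intro polynomials.mult polynomials_power ax_ot_polynomials a b)+
      fix r assume "r \<in> punctured" "proj r \<in> chart_nbhd i W"
      then have "r \<in> {ps. ax i (snd ps) \<noteq> 0 \<and> local_coords i ps \<in> W}" using preim_chart_nbhd[of i W] by blast
      then have r: "ax i (snd r) \<noteq> 0" "local_coords i r \<in> W" by auto
      then have "ev H (local_coords i r) \<noteq> 0" using GH by (simp add: W_def)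
      then show "b r * ax i (snd r) ^ M \<noteq> 0 \<and> ?g (proj r) = a r * ax i (snd r) ^ N / (b r * ax i (snd r) ^ M)"
        using r a(2)[OF r(1)] b(2)[OF r(1)] lc[OF r(1)] by simp
    qed
    moreover have "chart i q \<in> chart_nbhd i W" "f (chart i q) = ?g (chart i q)" if "q \<in> W" for q
    proof -
      show "chart i q \<in> chart_nbhd i W" using chart_nbhd_Bl[of i W] that by blast
      have "lc (chart i q) = q" using lc[of "lift i q"] by (simp add: lift_def local_coords_def flip: proj_lift)
      then show "f (chart i q) = ?g (chart i q)" using GH that by (simp add: W_def)
    qed
    ultimately show ?thesis
      using V(1) unfolding Bl_def subspace_def fspace.select_convs W(2) by blast
  qed
  have "chart True (1, 1) = chart False (1, 1)" using chart_flip[of 1 True 1] by simp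
  then show "range (chart True) \<inter> range (chart False) \<noteq> {}" by (metis disjoint_iff rangeI)
qed

interpretation Bl: plane_atlas Bl chart by (rule Bl_atlas)

section \<open>The quotient of the blow-up by roots of unity\<close>

definition power_map :: "nat \<Rightarrow> C2 \<Rightarrow> C2" where "power_map m q = (fst q ^ m, snd q)"

lemma ev_power_map: obtains P' where "\<And>q. ev P' q = ev P (power_map m q)"
proof -
  have "(\<lambda>q. ev P (fst q ^ m, snd q)) \<in> polynomials {fst, snd}"
    by (intro ev_subst_polynomials polynomials_power) (auto intro: polynomials.coord)
  then obtain P' where "(\<lambda>q. ev P (fst q ^ m, snd q)) = ev P'" using polynomials_plane_ev by blast
  then have "ev P' q = ev P (power_map m q)" for q unfolding power_map_def by (rule fun_cong[symmetric])
  then show thesis by (rule that)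
qed

lemma zopen_power_map: assumes "zopen U" shows "zopen (power_map m -` U)"
  unfolding zopen_def
proof
  fix q assume "q \<in> power_map m -` U"
  then obtain P where P: "ev P (power_map m q) \<noteq> 0" "{q. ev P q \<noteq> 0} \<subseteq> U" using assms unfolding zopen_def by blast
  obtain P' where "\<And>q. ev P' q = ev P (power_map m q)" using ev_power_map by blast
  with P show "\<exists>P. ev P q \<noteq> 0 \<and> {q'. ev P q' \<noteq> 0} \<subseteq> power_map m -` U" by (intro exI[of _ P']) auto
qed

lemma zreg_power_map: assumes "zreg U f" shows "zreg (power_map m -` U) (f \<circ> power_map m)"
proof -
  obtain G H where GH: "\<forall>q\<in>U. ev H q \<noteq> 0 \<and> f q = ev G q / ev H q" using assms by (auto simp: zreg_def)
  obtain G' where "\<And>q. ev G' q = ev G (power_map m q)" using ev_power_map by blast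
  moreover obtain H' where "\<And>q. ev H' q = ev H (power_map m q)" using ev_power_map by blast
  ultimately show ?thesis using GH assms zopen_power_map unfolding zreg_def
    by (intro conjI exI[of _ G'] exI[of _ H']) auto
qed

text \<open>The monomials are grouped by the residue of the exponent of the first variable modulo \<open>m\<close>; the
  roots of unity act on each group by a character.\<close>

lemma isotypic_decomposition:
  assumes m: "m > 0"
  obtains Pr where "\<And>u w. ev P (u, w) = (\<Sum>r<m. u ^ r * ev (Pr r) (u ^ m, w))"
proof -
  obtain n where n: "m = Suc n" using m gr0_implies_Suc by blast
  define T where "T P \<longleftrightarrow> (\<exists>Pr. \<forall>u w. ev P (u, w) = (\<Sum>r<m. u ^ r * ev (Pr r) (u ^ m, w)))" for P
  have add: "T (P + Q)" if T: "T P" "T Q" for P Q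
  proof -
    obtain Pr where "\<forall>u w. ev P (u, w) = (\<Sum>r<m. u ^ r * ev (Pr r) (u ^ m, w))"
      using T(1) unfolding T_def by blast
    moreover obtain Qr where "\<forall>u w. ev Q (u, w) = (\<Sum>r<m. u ^ r * ev (Qr r) (u ^ m, w))"
      using T(2) unfolding T_def by blast
    ultimately show ?thesis unfolding T_def
      by (intro exI[of _ "\<lambda>r. Pr r + Qr r"]) (auto simp: sum.distrib algebra_simps)
  qed
  have multY: "T (bY * P)" if T: "T P" for P
  proof -
    obtain Pr where "\<forall>u w. ev P (u, w) = (\<Sum>r<m. u ^ r * ev (Pr r) (u ^ m, w))" using T unfolding T_def by blast
    then show ?thesis unfolding T_def
      by (intro exI[of _ "\<lambda>r. bY * Pr r"]) (auto simp: sum_distrib_left algebra_simps)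
  qed
  have multX: "T (bX * P)" if T: "T P" for P
  proof -
    obtain Pr where Pr: "\<forall>u w. ev P (u, w) = (\<Sum>r<m. u ^ r * ev (Pr r) (u ^ m, w))" using T unfolding T_def by blast
    have "ev (bX * P) (u, w) = (\<Sum>r<m. u ^ r * ev (case r of 0 \<Rightarrow> bX * Pr n | Suc r \<Rightarrow> Pr r) (u ^ m, w))" for u w
    proof -
      have "(\<Sum>r<m. u ^ r * ev (case r of 0 \<Rightarrow> bX * Pr n | Suc r \<Rightarrow> Pr r) (u ^ m, w))
         = u ^ m * ev (Pr n) (u ^ m, w) + (\<Sum>r<n. u ^ Suc r * ev (Pr r) (u ^ m, w))"
        unfolding n by (subst sum.lessThan_Suc_shift) simp
      also have "\<dots> = u * (\<Sum>r<m. u ^ r * ev (Pr r) (u ^ m, w))"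
        unfolding n by (simp add: sum_distrib_left algebra_simps)
      finally show ?thesis using Pr by simp
    qed
    then show ?thesis unfolding T_def by blast
  qed
  have const: "T (bC c)" for c
    unfolding T_def n sum.lessThan_Suc_shift
    by (intro exI[of _ "\<lambda>r. if r = 0 then bC c else 0"]) simp
  have X: "T [:c:]" for c
  proof (induction c)
    case 0 show ?case using const[of 0] by simp
  next
    case (pCons a c)
    have "[:pCons a c:] = bC a + bX * [:c:]" by (simp add: bC_def bX_def)
    then show ?case using add const multX pCons by metis
  qed
  have "T P"
  proof (induction P)
    case 0 show ?case using const[of 0] by simp
  next
    case (pCons c P)
    have "pCons c P = [:c:] + bY * P" by (simp add: bY_def)
    then show ?case using add X multY pCons by metis
  qed
  then show thesis using that unfolding T_def by blast
qed

text \<open>As a function of the root of unity \<open>\<xi>\<close> the sum is a polynomial of degree less than \<open>m\<close> with \<open>m\<close> zeros.\<close>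

lemma isotypic_components_vanish:
  fixes u :: complex
  assumes m: "m > 0" and van: "\<And>\<xi>. \<xi> ^ m = 1 \<Longrightarrow> (\<Sum>r<m. (\<xi> * u) ^ r * c r) = 0" and r: "r < m"
  shows "u ^ r * c r = 0"
proof -
  define p where "p = (\<Sum>r<m. monom (u ^ r * c r) r)"
  have "coeff p k = (if k < m then u ^ k * c k else 0)" for k
    by (simp add: p_def coeff_sum sum.delta)
  note coeff = this
  have "p = 0"
  proof (rule ccontr)
    assume "p \<noteq> 0"
    have "{\<xi>. \<xi> ^ m = 1} \<subseteq> {\<xi>. poly p \<xi> = 0}"
      using van by (auto simp: p_def poly_sum poly_monom power_mult_distrib mult_ac)
    then have "card {\<xi>::complex. \<xi> ^ m = 1} \<le> card {\<xi>. poly p \<xi> = 0}"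
      using poly_roots_finite[OF \<open>p \<noteq> 0\<close>] by (rule card_mono[rotated])
    also have "\<dots> \<le> degree p" using \<open>p \<noteq> 0\<close> by (rule card_poly_roots_bound)
    also have "\<dots> \<le> m - 1" by (rule degree_le) (use coeff in auto)
    finally show False using card_roots_unity_eq[of m] m by simp
  qed
  then show ?thesis using coeff[of r] r by simp
qed

definition some_root :: "nat \<Rightarrow> complex \<Rightarrow> complex" where "some_root m s = (SOME u. u ^ m = s)"

lemma some_root_power [simp]: assumes "m > 0" shows "some_root m s ^ m = s"
proof -
  have "\<exists>u. u ^ m = s"
  proof (cases "s = 0")
    case False
    then have "{z. z ^ m = s} \<noteq> {}" using card_nth_roots[OF False assms] assms by (metis card.empty less_irrefl)
    then show ?thesis by blast
  qed (use assms in \<open>auto intro: exI[of _ 0]\<close>)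
  then show ?thesis unfolding some_root_def by (rule someI_ex)
qed

text \<open>A polynomial with zero set avoiding a given point need not be invariant, and its norm may vanish at
  that point. One of its isotypic components, however, does not vanish there, and it vanishes outside \<open>U\<close>
  because the polynomial vanishes on the whole orbit of any point outside.\<close>

lemma zopen_descent:
  assumes m: "m > 0" and U: "zopen (power_map m -` U)" shows "zopen U"
  unfolding zopen_def
proof
  fix q assume q: "q \<in> U"
  let ?u = "some_root m (fst q)"
  have "(?u, snd q) \<in> power_map m -` U" using q m by (simp add: power_map_def)
  then obtain P where P: "ev P (?u, snd q) \<noteq> 0" "{q. ev P q \<noteq> 0} \<subseteq> power_map m -` U"
    using U unfolding zopen_def by blast
  obtain Pr where Pr: "\<And>u w. ev P (u, w) = (\<Sum>r<m. u ^ r * ev (Pr r) (u ^ m, w))"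
    using isotypic_decomposition[OF m] by blast
  obtain r where r: "r < m" "?u ^ r * ev (Pr r) (?u ^ m, snd q) \<noteq> 0"
    using P(1) unfolding Pr by (meson lessThan_iff sum.neutral)
  \<comment> \<open>for \<open>r > 0\<close> the factor \<open>bX\<close> makes \<open>Q\<close> vanish where \<open>u ^ r\<close> does\<close>
  define Q where "Q = (if r = 0 then 1 else bX) * Pr r"
  have Q: "ev Q (u ^ m, w) \<noteq> 0 \<longleftrightarrow> u ^ r * ev (Pr r) (u ^ m, w) \<noteq> 0" for u w
    using m by (simp add: Q_def)
  have "ev Q q \<noteq> 0" using Q[of ?u "snd q"] r m by simp
  moreover have "s \<in> U" if "ev Q s \<noteq> 0" for s
  proof (rule ccontr)
    assume s: "s \<notin> U"
    let ?v = "some_root m (fst s)"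
    have "?v ^ r * ev (Pr r) (?v ^ m, snd s) = 0"
    proof (rule isotypic_components_vanish[OF m _ r(1)])
      fix \<xi> :: complex assume \<xi>: "\<xi> ^ m = 1"
      then have "power_map m (\<xi> * ?v, snd s) = s" using m by (simp add: power_map_def power_mult_distrib)
      then have "ev P (\<xi> * ?v, snd s) = 0" using s P(2) by auto
      then show "(\<Sum>r<m. (\<xi> * ?v) ^ r * ev (Pr r) (?v ^ m, snd s)) = 0"
        using \<xi> unfolding Pr by (simp add: power_mult_distrib)
    qed
    then show False using Q[of ?v "snd s"] that m by simp
  qed
  ultimately show "\<exists>P. ev P q \<noteq> 0 \<and> {q'. ev P q' \<noteq> 0} \<subseteq> U" by blast
qed

text \<open>If \<open>f H = G\<close> with \<open>f\<close> invariant, then the isotypic components satisfy \<open>f H\<^sub>r = G\<^sub>r\<close>, and some \<open>H\<^sub>r\<close>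
  does not vanish at the given point.\<close>

lemma zreg_descent:
  assumes m: "m > 0" and f: "zreg (power_map m -` U) (f \<circ> power_map m)" shows "zreg U f"
proof (rule zregI)
  show U: "zopen U" using f zopen_descent[OF m] by (auto simp: zreg_def)
  obtain G H where GH: "\<And>q. power_map m q \<in> U \<Longrightarrow> ev H q \<noteq> 0 \<and> f (power_map m q) = ev G q / ev H q" using f by (auto simp: zreg_def)
  obtain Gr where Gr: "\<And>u w. ev G (u, w) = (\<Sum>r<m. u ^ r * ev (Gr r) (u ^ m, w))"
    using isotypic_decomposition[OF m] by blast
  obtain Hr where Hr: "\<And>u w. ev H (u, w) = (\<Sum>r<m. u ^ r * ev (Hr r) (u ^ m, w))"
    using isotypic_decomposition[OF m] by blast
  have key: "some_root m (fst s) ^ r * (f s * ev (Hr r) s - ev (Gr r) s) = 0" if "s \<in> U" "r < m" for s r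
  proof (rule isotypic_components_vanish[OF m _ that(2)])
    let ?u = "some_root m (fst s)"
    fix \<xi> :: complex assume \<xi>: "\<xi> ^ m = 1"
    have pm: "power_map m (\<xi> * ?u, snd s) = s" "(\<xi> * ?u) ^ m = fst s" using m \<xi> by (simp_all add: power_map_def power_mult_distrib)
    then have "f s * ev H (\<xi> * ?u, snd s) - ev G (\<xi> * ?u, snd s) = 0" using GH[of "(\<xi> * ?u, snd s)"] that(1) by simp
    then show "(\<Sum>r<m. (\<xi> * ?u) ^ r * (f s * ev (Hr r) s - ev (Gr r) s)) = 0"
      unfolding Gr Hr pm(2) by (simp add: sum_distrib_left sum_subtractf algebra_simps)
  qed
  fix q assume q: "q \<in> U"
  let ?u = "some_root m (fst q)"
  have "power_map m (?u, snd q) = q" using m by (simp add: power_map_def)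
  then have "ev H (?u, snd q) \<noteq> 0" using GH q by simp
  then obtain r where r: "r < m" "?u ^ r * ev (Hr r) (?u ^ m, snd q) \<noteq> 0"
    unfolding Hr by (meson lessThan_iff sum.neutral)
  define Q where "Q = (if r = 0 then 1 else bX) * Hr r"
  show "\<exists>W G H. zopen W \<and> q \<in> W \<and> (\<forall>s\<in>U \<inter> W. ev H s \<noteq> 0 \<and> f s = ev G s / ev H s)"
  proof (intro exI conjI ballI)
    show "zopen {s. ev Q s \<noteq> 0}" by simp
    have "fst q \<noteq> 0" if "r \<noteq> 0" using r(2) some_root_power[OF m, of "fst q"] that by (auto simp: power_0_left)
    then show "q \<in> {s. ev Q s \<noteq> 0}" using r m by (auto simp: Q_def)
    fix s assume s: "s \<in> U \<inter> {s. ev Q s \<noteq> 0}"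
    then show H: "ev (Hr r) s \<noteq> 0" by (auto simp: Q_def)
    have "some_root m (fst s) ^ r \<noteq> 0"
    proof (cases "r = 0")
      case False
      then have "fst s \<noteq> 0" using s by (auto simp: Q_def)
      then show ?thesis using some_root_power[OF m, of "fst s"] m by (metis power_eq_0_iff zero_power)
    qed simp
    moreover have "some_root m (fst s) ^ r * (f s * ev (Hr r) s - ev (Gr r) s) = 0" using key s r(1) by blast
    ultimately have "f s * ev (Hr r) s = ev (Gr r) s" by (metis mult_eq_0_iff right_minus_eq)
    then show "f s = ev (Gr r) s / ev (Hr r) s" using H by (simp add: field_simps)
  qed
qed

text \<open>The coordinates are \<open>u\<^sup>m\<close>, \<open>v / u\<close> and \<open>v\<^sup>m\<close>, \<open>u / v\<close>, respectively. Any choice of root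
  gives the same orbit.\<close>

definition qchart :: "nat \<Rightarrow> bool \<Rightarrow> C2 \<Rightarrow> (C2 \<times> C2 set) set" where
  "qchart m i q = quot_map_mu m (chart i (some_root m (fst q), snd q))"

lemma Bl_act_chart: "\<xi> \<noteq> 0 \<Longrightarrow> Bl_act \<xi> (chart i (x, w)) = chart i (\<xi> * x, w)"
  by (simp add: Bl_act_def chart_def scale2_image_line mult.assoc)

lemma quot_map_chart:
  assumes "m > 0" shows "quot_map_mu m (chart i q) = chart i ` {r. power_map m r = power_map m q}"
proof (intro equalityI subsetI)
  fix x assume "x \<in> quot_map_mu m (chart i q)"
  then obtain \<xi> where \<xi>: "\<xi> ^ m = 1" "x = Bl_act \<xi> (chart i q)" by (auto simp: quot_map_mu_def orbit_def roots_of_unity_def)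
  then have "\<xi> \<noteq> 0" using assms by (auto simp: zero_power)
  then have "x = chart i (\<xi> * fst q, snd q)" using \<xi> Bl_act_chart[of \<xi> i "fst q" "snd q"] by simp
  moreover have "power_map m (\<xi> * fst q, snd q) = power_map m q" using \<xi> by (simp add: power_map_def power_mult_distrib)
  ultimately show "x \<in> chart i ` {r. power_map m r = power_map m q}" by blast
next
  fix x assume "x \<in> chart i ` {r. power_map m r = power_map m q}"
  then obtain r where r: "x = chart i r" "fst r ^ m = fst q ^ m" "snd r = snd q" by (auto simp: power_map_def)
  have "\<exists>\<xi>. \<xi> ^ m = 1 \<and> \<xi> \<noteq> 0 \<and> fst r = \<xi> * fst q"
  proof (cases "fst q = 0")
    case True then show ?thesis using r assms by (intro exI[of _ 1]) (auto simp: zero_power)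
  next
    case False
    moreover have "fst r \<noteq> 0" using r False assms by (metis power_eq_0_iff)
    ultimately show ?thesis using r by (intro exI[of _ "fst r / fst q"]) (auto simp: power_divide)
  qed
  then obtain \<xi> where \<xi>: "\<xi> ^ m = 1" "\<xi> \<noteq> 0" "fst r = \<xi> * fst q" by blast
  then have "x = Bl_act \<xi> (chart i q)" using r Bl_act_chart[of \<xi> i "fst q" "snd q"] by (metis prod.collapse)
  then show "x \<in> quot_map_mu m (chart i q)" using \<xi> by (auto simp: quot_map_mu_def orbit_def roots_of_unity_def)
qed

lemma quot_map_eq_qchart: assumes "m > 0" shows "quot_map_mu m (chart i q) = qchart m i (power_map m q)"
  using assms by (simp add: qchart_def quot_map_chart power_map_def)

lemma qchart_eq_image: assumes "m > 0" shows "qchart m i q = chart i ` {r. power_map m r = q}"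
  using assms by (simp add: qchart_def quot_map_chart) (simp add: power_map_def)

lemma chart_in_qchart: assumes "m > 0" "x \<in> points Bl" "quot_map_mu m x = qchart m i q" obtains r where "x = chart i r" "power_map m r = q"
proof -
  obtain j r where "x = chart j r" using assms(2) Bl_cover by auto
  then have "x \<in> quot_map_mu m x" using quot_map_chart[OF assms(1)] by auto
  then show thesis using that assms(3) qchart_eq_image[OF assms(1)] by auto
qed

lemma qchart_inj: assumes "m > 0" shows "inj (qchart m i)"
proof (rule injI)
  fix q q' assume eq: "qchart m i q = qchart m i q'"
  have "power_map m (some_root m (fst q), snd q) = q" using assms by (simp add: power_map_def)
  then have "chart i (some_root m (fst q), snd q) \<in> qchart m i q" unfolding qchart_eq_image[OF assms] by (intro imageI CollectI)
  then have "chart i (some_root m (fst q), snd q) \<in> qchart m i q'" unfolding eq .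
  then have "chart i (some_root m (fst q), snd q) \<in> chart i ` {r. power_map m r = q'}" unfolding qchart_eq_image[OF assms] .
  then have "power_map m (some_root m (fst q), snd q) = q'" by (auto simp only: chart_inj image_iff mem_Collect_eq)
  then show "q = q'" using assms by (simp add: power_map_def)
qed

lemma points_Bl_quot: "points (Bl_quot m) = quot_map_mu m ` points Bl"
proof -
  have "preim Bl (quot_map_mu m) (quot_map_mu m ` points Bl) = points Bl" by (auto simp: preim_def)
  then have "openin (ztop (Bl_quot m)) (quot_map_mu m ` points Bl)" by (simp add: Bl_quot_def quot_def openin_quot_top)
  moreover have "openin (ztop (Bl_quot m)) U \<Longrightarrow> U \<subseteq> quot_map_mu m ` points Bl" for U
    by (simp add: Bl_quot_def quot_def openin_quot_top)
  ultimately show ?thesis by (metis openin_subset openin_topspace subset_antisym)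
qed

lemma openin_Bl_quot:
  "openin (ztop (Bl_quot m)) U \<longleftrightarrow> U \<subseteq> points (Bl_quot m) \<and> openin (ztop Bl) (preim Bl (quot_map_mu m) U)"
  unfolding points_Bl_quot by (simp add: Bl_quot_def quot_def openin_quot_top)

lemma regular_Bl_quot:
  "regular (Bl_quot m) U f \<longleftrightarrow> openin (ztop (Bl_quot m)) U \<and> regular Bl (preim Bl (quot_map_mu m) U) (f \<circ> quot_map_mu m)"
  by (simp add: Bl_quot_def quot_def)

lemma chart_vimage_preim:
  assumes "m > 0" shows "chart i -` preim Bl (quot_map_mu m) U = power_map m -` qchart m i -` U"
  using assms by (auto simp: preim_def quot_map_eq_qchart)

lemma qchart_flip: assumes "m > 0" "w \<noteq> 0" shows "qchart m i (s, w) = qchart m (\<not> i) (s * w ^ m, 1 / w)"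
proof -
  have "qchart m i (s, w) = quot_map_mu m (chart (\<not> i) (some_root m s * w, 1 / w))"
    using assms chart_flip[of w i "some_root m s"] by (simp add: qchart_def)
  then show ?thesis using assms by (simp add: quot_map_eq_qchart power_map_def power_mult_distrib)
qed

lemma Bl_quot_atlas: assumes m: "m > 0" shows "plane_atlas (Bl_quot m) (qchart m)"
proof
  show "inj (qchart m i)" for i by (rule qchart_inj[OF m])
  have *: "quot_map_mu m ` range (chart i) = range (qchart m i)" for i
    unfolding image_image quot_map_eq_qchart[OF m]
  proof (intro equalityI subsetI)
    fix x assume "x \<in> range (qchart m i)"
    then obtain q where "x = qchart m i q" by blast
    then have "x = qchart m i (power_map m (some_root m (fst q), snd q))" using m by (simp add: power_map_def)
    then show "x \<in> range (\<lambda>q. qchart m i (power_map m q))" by blast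
  qed auto
  then show "points (Bl_quot m) = range (qchart m True) \<union> range (qchart m False)"
    by (simp add: points_Bl_quot Bl_cover image_Un)
  show "zopen (qchart m i -` V)" if "openin (ztop (Bl_quot m)) V" for V i
  proof -
    have "zopen (chart i -` preim Bl (quot_map_mu m) V)" using that openin_Bl_quot Bl.open_preim by blast
    then show ?thesis using zopen_descent[OF m] chart_vimage_preim[OF m] by simp
  qed
  show "openin (ztop (Bl_quot m)) (qchart m i ` W)" if "zopen W" for W i
  proof -
    have "preim Bl (quot_map_mu m) (qchart m i ` W) = chart i ` (power_map m -` W)"
    proof (intro equalityI subsetI)
      fix x assume "x \<in> preim Bl (quot_map_mu m) (qchart m i ` W)"
      then obtain q where q: "x \<in> points Bl" "quot_map_mu m x = qchart m i q" "q \<in> W" by (auto simp: preim_def)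
      obtain r where "x = chart i r" "power_map m r = q" by (rule chart_in_qchart[OF m q(1,2)])
      then show "x \<in> chart i ` (power_map m -` W)" using q(3) by simp
    qed (auto simp: preim_def quot_map_eq_qchart[OF m])
    moreover have "qchart m i ` W \<subseteq> points (Bl_quot m)" using * by (auto simp: points_Bl_quot qchart_def)
    ultimately show ?thesis using Bl.open_image zopen_power_map that openin_Bl_quot by simp
  qed
  show "openin (ztop (Bl_quot m)) V" if "regular (Bl_quot m) V f" for V f using that regular_Bl_quot by blast
  show "zreg (qchart m i -` V) (f \<circ> qchart m i)" if "regular (Bl_quot m) V f" for V f i
  proof (rule zreg_descent[OF m])
    have "zreg (chart i -` preim Bl (quot_map_mu m) V) ((f \<circ> quot_map_mu m) \<circ> chart i)"
      using that regular_Bl_quot Bl.regular_preim by blast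
    then show "zreg (power_map m -` qchart m i -` V) (f \<circ> qchart m i \<circ> power_map m)"
      unfolding chart_vimage_preim[OF m] by (rule zreg_cong[rotated]) (simp add: quot_map_eq_qchart[OF m])
  qed
  show "regular (Bl_quot m) V f" if V: "openin (ztop (Bl_quot m)) V" "V \<subseteq> range (qchart m i)"
    "zreg (qchart m i -` V) (f \<circ> qchart m i)" for V f i
    unfolding regular_Bl_quot
  proof (intro conjI V Bl.regular_chart)
    show "openin (ztop Bl) (preim Bl (quot_map_mu m) V)" using V openin_Bl_quot by blast
    show "preim Bl (quot_map_mu m) V \<subseteq> range (chart i)"
    proof
      fix x assume "x \<in> preim Bl (quot_map_mu m) V"
      then obtain q where q: "x \<in> points Bl" "quot_map_mu m x = qchart m i q" using V(2) by (auto simp: preim_def)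
      obtain r where "x = chart i r" by (rule chart_in_qchart[OF m q])
      then show "x \<in> range (chart i)" by simp
    qed
    show "zreg (chart i -` preim Bl (quot_map_mu m) V) (f \<circ> quot_map_mu m \<circ> chart i)"
      unfolding chart_vimage_preim[OF m]
      by (rule zreg_cong[OF _ zreg_power_map[OF V(3), of m]]) (simp add: quot_map_eq_qchart[OF m])
  qed
  have "qchart m True (1, 1) = qchart m False (1, 1)" using qchart_flip[OF m, of 1 True 1] by simp
  then show "range (qchart m True) \<inter> range (qchart m False) \<noteq> {}" by (metis disjoint_iff rangeI)
qed

lemma ev_ext: "(\<And>q. ev P q = ev Q q) \<Longrightarrow> P = Q"
  using ev_eq_on_nonzero[of 1 P Q] by simp

lemma irreducible_factor_at:
  assumes "f \<noteq> 0" "ev f q = 0" obtains w where "irreducible w" "w dvd f" "q \<in> zeros w"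
proof -
  have "\<exists>w. irreducible w \<and> w dvd f \<and> q \<in> zeros w" using assms
  proof (induction f rule: prime_divisors_induct)
    case (unit f)
    then obtain g where "f * g = 1" by (metis dvdE)
    then have "ev f q * ev g q = 1" by (metis ev_simps(2) ev_simps(4))
    then show ?case using unit by simp
  next
    case (factor p f)
    show ?case
    proof (cases "ev p q = 0")
      case True
      then show ?thesis using factor by (intro exI[of _ p]) (auto simp: zeros_def dest: prime_elem_imp_irreducible)
    next
      case False
      then show ?thesis using factor by (auto intro: dvd_mult)
    qed
  qed simp
  then show thesis using that by blast
qed

lemma multiplicity_irreducible:
  fixes p q :: bpoly assumes "irreducible p" "irreducible q"
  shows "multiplicity p q = (if p dvd q then 1 else 0)"
proof (cases "p dvd q")
  case True
  have q0: "q \<noteq> 0" using assms(2) by auto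
  have "multiplicity p q = multiplicity q q"
    using val_associated[OF assms True, of "to_fract q"] val_poly[OF assms(1) q0] val_poly[OF assms(2) q0] by simp
  then show ?thesis using True assms(2) by (simp add: multiplicity_prime irreducible_imp_prime_elem)
qed (simp add: not_dvd_imp_multiplicity_0)

section \<open>Prime divisors of ruled surfaces\<close>

text \<open>The total space of a line bundle of degree \<open>- k\<close> over the projective line. The blow-up has \<open>k = 1\<close>,
  its quotient has \<open>k = m\<close>. The chart \<open>False\<close> covers everything except one fibre.\<close>

locale ruled_atlas = plane_atlas Y \<psi> for Y :: "'a fspace" and \<psi> +
  fixes k :: nat
  assumes flip: "w \<noteq> 0 \<Longrightarrow> \<psi> i (s, w) = \<psi> (\<not> i) (s * w ^ k, 1 / w)"
    and overlap: "\<psi> False q = \<psi> True r \<Longrightarrow> snd q * snd r = 1"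
begin

definition fibre :: "'a set" where "fibre = curve True bY"

lemma irreducible_bY: "irreducible bY" unfolding bY_def by (rule irreducible_linear_poly) auto

lemma irreducible_bX: "irreducible bX"
  unfolding bX_def by (simp add: irreducible_const_poly_iff irreducible_linear_field_poly)

lemma prime_fibre: "prime_divisor Y fibre" unfolding fibre_def by (rule prime_divisor_curve[OF irreducible_bY])

lemma fibre_preim: "\<psi> False -` fibre = {}"
proof (rule ccontr)
  assume "\<psi> False -` fibre \<noteq> {}"
  then have "range (\<psi> False) \<inter> curve True bY \<noteq> {}" by (auto simp: fibre_def)
  then have "\<psi> True -` range (\<psi> False) \<inter> zeros bY \<noteq> {}" using curve_meets open_image[OF zopen_UNIV] by blast
  then obtain q r where "\<psi> False q = \<psi> True r" "snd r = 0" by (auto simp: zeros_def) metis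
  then show False using overlap[of q r] by simp
qed

lemma prime_divisor_cases:
  assumes P: "prime_divisor Y P"
  obtains "P = fibre" | p where "irreducible p" "P = curve False p"
proof (cases "\<psi> False -` P = {}")
  case True
  obtain i p where p: "irreducible p" "P = curve i p" using P by (rule prime_divisorE)
  have "i" 
  proof (rule ccontr)
    assume "\<not> i"
    then show False using p True preim_curve[of i p] zeros_nonempty[OF p(1)] by simp
  qed
  then have P': "P = curve True p" using p by simp
  have "zeros p \<subseteq> zeros bY"
  proof
    fix q assume q: "q \<in> zeros p"
    then have "\<psi> True q \<in> P" using P' zeros_in_curve by blast
    moreover have "\<psi> True q = \<psi> False (fst q * snd q ^ k, 1 / snd q)" if "snd q \<noteq> 0"
      using flip[OF that, of True "fst q"] by simp
    ultimately show "q \<in> zeros bY" using True by (cases "snd q = 0") (auto simp: zeros_def)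
  qed
  then have "p dvd bY" using zeros_subset_iff[OF p(1)] by blast
  then have "P = fibre" unfolding fibre_def P' using curve_eq_iff[OF p(1) irreducible_bY] by blast
  then show thesis by (rule that(1))
next
  case False
  then show thesis using prime_divisor_in_chart[OF P] that(2) by blast
qed

lemma closedin_chartwise:
  assumes "Z \<subseteq> points Y" "\<And>i. zopen (- (\<psi> i -` Z))" shows "closedin (ztop Y) Z"
proof -
  have "points Y - Z = \<psi> True ` (- (\<psi> True -` Z)) \<union> \<psi> False ` (- (\<psi> False -` Z))"
    using cover by auto
  moreover have "openin (ztop Y) \<dots>" by (intro openin_Un open_image assms)
  ultimately show ?thesis using assms(1) by (simp add: closedin_def)
qed

text \<open>A closed set that is an irreducible curve in each chart is the closure of either of them as soon as
  it has a point in the overlap, since then both closures are the same prime divisor.\<close>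

lemma eq_curve_if_zeros:
  assumes Z: "Z \<subseteq> points Y" "\<psi> True -` Z = zeros p" "\<psi> False -` Z = zeros q"
    and p: "irreducible p" and q: "irreducible q" and r: "\<psi> True r \<in> Z" "\<psi> True r \<in> range (\<psi> False)"
  shows "Z = curve False q"
proof -
  have "zopen (- (\<psi> i -` Z))" for i by (cases i) (simp_all add: Z zopen_compl_zeros)
  then have cl: "closedin (ztop Y) Z" using closedin_chartwise Z(1) by blast
  have sub: "curve True p \<subseteq> Z" "curve False q \<subseteq> Z"
    unfolding curve_def by (intro closure_of_minimal cl; use Z in blast)+
  have "r \<in> zeros p" using r Z by blast
  then have "\<psi> True r \<in> curve True p" using zeros_in_curve by blast
  then have "\<psi> False -` curve True p \<noteq> {}" using r(2) by auto
  then obtain q' where q': "irreducible q'" "curve True p = curve False q'"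
    using prime_divisor_in_chart[OF prime_divisor_curve[OF p]] by blast
  then have "zeros q' \<subseteq> zeros q" using sub Z(3) preim_curve[of False q'] by blast
  then have "q' dvd q" using zeros_subset_iff[OF q'(1)] by blast
  then have eq: "curve True p = curve False q" using q' curve_eq_iff[OF q'(1) q] by blast
  have "Z \<subseteq> curve True p \<union> curve False q"
  proof
    fix x assume x: "x \<in> Z"
    then obtain i s where s: "x = \<psi> i s" using Z(1) pointsE by blast
    then have "s \<in> \<psi> i -` Z" using x by simp
    then have "s \<in> zeros (if i then p else q)" by (cases i) (simp_all add: Z)
    then show "x \<in> curve True p \<union> curve False q" using s zeros_in_curve by (cases i) auto
  qed
  then show ?thesis using sub eq by blast
qed

text \<open>By irreducibility, an open set that meets the curve meets it inside \<open>W\<close> as well.\<close>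

lemma closure_open_part:
  assumes p: "irreducible p" and W: "zopen W" "W \<inter> zeros p \<noteq> {}"
  shows "ztop Y closure_of (\<psi> i ` (zeros p \<inter> W)) = curve i p"
proof
  show "ztop Y closure_of (\<psi> i ` (zeros p \<inter> W)) \<subseteq> curve i p"
    unfolding curve_def by (intro closure_of_mono image_mono) auto
  show "curve i p \<subseteq> ztop Y closure_of (\<psi> i ` (zeros p \<inter> W))"
  proof (rule subsetI, unfold in_closure_of, intro conjI allI impI)
    fix x assume x: "x \<in> curve i p"
    then show "x \<in> points Y" using closedin_subset[OF closedin_curve] by blast
    fix T assume T: "x \<in> T \<and> openin (ztop Y) T"
    then have "\<psi> i -` T \<inter> zeros p \<noteq> {}" using x curve_meets by blast
    then have "\<psi> i -` T \<inter> W \<inter> zeros p \<noteq> {}" using T W open_preim by (intro zeros_irreducible[OF p]) auto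
    then show "\<exists>y. y \<in> \<psi> i ` (zeros p \<inter> W) \<and> y \<in> T" by blast
  qed
qed

end

section \<open>The divisors of the blow-up and of its quotient\<close>

text \<open>In the coordinates \<open>v\<close> and \<open>u / v\<close> one has \<open>u + v + v^(m + 1) = v (1 + v\<^sup>m + u / v)\<close>, and the second
  factor is \<open>theta m\<close>. In the coordinates \<open>v\<^sup>m\<close> and \<open>u / v\<close> of the quotient it becomes \<open>theta 1\<close>.\<close>

definition theta :: "nat \<Rightarrow> bpoly" where "theta m = 1 + bX ^ m + bY"

lemma ev_theta [simp]: "ev (theta m) q = 1 + fst q ^ m + snd q" by (simp add: theta_def)

lemma irreducible_theta: "irreducible (theta m)"
proof -
  have "ev (theta m) q = ev ([:1 + [:0, 1:] ^ m, 1:] :: bpoly) q" for q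
    unfolding ev_theta by (simp add: ev_def poly_power)
  then have "theta m = [:1 + [:0, 1:] ^ m, 1:]" by (rule ev_ext)
  moreover have "irreducible ([:1 + [:0, 1:] ^ m, 1:] :: bpoly)" by (rule irreducible_linear_poly) auto
  ultimately show ?thesis by simp
qed

text \<open>Pull-back of polynomials along the quotient map, expressed in the charts.\<close>

definition pull_poly :: "nat \<Rightarrow> bpoly \<Rightarrow> bpoly" where "pull_poly m P = (SOME P'. \<forall>q. ev P' q = ev P (power_map m q))"

lemma ev_pull_poly [simp]: "ev (pull_poly m P) q = ev P (power_map m q)"
proof -
  obtain P' where "\<And>q. ev P' q = ev P (power_map m q)" using ev_power_map by blast
  then have "\<forall>q. ev (pull_poly m P) q = ev P (power_map m q)"
    unfolding pull_poly_def by (intro someI[where P = "\<lambda>P'. \<forall>q. ev P' q = ev P (power_map m q)"]) blast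
  then show ?thesis by blast
qed

lemma pull_poly_simps [simp]: "pull_poly m (P * Q) = pull_poly m P * pull_poly m Q" "pull_poly m bX = bX ^ m" "pull_poly m bY = bY"
  "pull_poly m (theta 1) = theta m"
  by (rule ev_ext; simp add: power_map_def)+

interpretation Bl: ruled_atlas Bl chart 1
proof (intro ruled_atlas.intro Bl_atlas ruled_atlas_axioms.intro)
  show "chart i (s, w) = chart (\<not> i) (s * w ^ 1, 1 / w)" if "w \<noteq> 0" for w i s using chart_flip[OF that] by simp
  fix q r assume "chart False q = chart True r"
  then have l: "line (mk False 1 (snd q)) = line (mk True 1 (snd r))" by (simp add: chart_def)
  have "mk False 1 (snd q) \<in> line (mk False 1 (snd q))" by (simp add: in_line_mk)
  then have "mk False 1 (snd q) \<in> line (mk True 1 (snd r))" unfolding l .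
  then show "snd q * snd r = 1" unfolding in_line_mk by (simp add: mk_def ax_def ot_def mult.commute)
qed

lemma exc_eq: "exc = Bl.curve False bX"
proof (rule Bl.eq_curve_if_zeros)
  show "exc \<subseteq> points Bl" by (auto simp: exc_def)
  have *: "chart i -` exc = zeros bX" for i
  proof -
    have "chart i q \<in> exc \<longleftrightarrow> fst q = 0" for q
      using chart_in_Bl[of i q] by (cases i) (auto simp: exc_def chart_def mk_def)
    then show ?thesis by (simp add: set_eq_iff zeros_def)
  qed
  show "chart True -` exc = zeros bX" "chart False -` exc = zeros bX" by (rule *)+
  have "(0, 1) \<in> chart True -` exc" unfolding * by (simp add: zeros_def)
  then show "chart True (0, 1) \<in> exc" by simp
  show "chart True (0, 1) \<in> range (chart False)" using chart_flip[of 1 True 0] by simp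
qed (rule Bl.irreducible_bX)+

lemma nonzero_point_cases:
  assumes "x \<in> points Bl" "fst x \<noteq> (0, 0)"
  obtains a b where "a \<noteq> 0" "x = chart False (a, b)" "fst x = (a * b, a)" | a where "a \<noteq> 0" "fst x = (a, 0)"
proof -
  obtain j q where x: "x = chart j q" using assms(1) Bl_cover by auto
  show thesis
  proof (cases j)
    case False
    then have "fst x = (fst q * snd q, fst q)" using x by (simp add: chart_def mk_def)
    then show ?thesis using that(1)[of "fst q" "snd q"] assms(2) x False by auto
  next
    case True
    then have f: "fst x = (fst q, fst q * snd q)" using x by (simp add: chart_def mk_def)
    then have q0: "fst q \<noteq> 0" using assms(2) by auto
    show ?thesis
    proof (cases "snd q = 0")
      case True then show ?thesis using that(2)[of "fst q"] f q0 by auto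
    next
      case False
      then have "x = chart False (fst q * snd q, 1 / snd q)" using x True chart_flip[of "snd q" True "fst q"] by simp
      then show ?thesis using that(1)[of "fst q * snd q" "1 / snd q"] False q0 f by auto
    qed
  qed
qed

text \<open>A point of the plane outside the origin lies in the chart \<open>False\<close> of the blow-up unless \<open>v = 0\<close>.\<close>

lemma strict_transform_eq:
  assumes p: "irreducible p" and ne: "\<exists>q\<in>zeros p. fst q \<noteq> 0"
    and C: "\<And>a b. a \<noteq> 0 \<Longrightarrow> (a * b, a) \<in> C \<longleftrightarrow> ev p (a, b) = 0" "\<And>a. a \<noteq> 0 \<Longrightarrow> (a, 0) \<notin> C"
  shows "strict_transform C = Bl.curve False p"
proof -
  have "{(p, L) \<in> points Bl. p \<in> C \<and> p \<noteq> (0, 0)} = chart False ` (zeros p \<inter> {q. ev bX q \<noteq> 0})"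
  proof (intro equalityI subsetI)
    fix x assume "x \<in> {(p, L) \<in> points Bl. p \<in> C \<and> p \<noteq> (0, 0)}"
    then have x: "x \<in> points Bl" "fst x \<noteq> (0, 0)" "fst x \<in> C" by auto
    show "x \<in> chart False ` (zeros p \<inter> {q. ev bX q \<noteq> 0})"
    proof (rule nonzero_point_cases[OF x(1,2)])
      fix a b assume "a \<noteq> 0" "x = chart False (a, b)" "fst x = (a * b, a)"
      then show ?thesis using C(1)[of a b] x(3) by (auto simp: zeros_def)
    qed (use C(2) x in auto)
  next
    fix x assume "x \<in> chart False ` (zeros p \<inter> {q. ev bX q \<noteq> 0})"
    then obtain q where q: "x = chart False q" "q \<in> zeros p" "fst q \<noteq> 0" by auto
    then have "fst x = (fst q * snd q, fst q)" by (simp add: chart_def mk_def)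
    moreover have "x \<in> points Bl" using q by simp
    ultimately show "x \<in> {(p, L) \<in> points Bl. p \<in> C \<and> p \<noteq> (0, 0)}"
      using C(1)[of "fst q" "snd q"] q by (auto simp: zeros_def case_prod_unfold)
  qed
  then show ?thesis unfolding strict_transform_def
    using Bl.closure_open_part[OF p zopen_basic[of bX], of False] ne by auto
qed

lemma strict_transform_u: "strict_transform {(u, v). u = 0} = Bl.curve False bY"
proof (rule strict_transform_eq[OF Bl.irreducible_bY])
  show "\<exists>q\<in>zeros bY. fst q \<noteq> 0" by (rule bexI[of _ "(1, 0)"]) (auto simp: zeros_def)
qed auto

lemma strict_transform_uvd: "strict_transform {(u, v). u + v + v ^ Suc m = 0} = Bl.curve False (theta m)"
proof (rule strict_transform_eq[OF irreducible_theta])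
  show "\<exists>q\<in>zeros (theta m). fst q \<noteq> 0" by (rule bexI[of _ "(1, -2)"]) (auto simp: zeros_def)
  fix a b :: complex assume a: "a \<noteq> 0"
  have "a * b + a + a ^ Suc m = a * (1 + a ^ m + b)" by (simp add: algebra_simps)
  then show "(a * b, a) \<in> {(u, v). u + v + v ^ Suc m = 0} \<longleftrightarrow> ev (theta m) (a, b) = 0" using a by simp
qed auto

locale blowup_quotient = fixes m :: nat assumes m: "m > 0"

sublocale blowup_quotient \<subseteq> Q: ruled_atlas "Bl_quot m" "qchart m" m
proof (intro ruled_atlas.intro Bl_quot_atlas[OF m] ruled_atlas_axioms.intro)
  show "qchart m i (s, w) = qchart m (\<not> i) (s * w ^ m, 1 / w)" if "w \<noteq> 0" for w i s
    using qchart_flip[OF m that] .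
  fix q r assume eq: "qchart m False q = qchart m True r"
  have "power_map m (some_root m (fst q), snd q) = q" using m by (simp add: power_map_def)
  then have "chart False (some_root m (fst q), snd q) \<in> qchart m False q"
    unfolding qchart_eq_image[OF m] by (intro imageI CollectI)
  then have "chart False (some_root m (fst q), snd q) \<in> qchart m True r" unfolding eq .
  then obtain r' where "chart False (some_root m (fst q), snd q) = chart True r'" "power_map m r' = r"
    unfolding qchart_eq_image[OF m] by auto
  then show "snd q * snd r = 1" using Bl.overlap[of "(some_root m (fst q), snd q)" r'] by (auto simp: power_map_def)
qed

context blowup_quotient
begin

abbreviation "Y \<equiv> Bl_quot m"
abbreviation "\<pi> \<equiv> quot_map_mu m"

lemma exc_quot_eq: "exc_quot m = Q.curve False bX"
proof (rule Q.eq_curve_if_zeros)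
  show "exc_quot m \<subseteq> points Y" by (auto simp: exc_quot_def exc_def points_Bl_quot)
  have ex: "chart i q \<in> exc \<longleftrightarrow> fst q = 0" for i q
    using chart_in_Bl[of i q] by (cases i) (auto simp: exc_def chart_def mk_def)
  have *: "qchart m i -` exc_quot m = zeros bX" for i
  proof (intro equalityI subsetI)
    fix q assume "q \<in> qchart m i -` exc_quot m"
    then obtain x where x: "x \<in> exc" "\<pi> x = qchart m i q" by (auto simp: exc_quot_def)
    then have xB: "x \<in> points Bl" by (auto simp: exc_def)
    obtain r where "x = chart i r" "power_map m r = q" by (rule chart_in_qchart[OF m xB x(2)])
    then show "q \<in> zeros bX" using x(1) ex m by (auto simp: zeros_def power_map_def)
  next
    fix q assume "q \<in> zeros bX"
    then have "power_map m (0, snd q) = q" using m by (auto simp: zeros_def power_map_def prod_eq_iff)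
    then have "qchart m i q = \<pi> (chart i (0, snd q))" using quot_map_eq_qchart[OF m, of i "(0, snd q)"] by simp
    then show "q \<in> qchart m i -` exc_quot m" using ex[of i "(0, snd q)"] by (auto simp: exc_quot_def)
  qed
  show "qchart m True -` exc_quot m = zeros bX" "qchart m False -` exc_quot m = zeros bX" by (rule *)+
  have "(0, 1) \<in> qchart m True -` exc_quot m" unfolding * by (simp add: zeros_def)
  then show "qchart m True (0, 1) \<in> exc_quot m" by simp
  show "qchart m True (0, 1) \<in> range (qchart m False)" using Q.flip[of 1 True 0] by simp
qed (rule Bl.irreducible_bX)+

lemma pull_poly_eq_0_iff [simp]: "pull_poly m P = 0 \<longleftrightarrow> P = 0"
proof
  assume 0: "pull_poly m P = 0"
  show "P = 0"
  proof (rule ev_ext)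
    fix q
    have "power_map m (some_root m (fst q), snd q) = q" using m by (simp add: power_map_def)
    then show "ev P q = ev 0 q" using ev_pull_poly[of m P "(some_root m (fst q), snd q)"] 0 by simp
  qed
qed (rule ev_ext, simp)

lemma pullback_\<Phi>:
  assumes H: "H \<noteq> 0"
  shows "pullback_ratfun Bl \<pi> (Q.\<Phi> i (Fract G H)) = Bl.\<Phi> i (Fract (pull_poly m G) (pull_poly m H))"
proof -
  have *: "ratclass Bl (preim Bl \<pi> V) (g \<circ> \<pi>) = Bl.\<Phi> i (Fract (pull_poly m G) (pull_poly m H))" if Vg: "(V, g) \<in> Q.\<Phi> i (Fract G H)" for V g
  proof (rule Bl.ratclass_eq_\<Phi>)
    note V = Q.\<Phi>D[OF Vg]
    show "Bl.chartwise_regular (preim Bl \<pi> V) (g \<circ> \<pi>)" using V(2) regular_Bl_quot Bl.regular_chartwise by blast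
    have "V \<subseteq> \<pi> ` points Bl" using V(3) openin_subset points_Bl_quot by metis
    then show "preim Bl \<pi> V \<noteq> {}" using V(1) by (auto simp: preim_def)
    fix q assume "chart i q \<in> preim Bl \<pi> V"
    then have qV: "qchart m i (power_map m q) \<in> V" by (simp add: preim_def quot_map_eq_qchart[OF m])
    obtain G' H' where GH: "Fract G H = Fract G' H'" "ev H' (power_map m q) \<noteq> 0" "H' \<noteq> 0" "evf (Fract G H) (power_map m q) = ev G' (power_map m q) / ev H' (power_map m q)"
      using Q.\<Phi>D(4)[OF Vg qV] by (rule at_pointE)
    have "G * H' = G' * H" using GH H by (simp add: eq_fract)
    then have "pull_poly m G * pull_poly m H' = pull_poly m G' * pull_poly m H" by (metis pull_poly_simps(1))
    then have "Fract (pull_poly m G) (pull_poly m H) = Fract (pull_poly m G') (pull_poly m H')" using GH H by (simp add: eq_fract)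
    moreover have "ev (pull_poly m H') q \<noteq> 0" using GH by simp
    ultimately show "Fract (pull_poly m G) (pull_poly m H) \<in> at_point q \<and> evf (Fract (pull_poly m G) (pull_poly m H)) q = (g \<circ> \<pi>) (chart i q)"
      using GH Q.\<Phi>D(5)[OF Vg qV] by (simp add: at_pointI evf_Fract quot_map_eq_qchart[OF m])
  qed
  obtain V g where "(V, g) \<in> Q.\<Phi> i (Fract G H)" using Q.\<Phi>_nonempty by blast
  then show ?thesis unfolding pullback_ratfun_def using * by (auto split: prod.splits)
qed

lemma fibre_not_curve_False:
  assumes "irreducible z" shows "Q.fibre \<noteq> Q.curve False z"
  using Q.fibre_preim Q.preim_curve[of False z] zeros_nonempty[OF assms] by auto

text \<open>The local equation \<open>z\<close> of a divisor in the chart pulls back to \<open>pull_poly m z\<close>. Any other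
  admissible local equation differs from it by a function without zeros and poles on \<open>V\<close>.\<close>

lemma ord_pullback_local_equation:
  assumes z: "irreducible z" and p: "irreducible p"
    and V: "openin (ztop Y) V" "V \<inter> \<pi> ` Bl.curve False p \<noteq> {}"
    and g: "g \<in> carrier (function_field Y)" "g \<noteq> \<zero>\<^bsub>function_field Y\<^esub>"
    and ord: "\<And>W. prime_divisor Y W \<Longrightarrow> W \<inter> V \<noteq> {} \<Longrightarrow> ord_along Y W g = (if W = Q.curve False z then 1 else 0)"
  shows "ord_along Bl (Bl.curve False p) (pullback_ratfun Bl \<pi> g) = int (multiplicity p (pull_poly m z))"
proof -
  obtain x where x: "g = Q.\<Phi> False x" using g(1) by (rule Q.K_cases)
  have x0: "x \<noteq> 0" using g(2) x Q.zero_K[of False] by auto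
  have z0: "to_fract z \<noteq> 0" using z by auto
  define y where "y = x * inverse (to_fract z)"
  have y0: "y \<noteq> 0" using x0 z0 by (simp add: y_def)
  \<comment> \<open>\<open>g\<close> and \<open>z\<close> have the same divisor on \<open>V\<close>, so their quotient \<open>y\<close> has neither zeros nor poles there\<close>
  have valy: "val w y = 0" if w: "irreducible w" "q \<in> zeros w" "qchart m False q \<in> V" for w q
  proof -
    have "qchart m False q \<in> Q.curve False w" using w Q.zeros_in_curve by blast
    then have "Q.curve False w \<inter> V \<noteq> {}" using w by blast
    then have "ord_along Y (Q.curve False w) g = (if Q.curve False w = Q.curve False z then 1 else 0)"
      using ord[OF Q.prime_divisor_curve[OF w(1)]] by blast
    then have "val w x = (if Q.curve False w = Q.curve False z then 1 else 0)"
      unfolding x Q.ord_along_curve[OF w(1) x0] .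
    moreover have "val w (to_fract z) = (if Q.curve False w = Q.curve False z then 1 else 0)"
      using val_poly[OF w(1), of z] multiplicity_irreducible[OF w(1) z] Q.curve_eq_iff[OF w(1) z] z0 by simp
    ultimately show ?thesis using x0 z0 by (simp add: y_def val_mult[OF w(1)] val_inverse[OF w(1)])
  qed
  obtain G H where GH: "y = Fract G H" "H \<noteq> 0" "coprime G H" by (rule Fract_reducedE)
  have G0: "G \<noteq> 0" using GH y0 by (auto simp: Fract_eq_0_iff)
  have nv: "ev G q \<noteq> 0 \<and> ev H q \<noteq> 0" if q: "qchart m False q \<in> V" for q
  proof (intro conjI notI)
    assume "ev G q = 0"
    then obtain w where w: "irreducible w" "w dvd G" "q \<in> zeros w" using irreducible_factor_at[OF G0] by blast
    then show False using valy[OF w(1,3) q] val_coprime_nonneg_iff(2)[OF w(1) GH(3,2) G0] GH(1) by simp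
  next
    assume "ev H q = 0"
    then obtain w where w: "irreducible w" "w dvd H" "q \<in> zeros w" using irreducible_factor_at[OF GH(2)] by blast
    then show False using valy[OF w(1,3) q] val_coprime_nonneg_iff(1)[OF w(1) GH(3,2) G0] GH(1) by simp
  qed
  have "x = y * to_fract z" using z0 by (simp add: y_def)
  then have xf: "x = Fract (z * G) H" by (simp add: GH to_fract_def mult.commute)
  have pb: "pullback_ratfun Bl \<pi> g = Bl.\<Phi> False (Fract (pull_poly m z * pull_poly m G) (pull_poly m H))"
    unfolding x xf pullback_\<Phi>[OF GH(2)] by simp
  obtain x' where x': "x' \<in> Bl.curve False p" "\<pi> x' \<in> V" using V(2) by blast
  then have "x' \<in> preim Bl \<pi> V \<inter> Bl.curve False p" using closedin_subset[OF Bl.closedin_curve] by (auto simp: preim_def)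
  moreover have "openin (ztop Bl) (preim Bl \<pi> V)" using V(1) openin_Bl_quot by blast
  ultimately obtain q where q: "q \<in> zeros p" "chart False q \<in> preim Bl \<pi> V" using Bl.curve_meets by blast
  then have qV: "qchart m False (power_map m q) \<in> V" by (simp add: preim_def quot_map_eq_qchart[OF m])
  have "\<not> p dvd pull_poly m G" "\<not> p dvd pull_poly m H" using nv[OF qV] q(1) by (auto simp: zeros_def elim!: dvdE) (metis ev_pull_poly ev_simps(4) mult_zero_left)+
  then have mult: "multiplicity p (pull_poly m G) = 0" "multiplicity p (pull_poly m H) = 0" by (simp_all add: not_dvd_imp_multiplicity_0)
  have nz: "pull_poly m z * pull_poly m G \<noteq> 0" "pull_poly m H \<noteq> 0" using z G0 GH(2) by auto
  then have "Fract (pull_poly m z * pull_poly m G) (pull_poly m H) \<noteq> 0" by (simp add: Fract_eq_0_iff)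
  then have "ord_along Bl (Bl.curve False p) (pullback_ratfun Bl \<pi> g) = val p (Fract (pull_poly m z * pull_poly m G) (pull_poly m H))"
    unfolding pb by (rule Bl.ord_along_curve[OF p])
  also have "\<dots> = int (multiplicity p (pull_poly m z))"
    using nz mult prime_elem_multiplicity_mult_distrib[OF irreducible_imp_prime_elem[OF p], of "pull_poly m z" "pull_poly m G"]
    by (simp add: val_Fract[OF p nz])
  finally show ?thesis .
qed

text \<open>The strict transform of \<open>v = 0\<close> is a fibre and invisible in the chart \<open>False\<close>. In the chart \<open>True\<close> it is given by the
  second coordinate, which the quotient map preserves, so a function that is a unit along the
  fibre of the quotient pulls back to a unit along the fibre of the blow-up.\<close>

lemma ord_pullback_local_equation_fibre:
  assumes z: "irreducible z"
    and V: "openin (ztop Y) V" "V \<inter> \<pi> ` Bl.fibre \<noteq> {}"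
    and g: "g \<in> carrier (function_field Y)" "g \<noteq> \<zero>\<^bsub>function_field Y\<^esub>"
    and ord: "\<And>W. prime_divisor Y W \<Longrightarrow> W \<inter> V \<noteq> {} \<Longrightarrow> ord_along Y W g = (if W = Q.curve False z then 1 else 0)"
  shows "ord_along Bl Bl.fibre (pullback_ratfun Bl \<pi> g) = 0"
proof -
  note bY = Bl.irreducible_bY
  obtain x where x: "g = Q.\<Phi> True x" using g(1) by (rule Q.K_cases)
  have x0: "x \<noteq> 0" using g(2) x Q.zero_K[of True] by auto
  obtain x' where x': "x' \<in> Bl.fibre" "\<pi> x' \<in> V" using V(2) by blast
  then have "x' \<in> preim Bl \<pi> V \<inter> Bl.curve True bY" using closedin_subset[OF Bl.closedin_curve] by (auto simp: preim_def Bl.fibre_def)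
  moreover have "openin (ztop Bl) (preim Bl \<pi> V)" using V(1) openin_Bl_quot by blast
  ultimately obtain q where q: "q \<in> zeros bY" "chart True q \<in> preim Bl \<pi> V" using Bl.curve_meets by blast
  then have qV: "qchart m True (power_map m q) \<in> V" by (simp add: preim_def quot_map_eq_qchart[OF m])
  have pwY: "power_map m r \<in> zeros bY \<longleftrightarrow> r \<in> zeros bY" for r by (simp add: zeros_def power_map_def)
  have "qchart m True (power_map m q) \<in> Q.fibre"
    unfolding Q.fibre_def using pwY q(1) by (intro subsetD[OF Q.zeros_in_curve] imageI) blast
  then have "ord_along Y Q.fibre g = 0" using ord[OF Q.prime_fibre] qV fibre_not_curve_False[OF z] by auto
  then have "val bY x = 0" unfolding Q.fibre_def x Q.ord_along_curve[OF bY x0] .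
  moreover obtain G H where GH: "x = Fract G H" "H \<noteq> 0" "coprime G H" by (rule Fract_reducedE)
  moreover have G0: "G \<noteq> 0" using GH x0 by (auto simp: Fract_eq_0_iff)
  ultimately have nd: "\<not> bY dvd G" "\<not> bY dvd H" using val_coprime_nonneg_iff[OF bY GH(3,2) G0] by auto
  have "\<not> bY dvd pull_poly m F" if "\<not> bY dvd F" for F
  proof -
    obtain r where r: "r \<in> zeros bY" "ev F r \<noteq> 0"
      using \<open>\<not> bY dvd F\<close> zeros_subset_iff[OF bY, of F] by (auto simp: zeros_def)
    have "power_map m (some_root m (fst r), snd r) = r" using m by (simp add: power_map_def)
    then have "(some_root m (fst r), snd r) \<in> zeros bY" "(some_root m (fst r), snd r) \<notin> zeros (pull_poly m F)"
      using r by (simp_all add: zeros_def)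
    then show ?thesis using zeros_subset_iff[OF bY] by blast
  qed
  then have "multiplicity bY (pull_poly m G) = 0" "multiplicity bY (pull_poly m H) = 0"
    using nd by (simp_all add: not_dvd_imp_multiplicity_0)
  moreover have nz: "pull_poly m G \<noteq> 0" "pull_poly m H \<noteq> 0" using G0 GH(2) by auto
  ultimately have "val bY (Fract (pull_poly m G) (pull_poly m H)) = 0" "Fract (pull_poly m G) (pull_poly m H) \<noteq> 0"
    by (simp_all add: val_Fract[OF bY] Fract_eq_0_iff)
  then show ?thesis unfolding x GH(1) pullback_\<Phi>[OF GH(2)] Bl.fibre_def by (simp add: Bl.ord_along_curve[OF bY])
qed

text \<open>Existence of an admissible local equation: \<open>z\<close> itself on the whole chart.\<close>

lemma pullback_mult_curve:
  assumes z: "irreducible z" and p: "irreducible p"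
  shows "pullback_mult Bl Y \<pi> (Q.curve False z) (Bl.curve False p) = int (multiplicity p (pull_poly m z))"
  unfolding pullback_mult_def
proof (rule the_equality)
  let ?V = "range (qchart m False)" and ?g = "Q.\<Phi> False (to_fract z)"
  have V: "openin (ztop Y) ?V" by (rule Q.open_image[OF zopen_UNIV])
  obtain q where "q \<in> zeros p" using zeros_nonempty[OF p] by blast
  then have "chart False q \<in> Bl.curve False p" "\<pi> (chart False q) \<in> ?V"
    using Bl.zeros_in_curve by (blast, simp add: quot_map_eq_qchart[OF m])
  then have meets: "?V \<inter> \<pi> ` Bl.curve False p \<noteq> {}" by blast
  have g: "?g \<in> carrier (function_field Y)" "?g \<noteq> \<zero>\<^bsub>function_field Y\<^esub>"
    using z by (auto simp: Q.zero_K[of False])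
  have ord: "ord_along Y W ?g = (if W = Q.curve False z then 1 else 0)" if W: "prime_divisor Y W" "W \<inter> ?V \<noteq> {}" for W
  proof -
    have "qchart m False -` W \<noteq> {}" using W(2) by blast
    then obtain w where w: "irreducible w" "W = Q.curve False w" using Q.prime_divisor_in_chart[OF W(1)] by blast
    have z0: "z \<noteq> 0" using z by auto
    then show ?thesis
      using Q.ord_along_curve[OF w(1), of "to_fract z" False] val_poly[OF w(1) z0] multiplicity_irreducible[OF w(1) z]
        Q.curve_eq_iff[OF w(1) z, of False] w(2) by simp
  qed
  show "\<exists>V g. openin (ztop Y) V \<and> V \<inter> \<pi> ` Bl.curve False p \<noteq> {} \<and> g \<in> carrier (function_field Y) \<and>
      g \<noteq> \<zero>\<^bsub>function_field Y\<^esub> \<and>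
      (\<forall>W. prime_divisor Y W \<longrightarrow> W \<inter> V \<noteq> {} \<longrightarrow> ord_along Y W g = (if W = Q.curve False z then 1 else 0)) \<and>
      int (multiplicity p (pull_poly m z)) = ord_along Bl (Bl.curve False p) (pullback_ratfun Bl \<pi> g)"
    by (rule exI[of _ ?V], rule exI[of _ ?g])
      (use V meets g ord ord_pullback_local_equation[OF z p V meets g ord] in simp)
qed (use ord_pullback_local_equation[OF z p] in blast)

text \<open>No divisor in question contains the fibre, so \<open>1\<close> is a local equation near its generic point.\<close>

lemma pullback_mult_fibre:
  assumes z: "irreducible z"
  shows "pullback_mult Bl Y \<pi> (Q.curve False z) Bl.fibre = 0"
  unfolding pullback_mult_def
proof (rule the_equality)
  let ?V = "points Y - Q.curve False z" and ?g = "Q.\<Phi> True 1"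
  have V: "openin (ztop Y) ?V" using Q.closedin_curve by blast
  have "\<not> qchart m True ` zeros bY \<subseteq> Q.curve False z"
  proof
    assume "qchart m True ` zeros bY \<subseteq> Q.curve False z"
    then have "Q.fibre \<subseteq> Q.curve False z" unfolding Q.fibre_def Q.curve_def[of True] by (intro closure_of_minimal Q.closedin_curve)
    moreover have "Q.curve False z \<subset> points Y" using Q.curve_neq_points[OF z] closedin_subset[OF Q.closedin_curve] by blast
    ultimately show False
      using Q.prime_fibre Q.irreducible_closed_curve[OF z] fibre_not_curve_False[OF z] unfolding prime_divisor_def by blast
  qed
  then obtain q where q: "q \<in> zeros bY" "qchart m True q \<notin> Q.curve False z" by blast
  have "power_map m (some_root m (fst q), snd q) = q" using m by (simp add: power_map_def)
  moreover have "(some_root m (fst q), snd q) \<in> zeros bY" using q by (simp add: zeros_def)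
  then have "chart True (some_root m (fst q), snd q) \<in> Bl.fibre" unfolding Bl.fibre_def using Bl.zeros_in_curve by blast
  moreover have "qchart m True q \<in> points Y" using Q.range_points by blast
  ultimately have meets: "?V \<inter> \<pi> ` Bl.fibre \<noteq> {}"
    using q quot_map_eq_qchart[OF m, of True "(some_root m (fst q), snd q)"] by (metis DiffI IntI empty_iff image_eqI)
  have g: "?g \<in> carrier (function_field Y)" "?g \<noteq> \<zero>\<^bsub>function_field Y\<^esub>"
    by (auto simp: Q.zero_K[of True])
  have ord: "ord_along Y W ?g = (if W = Q.curve False z then 1 else 0)" if W: "prime_divisor Y W" "W \<inter> ?V \<noteq> {}" for W
  proof -
    obtain i w where w: "irreducible w" "W = Q.curve i w" using W(1) by (rule Q.prime_divisorE)
    have "?g = Q.\<Phi> i 1" using Q.one_K by metis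
    then have "ord_along Y W ?g = 0" using Q.ord_along_curve[OF w(1), of 1 i] w by simp
    then show ?thesis using W(2) by auto
  qed
  show "\<exists>V g. openin (ztop Y) V \<and> V \<inter> \<pi> ` Bl.fibre \<noteq> {} \<and> g \<in> carrier (function_field Y) \<and>
      g \<noteq> \<zero>\<^bsub>function_field Y\<^esub> \<and>
      (\<forall>W. prime_divisor Y W \<longrightarrow> W \<inter> V \<noteq> {} \<longrightarrow> ord_along Y W g = (if W = Q.curve False z then 1 else 0)) \<and>
      0 = ord_along Bl Bl.fibre (pullback_ratfun Bl \<pi> g)"
    by (rule exI[of _ ?V], rule exI[of _ ?g])
      (use V meets g ord ord_pullback_local_equation_fibre[OF z V meets g ord] in simp)
qed (use ord_pullback_local_equation_fibre[OF z] in blast)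

end

lemma interval_eval:
  fixes lo hi :: rat assumes "lo \<le> hi"
  shows "(LEAST w. \<exists>v\<in>{lo..hi}. w = of_int n * v) = (if 0 \<le> n then of_int n * lo else of_int n * hi)"
proof (rule Least_equality)
  show "\<exists>v\<in>{lo..hi}. (if 0 \<le> n then of_int n * lo else of_int n * hi) = of_int n * v"
    using assms by (cases "0 \<le> n") auto
  fix w :: rat assume "\<exists>v\<in>{lo..hi}. w = of_int n * v"
  then show "(if 0 \<le> n then of_int n * lo else of_int n * hi) \<le> w"
    by (auto intro: mult_left_mono mult_left_mono_neg)
qed

lemma eval_interval_superadditive:
  fixes lo hi :: rat assumes "lo \<le> hi"
  shows "(if 0 \<le> n then of_int n * lo else of_int n * hi) + (if 0 \<le> k then of_int k * lo else of_int k * hi)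
     \<le> (if 0 \<le> n + k then of_int (n + k) * lo else of_int (n + k) * hi)"
proof -
  have "of_int i * hi \<le> of_int i * lo" if "i \<le> 0" for i
    using that assms by (intro mult_left_mono_neg) auto
  moreover have "of_int i * lo \<le> of_int i * hi" if "0 \<le> i" for i
    using that assms by (intro mult_left_mono) auto
  ultimately show ?thesis
    by (auto simp: distrib_right not_le intro: less_imp_le)
qed

text \<open>The minimum of \<open>n v\<close> over an interval is superadditive in \<open>n\<close>, which makes the direct sum of the
  sections an algebra.\<close>

lemma floor_eval_superadditive:
  assumes "polyhedral_divisor Y D"
  shows "\<lfloor>eval_pdivisor D n P\<rfloor> + \<lfloor>eval_pdivisor D k P\<rfloor> \<le> \<lfloor>eval_pdivisor D (n + k) P\<rfloor>"
proof -
  obtain lo hi where "lo \<le> hi" "D P = {lo..hi}" using assms unfolding polyhedral_divisor_def by blast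
  then have "eval_pdivisor D n P + eval_pdivisor D k P \<le> eval_pdivisor D (n + k) P"
    using eval_interval_superadditive[of lo hi n k] by (simp only: eval_pdivisor_def interval_eval)
  then show ?thesis using le_floor_add floor_mono order_trans by blast
qed

context plane_atlas
begin

lemma ord_mult:
  assumes P: "prime_divisor Y P" and a: "a \<in> carrier K" "a \<noteq> \<zero>\<^bsub>K\<^esub>" and b: "b \<in> carrier K" "b \<noteq> \<zero>\<^bsub>K\<^esub>"
  shows "ord_along Y P (a \<otimes>\<^bsub>K\<^esub> b) = ord_along Y P a + ord_along Y P b"
proof -
  obtain i p where p: "irreducible p" "P = curve i p" using P by (rule prime_divisorE)
  obtain x y where "a = \<Phi> i x" "b = \<Phi> i y" using a(1) b(1) by (metis K_cases)
  then show ?thesis using a b p by (simp add: zero_K[of i] mult_\<Phi> ord_along_curve val_mult)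
qed

lemma ord_add:
  assumes P: "prime_divisor Y P" and a: "a \<in> carrier K" "a \<noteq> \<zero>\<^bsub>K\<^esub>" and b: "b \<in> carrier K" "b \<noteq> \<zero>\<^bsub>K\<^esub>"
    and s: "a \<oplus>\<^bsub>K\<^esub> b \<noteq> \<zero>\<^bsub>K\<^esub>" and n: "n \<le> ord_along Y P a" "n \<le> ord_along Y P b"
  shows "n \<le> ord_along Y P (a \<oplus>\<^bsub>K\<^esub> b)"
proof -
  obtain i p where p: "irreducible p" "P = curve i p" using P by (rule prime_divisorE)
  obtain x y where "a = \<Phi> i x" "b = \<Phi> i y" using a(1) b(1) by (metis K_cases)
  then show ?thesis using a b p s n by (simp add: zero_K[of i] add_\<Phi> ord_along_curve val_add)
qed

lemma \<Phi>_const: "\<Phi> i (to_fract (bC c)) = \<Phi> j (to_fract (bC c))"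
  using smult_\<Phi>[of c i 1] smult_\<Phi>[of c j 1] one_K[of i] one_K[of j] by simp

lemma ord_const:
  assumes P: "prime_divisor Y P" and c: "c \<noteq> 0" shows "ord_along Y P (\<Phi> i (to_fract (bC c))) = 0"
proof -
  obtain j p where p: "irreducible p" "P = curve j p" using P by (rule prime_divisorE)
  have "bC c * bC (1 / c) = 1" using c by (simp flip: bC_simps(3))
  then have "is_unit (bC c)" by (metis dvd_triv_left)
  then have "multiplicity p (bC c) = 0" by (rule multiplicity_unit_right)
  moreover have "to_fract (bC c) \<noteq> 0" using c by simp
  ultimately show ?thesis using p c by (simp add: \<Phi>_const[of i c j] ord_along_curve val_poly)
qed

lemma sections_zero [simp]: "\<zero>\<^bsub>K\<^esub> \<in> sections Y D"
  using \<Phi>_carrier[of True 0] by (simp add: sections_def zero_K[of True])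

lemma sections_mult:
  assumes D: "\<And>P. \<lfloor>D P\<rfloor> + \<lfloor>D' P\<rfloor> \<le> \<lfloor>D'' P\<rfloor>" and a: "a \<in> sections Y D" and b: "b \<in> sections Y D'"
  shows "a \<otimes>\<^bsub>K\<^esub> b \<in> sections Y D''"
proof -
  interpret cring K by (rule cring_K)
  have ab: "a \<in> carrier K" "b \<in> carrier K" using a b by (auto simp: sections_def)
  show ?thesis
  proof (cases "a = \<zero>\<^bsub>K\<^esub> \<or> b = \<zero>\<^bsub>K\<^esub>")
    case True then show ?thesis using ab by auto
  next
    case False
    have "0 \<le> ord_along Y P (a \<otimes>\<^bsub>K\<^esub> b) + \<lfloor>D'' P\<rfloor>" if P: "prime_divisor Y P" for P
    proof -
      have "0 \<le> ord_along Y P a + \<lfloor>D P\<rfloor>" "0 \<le> ord_along Y P b + \<lfloor>D' P\<rfloor>"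
        using False a b P by (auto simp: sections_def)
      then show ?thesis using D[of P] ord_mult[OF P ab(1) _ ab(2)] False by simp
    qed
    then show ?thesis using ab by (simp add: sections_def)
  qed
qed

lemma sections_add:
  assumes a: "a \<in> sections Y D" and b: "b \<in> sections Y D"
  shows "a \<oplus>\<^bsub>K\<^esub> b \<in> sections Y D"
proof -
  interpret cring K by (rule cring_K)
  have ab: "a \<in> carrier K" "b \<in> carrier K" using a b by (auto simp: sections_def)
  show ?thesis
  proof (cases "a = \<zero>\<^bsub>K\<^esub> \<or> b = \<zero>\<^bsub>K\<^esub>")
    case True then show ?thesis using a b ab by auto
  next
    case False
    have "0 \<le> ord_along Y P (a \<oplus>\<^bsub>K\<^esub> b) + \<lfloor>D P\<rfloor>" if P: "prime_divisor Y P" and nz: "a \<oplus>\<^bsub>K\<^esub> b \<noteq> \<zero>\<^bsub>K\<^esub>" for P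
    proof -
      have "- \<lfloor>D P\<rfloor> \<le> ord_along Y P a" "- \<lfloor>D P\<rfloor> \<le> ord_along Y P b"
        using False a b P unfolding sections_def by force+
      then have "- \<lfloor>D P\<rfloor> \<le> ord_along Y P (a \<oplus>\<^bsub>K\<^esub> b)" using ord_add[OF P ab(1) _ ab(2) _ nz] False by blast
      then show ?thesis by simp
    qed
    then show ?thesis using ab by (auto simp: sections_def)
  qed
qed

lemma sections_const: assumes "\<And>P. 0 \<le> \<lfloor>D P\<rfloor>" shows "\<Phi> i (to_fract (bC c)) \<in> sections Y D"
proof (cases "c = 0")
  case True then show ?thesis using zero_K[of i] sections_zero[of D] by simp
next
  case False then show ?thesis using assms by (simp add: sections_def ord_const)
qed

end

context ruled_atlas
begin

text \<open>A rational function given in one chart is rewritten in the other by comparing values on the overlap.\<close>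

lemma transition:
  assumes H: "H \<noteq> 0" "H' \<noteq> 0"
    and eq: "\<And>s w. w \<noteq> 0 \<Longrightarrow> ev G (s * w ^ k, 1 / w) * ev H' (s, w) = ev G' (s, w) * ev H (s * w ^ k, 1 / w)"
  shows "\<Phi> False (Fract G H) = \<Phi> True (Fract G' H')"
proof -
  obtain V g where Vg: "(V, g) \<in> \<Phi> False (Fract G H)" using \<Phi>_nonempty by blast
  note V = \<Phi>D[OF Vg]
  define U where "U = V \<inter> \<psi> False ` {q. ev H q \<noteq> 0} \<inter> \<psi> True ` {q. ev H' q \<noteq> 0} \<inter> \<psi> True ` {q. ev bY q \<noteq> 0}"
  have ne: "{q. ev P q \<noteq> 0} \<noteq> {}" if "P \<noteq> 0" for P using ev_nonzero[OF that] by blast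
  have bY0: "bY \<noteq> 0" by (simp add: bY_def)
  have o: "openin (ztop Y) (\<psi> i ` {q. ev P q \<noteq> 0})" "P \<noteq> 0 \<Longrightarrow> \<psi> i ` {q. ev P q \<noteq> 0} \<noteq> {}" for i P
    using open_image[OF zopen_basic] ne by auto
  have U: "openin (ztop Y) U" "U \<noteq> {}"
    unfolding U_def by (intro openin_Int open_meet o V H bY0)+
  have "(V, g) \<in> \<Phi> True (Fract G' H')"
  proof (rule \<Phi>_ext[OF V(2,1) open_preim[OF U(1)] dense[OF U]])
    show "\<psi> True -` U \<subseteq> \<psi> True -` V" by (auto simp: U_def)
    fix q assume q: "q \<in> \<psi> True -` U"
    then have nz: "ev H' q \<noteq> 0" "snd q \<noteq> 0" by (auto simp: U_def inj_image_mem_iff[OF inj])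
    define r where "r = (fst q * snd q ^ k, 1 / snd q)"
    have qr: "\<psi> True q = \<psi> False r" using flip[OF nz(2), of True "fst q"] by (simp add: r_def)
    then have r: "\<psi> False r \<in> V" "ev H r \<noteq> 0" using q by (auto simp: U_def inj_image_mem_iff[OF inj])
    have "ev G r * ev H' q = ev G' q * ev H r" using eq[OF nz(2), of "fst q"] by (simp add: r_def)
    then have "ev G' q / ev H' q = ev G r / ev H r" using nz r by (simp add: frac_eq_eq)
    then show "Fract G' H' \<in> at_point q \<and> evf (Fract G' H') q = g (\<psi> True q)"
      using nz r V(5)[OF r(1)] qr by (simp add: at_pointI evf_Fract)
  qed
  then show ?thesis using \<Phi>_eqI[OF Vg] \<Phi>_eqI by metis
qed

definition ord_fibre :: "ratpoly \<Rightarrow> int" where "ord_fibre x = ord_along Y fibre (\<Phi> False x)"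

lemma ord_fibre_mult: "x \<noteq> 0 \<Longrightarrow> y \<noteq> 0 \<Longrightarrow> ord_fibre (x * y) = ord_fibre x + ord_fibre y"
  unfolding ord_fibre_def by (simp add: zero_K[of False] flip: mult_\<Phi>) (intro ord_mult prime_fibre; simp add: zero_K[of False])

lemma ord_fibre_1: "ord_fibre 1 = 0"
  using ord_const[OF prime_fibre, of 1 False] by (simp add: ord_fibre_def)

lemma ord_fibre_inverse: "x \<noteq> 0 \<Longrightarrow> ord_fibre (inverse x) = - ord_fibre x"
  using ord_fibre_mult[of x "inverse x"] ord_fibre_1 by simp

lemma ord_fibre_power: "x \<noteq> 0 \<Longrightarrow> ord_fibre (x ^ n) = int n * ord_fibre x"
  by (induction n) (auto simp: ord_fibre_mult ord_fibre_1 algebra_simps)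

lemma ord_fibre_powi: "x \<noteq> 0 \<Longrightarrow> ord_fibre (x powi n) = n * ord_fibre x"
  by (cases n rule: int_cases4) (auto simp: power_int_minus ord_fibre_inverse ord_fibre_power)

lemma ord_fibre_transition:
  assumes "G \<noteq> 0" "G' \<noteq> 0" and eq: "\<And>s w. w \<noteq> 0 \<Longrightarrow> ev G (s * w ^ k, 1 / w) * w ^ N = ev G' (s, w)"
  shows "ord_fibre (to_fract G) = int (multiplicity bY G') - int N"
proof -
  have "\<Phi> False (Fract G 1) = \<Phi> True (Fract G' (bY ^ N))"
    by (rule transition) (use eq in \<open>auto simp: bY_def\<close>, auto simp: ev_def bY_def poly_power)
  moreover have "bY ^ N \<noteq> 0" by (simp add: bY_def)
  moreover from this have "Fract G' (bY ^ N) \<noteq> 0" using assms(2) by (simp add: Fract_eq_0_iff)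
  ultimately have "ord_fibre (to_fract G) = val bY (Fract G' (bY ^ N))"
    using ord_along_curve[OF irreducible_bY, of "Fract G' (bY ^ N)" True] by (simp add: ord_fibre_def fibre_def to_fract_def)
  then show ?thesis using assms(2) \<open>bY ^ N \<noteq> 0\<close>
    by (simp add: val_Fract[OF irreducible_bY] multiplicity_prime_power irreducible_imp_prime_elem irreducible_bY)
qed

end

section \<open>The polyhedral divisors\<close>

text \<open>Here \<open>m = d - 1\<close>.\<close>

locale koras_russell_data = blowup_quotient +
  fixes \<alpha>\<^sub>2 \<alpha>\<^sub>3 :: nat and a b :: int
  assumes \<alpha>\<^sub>2: "2 \<le> \<alpha>\<^sub>2" and \<alpha>\<^sub>3: "2 \<le> \<alpha>\<^sub>3" and bezout: "a * int \<alpha>\<^sub>3 + b * int \<alpha>\<^sub>2 = 1"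
begin

definition "D\<^sub>3 = Q.curve False (theta 1)"
definition "D\<^sub>2 = Q.curve False bY"
definition "D\<^sub>E = Q.curve False bX"

definition "Dq = formal_sum
        [({of_int a / of_nat \<alpha>\<^sub>2}, D\<^sub>3),
         ({of_int b / of_nat \<alpha>\<^sub>3}, D\<^sub>2),
         ({0 .. 1 / (of_nat m * of_nat \<alpha>\<^sub>2 * of_nat \<alpha>\<^sub>3)}, D\<^sub>E)]"

lemma irreducibles: "irreducible bX" "irreducible bY" "irreducible (theta n)"
  by (rule Q.irreducible_bX Q.irreducible_bY irreducible_theta)+

lemma not_dvd: "\<not> bX dvd bY" "\<not> bY dvd bX" "n > 0 \<Longrightarrow> \<not> bX dvd theta n" "n > 0 \<Longrightarrow> \<not> bY dvd theta n" "\<not> theta n dvd bX" "n > 0 \<Longrightarrow> \<not> theta n dvd bY"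
proof -
  have *: "\<not> p dvd q" if "irreducible p" "ev p (x, y) = 0" "ev q (x, y) \<noteq> 0" for p q x y
  proof
    assume "p dvd q"
    then have "zeros p \<subseteq> zeros q" using zeros_subset_iff[OF that(1)] by blast
    then show False using that by (auto simp: zeros_def)
  qed
  show "\<not> bX dvd bY" by (rule *[OF irreducibles(1), of 0 1]) auto
  show "\<not> bY dvd bX" by (rule *[OF irreducibles(2), of 1 0]) auto
  show "n > 0 \<Longrightarrow> \<not> bX dvd theta n" by (rule *[OF irreducibles(1), of 0 0]) (auto simp: power_0_left)
  show "n > 0 \<Longrightarrow> \<not> bY dvd theta n" by (rule *[OF irreducibles(2), of 0 0]) (auto simp: power_0_left)
  show "\<not> theta n dvd bX" by (rule *[OF irreducibles(3), of _ 1 "-2"]) auto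
  show "n > 0 \<Longrightarrow> \<not> theta n dvd bY" by (rule *[OF irreducibles(3), of _ 0 "-1"]) (auto simp: power_0_left)
qed

lemma D_distinct: "D\<^sub>3 \<noteq> D\<^sub>2" "D\<^sub>3 \<noteq> D\<^sub>E" "D\<^sub>2 \<noteq> D\<^sub>E" "D\<^sub>2 \<noteq> D\<^sub>3" "D\<^sub>E \<noteq> D\<^sub>3" "D\<^sub>E \<noteq> D\<^sub>2"
  using not_dvd(1,2) not_dvd(3)[of 1] not_dvd(4)[of 1] not_dvd(5)[of 1] not_dvd(6)[of 1] Q.curve_eq_iff irreducibles unfolding D\<^sub>3_def D\<^sub>2_def D\<^sub>E_def by auto

lemma D_prime: "prime_divisor Y D\<^sub>3" "prime_divisor Y D\<^sub>2" "prime_divisor Y D\<^sub>E"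
  unfolding D\<^sub>3_def D\<^sub>2_def D\<^sub>E_def by (intro Q.prime_divisor_curve irreducibles)+

lemma Dq_values:
  "Dq D\<^sub>3 = {of_int a / of_nat \<alpha>\<^sub>2 .. of_int a / of_nat \<alpha>\<^sub>2}" "Dq D\<^sub>2 = {of_int b / of_nat \<alpha>\<^sub>3 .. of_int b / of_nat \<alpha>\<^sub>3}"
  "Dq D\<^sub>E = {0 .. 1 / (of_nat m * of_nat \<alpha>\<^sub>2 * of_nat \<alpha>\<^sub>3)}"
  "P \<noteq> D\<^sub>3 \<Longrightarrow> P \<noteq> D\<^sub>2 \<Longrightarrow> P \<noteq> D\<^sub>E \<Longrightarrow> Dq P = {0..0}"
  using D_distinct by (auto simp: Dq_def formal_sum_def)

lemma ab_nonzero: "a \<noteq> 0" "b \<noteq> 0"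
proof -
  show "a \<noteq> 0"
  proof
    assume "a = 0"
    then have "int \<alpha>\<^sub>2 dvd 1" using bezout by (metis add_0 dvd_triv_right mult_zero_left)
    then show False using \<alpha>\<^sub>2 by simp
  qed
  show "b \<noteq> 0"
  proof
    assume "b = 0"
    then have "int \<alpha>\<^sub>3 dvd 1" using bezout by (metis add.right_neutral dvd_triv_right mult_zero_left)
    then show False using \<alpha>\<^sub>3 by simp
  qed
qed

lemma Dq_support: "{P. Dq P \<noteq> 0} = {D\<^sub>3, D\<^sub>2, D\<^sub>E}"
proof -
  have "Dq D\<^sub>3 \<noteq> 0" "Dq D\<^sub>2 \<noteq> 0" unfolding Dq_values using ab_nonzero \<alpha>\<^sub>2 \<alpha>\<^sub>3 by simp_all
  moreover have "Dq D\<^sub>E \<noteq> 0"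
  proof
    assume "Dq D\<^sub>E = 0"
    moreover have "1 / (of_nat m * of_nat \<alpha>\<^sub>2 * of_nat \<alpha>\<^sub>3) \<in> Dq D\<^sub>E" unfolding Dq_values by auto
    ultimately have "1 / (of_nat m * of_nat \<alpha>\<^sub>2 * of_nat \<alpha>\<^sub>3 :: rat) = 0" by simp
    then show False using m \<alpha>\<^sub>2 \<alpha>\<^sub>3 by simp
  qed
  moreover have "Dq P = 0" if "P \<notin> {D\<^sub>3, D\<^sub>2, D\<^sub>E}" for P using that Dq_values(4)[of P] by auto
  ultimately show ?thesis by blast
qed

lemma Dq_interval: "\<exists>lo hi. lo \<le> hi \<and> Dq P = {lo..hi}"
proof (cases "P \<in> {D\<^sub>3, D\<^sub>2, D\<^sub>E}")
  case True
  have "(0::rat) \<le> 1 / (of_nat m * of_nat \<alpha>\<^sub>2 * of_nat \<alpha>\<^sub>3)" by simp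
  then have "\<exists>lo hi. lo \<le> hi \<and> Dq D\<^sub>E = {lo..hi}" unfolding Dq_values(3) by blast
  moreover have "\<exists>lo hi. lo \<le> hi \<and> Dq D\<^sub>3 = {lo..hi}" "\<exists>lo hi. lo \<le> hi \<and> Dq D\<^sub>2 = {lo..hi}"
    unfolding Dq_values(1,2) by (rule exI, rule exI, rule conjI, rule order_refl, rule refl)+
  ultimately show ?thesis using True by blast
next
  case False
  then show ?thesis using Dq_values(4)[of P] by (intro exI[of _ 0]) auto
qed

lemma Dq_polyhedral: "polyhedral_divisor Y Dq"
  unfolding polyhedral_divisor_def
proof (intro conjI allI impI)
  show "finite {P. Dq P \<noteq> 0}" unfolding Dq_support by simp
  fix P assume "Dq P \<noteq> 0"
  then have "P \<in> {D\<^sub>3, D\<^sub>2, D\<^sub>E}" unfolding Dq_support[symmetric] by simp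
  then show "prime_divisor Y P" using D_prime by (elim insertE emptyE) simp_all
next
  fix P show "\<exists>a b. a \<le> b \<and> Dq P = {a..b}" by (rule Dq_interval)
qed

lemma gens0: "bX \<noteq> 0" "bY \<noteq> 0" by (simp_all add: bX_def bY_def)

lemma multiplicities:
  assumes p: "irreducible p"
  shows "multiplicity p (pull_poly m (theta 1)) = (if Bl.curve False p = Bl.curve False (theta m) then 1 else 0)"
    "multiplicity p (pull_poly m bY) = (if Bl.curve False p = Bl.curve False bY then 1 else 0)"
    "multiplicity p (pull_poly m bX) = (if Bl.curve False p = Bl.curve False bX then m else 0)"
  using multiplicity_irreducible[OF p] prime_elem_multiplicity_power_distrib[OF irreducible_imp_prime_elem[OF p], of bX m]
    Bl.curve_eq_iff[OF p, of _ False] irreducibles gens0 unfolding pull_poly_simps by auto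

lemma fibre_not_curve: "irreducible z \<Longrightarrow> Bl.curve False z \<noteq> Bl.fibre"
  using Bl.fibre_preim Bl.preim_curve[of False z] zeros_nonempty[of z] by auto

text \<open>The quotient map is ramified at most along the exceptional divisor, where \<open>s\<close> pulls back to \<open>v\<^sup>m\<close>; this
  turns \<open>1 / (m \<alpha>\<^sub>2 \<alpha>\<^sub>3)\<close> into \<open>1 / (\<alpha>\<^sub>2 \<alpha>\<^sub>3)\<close>.\<close>

lemma pullback_Dq:
  "pullback_pdivisor Bl Y \<pi> Dq = formal_sum
      [({of_int a / of_nat \<alpha>\<^sub>2}, Bl.curve False (theta m)), ({of_int b / of_nat \<alpha>\<^sub>3}, Bl.curve False bY),
       ({0 .. 1 / (of_nat \<alpha>\<^sub>2 * of_nat \<alpha>\<^sub>3)}, Bl.curve False bX)]" (is "_ = ?D")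
proof
  fix P
  let ?E3 = "Bl.curve False (theta m)" and ?E2 = "Bl.curve False bY" and ?EE = "Bl.curve False bX"
  let ?I = "{0 .. 1 / (of_nat \<alpha>\<^sub>2 * of_nat \<alpha>\<^sub>3) :: rat}"
  have primes: "prime_divisor Bl ?E3" "prime_divisor Bl ?E2" "prime_divisor Bl ?EE"
    by (intro Bl.prime_divisor_curve irreducibles)+
  show "pullback_pdivisor Bl Y \<pi> Dq P = ?D P"
  proof (cases "prime_divisor Bl P")
    case False
    then have "P \<noteq> ?E3" "P \<noteq> ?E2" "P \<noteq> ?EE" using primes by blast+
    then show ?thesis using False by (auto simp: pullback_pdivisor_def formal_sum_def)
  next
    case True
    have mult: "pullback_mult Bl Y \<pi> D\<^sub>3 P = (if P = ?E3 then 1 else 0)"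
       "pullback_mult Bl Y \<pi> D\<^sub>2 P = (if P = ?E2 then 1 else 0)"
       "pullback_mult Bl Y \<pi> D\<^sub>E P = (if P = ?EE then int m else 0)"
      unfolding D\<^sub>3_def D\<^sub>2_def D\<^sub>E_def
    proof (atomize (full), use True in \<open>cases rule: Bl.prime_divisor_cases\<close>)
      case 1
      then show "pullback_mult Bl Y \<pi> (Q.curve False (theta 1)) P = (if P = ?E3 then 1 else 0) \<and>
        pullback_mult Bl Y \<pi> (Q.curve False bY) P = (if P = ?E2 then 1 else 0) \<and>
        pullback_mult Bl Y \<pi> (Q.curve False bX) P = (if P = ?EE then int m else 0)"
        unfolding 1 using fibre_not_curve[OF irreducibles(1)] fibre_not_curve[OF irreducibles(2)] fibre_not_curve[OF irreducibles(3)]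
        by (simp only: pullback_mult_fibre[OF irreducibles(1)] pullback_mult_fibre[OF irreducibles(2)]
            pullback_mult_fibre[OF irreducibles(3)] not_sym if_False simp_thms)
    next
      case (2 p)
      show "pullback_mult Bl Y \<pi> (Q.curve False (theta 1)) P = (if P = ?E3 then 1 else 0) \<and>
        pullback_mult Bl Y \<pi> (Q.curve False bY) P = (if P = ?E2 then 1 else 0) \<and>
        pullback_mult Bl Y \<pi> (Q.curve False bX) P = (if P = ?EE then int m else 0)"
        unfolding 2(2) pullback_mult_curve[OF irreducibles(1) 2(1)] pullback_mult_curve[OF irreducibles(2) 2(1)]
          pullback_mult_curve[OF irreducibles(3) 2(1)] multiplicities[OF 2(1)] by simp
    qed
    have zero: "(\<lambda>v. 0 * v) ` A = {0}" if "A \<noteq> {}" for A :: "rat set" using that by auto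
    have scale: "(\<lambda>v. of_int (int m) * v) ` {0 .. 1 / (of_nat m * of_nat \<alpha>\<^sub>2 * of_nat \<alpha>\<^sub>3)} = ?I"
      using m by (simp add: image_mult_atLeastAtMost)
    have neE: "{0 .. 1 / (of_nat m * of_nat \<alpha>\<^sub>2 * of_nat \<alpha>\<^sub>3) :: rat} \<noteq> {}" by simp
    have "pullback_pdivisor Bl Y \<pi> Dq P = (\<Sum>Z\<in>{D\<^sub>3, D\<^sub>2, D\<^sub>E}. (\<lambda>v. of_int (pullback_mult Bl Y \<pi> Z P) * v) ` Dq Z)"
      using True unfolding pullback_pdivisor_def Dq_support by simp
    also have "\<dots> = (\<lambda>v. of_int (pullback_mult Bl Y \<pi> D\<^sub>3 P) * v) ` Dq D\<^sub>3
       + ((\<lambda>v. of_int (pullback_mult Bl Y \<pi> D\<^sub>2 P) * v) ` Dq D\<^sub>2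
       + (\<lambda>v. of_int (pullback_mult Bl Y \<pi> D\<^sub>E P) * v) ` Dq D\<^sub>E)"
      using D_distinct by simp
    also have "(\<lambda>v. of_int (pullback_mult Bl Y \<pi> D\<^sub>3 P) * v) ` Dq D\<^sub>3 = (if ?E3 = P then {of_int a / of_nat \<alpha>\<^sub>2} else 0)"
      unfolding mult Dq_values by auto
    also have "(\<lambda>v. of_int (pullback_mult Bl Y \<pi> D\<^sub>2 P) * v) ` Dq D\<^sub>2 = (if ?E2 = P then {of_int b / of_nat \<alpha>\<^sub>3} else 0)"
      unfolding mult Dq_values by auto
    also have "(\<lambda>v. of_int (pullback_mult Bl Y \<pi> D\<^sub>E P) * v) ` Dq D\<^sub>E = (if ?EE = P then ?I else 0)"
      unfolding mult Dq_values using scale zero[OF neE] by auto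
    finally show ?thesis by (simp add: formal_sum_def)
  qed
qed

section \<open>Homogeneous sections\<close>

text \<open>The rounded coefficients of the evaluation at \<open>n\<close>; the minimum over \<open>[0, 1 / (m \<alpha>\<^sub>2 \<alpha>\<^sub>3)]\<close> is attained
  at the left end for \<open>n \<ge> 0\<close> and at the right end otherwise.\<close>

definition floor_E where "floor_E n = (if 0 \<le> n then 0 else n div (int m * int \<alpha>\<^sub>2 * int \<alpha>\<^sub>3))"
definition floor_2 where "floor_2 n = n * b div int \<alpha>\<^sub>3"
definition floor_3 where "floor_3 n = n * a div int \<alpha>\<^sub>2"

lemma floor_eval:
  "\<lfloor>eval_pdivisor Dq n D\<^sub>3\<rfloor> = floor_3 n" "\<lfloor>eval_pdivisor Dq n D\<^sub>2\<rfloor> = floor_2 n" "\<lfloor>eval_pdivisor Dq n D\<^sub>E\<rfloor> = floor_E n"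
  "P \<noteq> D\<^sub>3 \<Longrightarrow> P \<noteq> D\<^sub>2 \<Longrightarrow> P \<noteq> D\<^sub>E \<Longrightarrow> \<lfloor>eval_pdivisor Dq n P\<rfloor> = 0"
proof -
  have fl: "\<lfloor>of_int k / of_nat j :: rat\<rfloor> = k div int j" for k j
    using floor_divide_of_int_eq[of k "int j"] by simp
  have iv: "eval_pdivisor Dq n P = (if 0 \<le> n then of_int n * lo else of_int n * hi)" if "Dq P = {lo..hi}" "lo \<le> hi" for P lo hi
    using that interval_eval by (simp add: eval_pdivisor_def)
  show "\<lfloor>eval_pdivisor Dq n D\<^sub>3\<rfloor> = floor_3 n"
    using iv[OF Dq_values(1)] fl[of "n * a" \<alpha>\<^sub>2] by (simp add: floor_3_def)
  show "\<lfloor>eval_pdivisor Dq n D\<^sub>2\<rfloor> = floor_2 n"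
    using iv[OF Dq_values(2)] fl[of "n * b" \<alpha>\<^sub>3] by (simp add: floor_2_def)
  show "\<lfloor>eval_pdivisor Dq n D\<^sub>E\<rfloor> = floor_E n"
    using iv[OF Dq_values(3)] fl[of n "m * \<alpha>\<^sub>2 * \<alpha>\<^sub>3"] by (simp add: floor_E_def)
  show "\<lfloor>eval_pdivisor Dq n P\<rfloor> = 0" if "P \<noteq> D\<^sub>3" "P \<noteq> D\<^sub>2" "P \<noteq> D\<^sub>E"
    using iv[OF Dq_values(4)[OF that]] by simp
qed

definition Sec :: "int \<Rightarrow> ratpoly set" where "Sec n = {x. Q.\<Phi> False x \<in> sections Y (eval_pdivisor Dq n)}"

definition floor_at :: "int \<Rightarrow> bpoly \<Rightarrow> int" where
  "floor_at n p = (if p dvd bX then floor_E n else if p dvd bY then floor_2 n else if p dvd theta 1 then floor_3 n else 0)"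

lemma floor_eval_curve:
  assumes p: "irreducible p" shows "\<lfloor>eval_pdivisor Dq n (Q.curve False p)\<rfloor> = floor_at n p"
proof -
  have iff: "Q.curve False p = D\<^sub>3 \<longleftrightarrow> p dvd theta 1" "Q.curve False p = D\<^sub>2 \<longleftrightarrow> p dvd bY" "Q.curve False p = D\<^sub>E \<longleftrightarrow> p dvd bX"
    unfolding D\<^sub>3_def D\<^sub>2_def D\<^sub>E_def by (intro Q.curve_eq_iff p irreducibles)+
  consider "Q.curve False p = D\<^sub>E" | "Q.curve False p = D\<^sub>2" | "Q.curve False p = D\<^sub>3"
    | "Q.curve False p \<noteq> D\<^sub>3" "Q.curve False p \<noteq> D\<^sub>2" "Q.curve False p \<noteq> D\<^sub>E" by blast
  then show ?thesis
  proof cases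
    case 1 then show ?thesis unfolding floor_at_def iff[symmetric] by (simp add: floor_eval)
  next
    case 2 then show ?thesis unfolding floor_at_def iff[symmetric] using D_distinct by (simp add: floor_eval)
  next
    case 3 then show ?thesis unfolding floor_at_def iff[symmetric] using D_distinct by (simp add: floor_eval)
  next
    case 4 then show ?thesis unfolding floor_at_def iff[symmetric] by (simp add: floor_eval(4))
  qed
qed

lemma floor_eval_fibre: "\<lfloor>eval_pdivisor Dq n Q.fibre\<rfloor> = 0"
proof (rule floor_eval(4))
  show "Q.fibre \<noteq> D\<^sub>3" unfolding D\<^sub>3_def by (rule fibre_not_curve_False[OF irreducibles(3)])
  show "Q.fibre \<noteq> D\<^sub>2" unfolding D\<^sub>2_def by (rule fibre_not_curve_False[OF irreducibles(2)])
  show "Q.fibre \<noteq> D\<^sub>E" unfolding D\<^sub>E_def by (rule fibre_not_curve_False[OF irreducibles(1)])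
qed

lemma Sec_iff:
  "x \<in> Sec n \<longleftrightarrow> x = 0 \<or> ((\<forall>p. irreducible p \<longrightarrow> 0 \<le> val p x + floor_at n p) \<and> 0 \<le> Q.ord_fibre x)"
proof (cases "x = 0")
  case True
  have "Q.\<Phi> False 0 \<in> sections Y (eval_pdivisor Dq n)" unfolding Q.zero_K[symmetric] by (rule Q.sections_zero)
  then show ?thesis using True by (simp add: Sec_def)
next
  case False
  have "x \<in> Sec n \<longleftrightarrow> (\<forall>P. prime_divisor Y P \<longrightarrow> 0 \<le> ord_along Y P (Q.\<Phi> False x) + \<lfloor>eval_pdivisor Dq n P\<rfloor>)"
    using False by (simp add: Sec_def sections_def Q.zero_K[of False])
  also have "\<dots> \<longleftrightarrow> (\<forall>p. irreducible p \<longrightarrow> 0 \<le> val p x + floor_at n p) \<and> 0 \<le> Q.ord_fibre x"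
  proof (intro iffI conjI allI impI)
    assume *: "\<forall>P. prime_divisor Y P \<longrightarrow> 0 \<le> ord_along Y P (Q.\<Phi> False x) + \<lfloor>eval_pdivisor Dq n P\<rfloor>"
    show "0 \<le> val p x + floor_at n p" if "irreducible p" for p
      using *[rule_format, OF Q.prime_divisor_curve[OF that, of False]] False that by (simp add: Q.ord_along_curve floor_eval_curve)
    show "0 \<le> Q.ord_fibre x"
      using *[rule_format, OF Q.prime_fibre] floor_eval_fibre by (simp add: Q.ord_fibre_def)
  next
    fix P assume *: "(\<forall>p. irreducible p \<longrightarrow> 0 \<le> val p x + floor_at n p) \<and> 0 \<le> Q.ord_fibre x" and P: "prime_divisor Y P"
    show "0 \<le> ord_along Y P (Q.\<Phi> False x) + \<lfloor>eval_pdivisor Dq n P\<rfloor>"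
      using P
    proof (cases rule: Q.prime_divisor_cases)
      case 1 then show ?thesis using * floor_eval_fibre by (simp add: Q.ord_fibre_def)
    next
      case (2 p) then show ?thesis using * False by (simp add: Q.ord_along_curve floor_eval_curve)
    qed
  qed
  finally show ?thesis using False by simp
qed

abbreviation "xX \<equiv> to_fract bX"
abbreviation "xY \<equiv> to_fract bY"
abbreviation "xT \<equiv> to_fract (theta 1)"

definition lmon :: "int \<Rightarrow> int \<Rightarrow> int \<Rightarrow> ratpoly" where "lmon i j k = xX powi i * xY powi j * xT powi k"

lemma gens_nonzero: "xX \<noteq> 0" "xY \<noteq> 0" "xT \<noteq> 0"
  using gens0 irreducible_theta[of 1] by auto

lemma lmon_nonzero: "lmon i j k \<noteq> 0" using gens_nonzero by (simp add: lmon_def)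

lemma val_lmon:
  assumes p: "irreducible p"
  shows "val p (lmon i j k) = (if p dvd bX then i else if p dvd bY then j else if p dvd theta 1 then k else 0)"
proof -
  have v: "val p (to_fract q) = (if p dvd q then 1 else 0)" if "irreducible q" for q
  proof -
    have "q \<noteq> 0" using that by auto
    then show ?thesis using multiplicity_irreducible[OF p that] by (simp add: val_poly[OF p])
  qed
  have tr: "q dvd q'" if "irreducible q" "p dvd q" "p dvd q'" for q q'
    using irreducibleD'[OF that(1,2)] p dvd_trans[OF _ that(3)] by (auto simp: irreducible_def)
  have "\<not> (p dvd bX \<and> p dvd bY)" using tr[OF irreducibles(1)] not_dvd(1) by blast
  moreover have "\<not> (p dvd bX \<and> p dvd theta 1)" using tr[OF irreducibles(1)] not_dvd(3)[of 1] by auto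
  moreover have "\<not> (p dvd bY \<and> p dvd theta 1)" using tr[OF irreducibles(2)] not_dvd(4)[of 1] by auto
  ultimately show ?thesis
    using gens_nonzero irreducibles by (auto simp: lmon_def val_mult[OF p] val_powi[OF p] v)
qed

lemma ord_fibre_lmon: "Q.ord_fibre (lmon i j k) = int m * i - j - k"
proof -
  have "Q.ord_fibre xX = int (multiplicity bY (bX * bY ^ m)) - int 0"
    by (rule Q.ord_fibre_transition) (auto simp: bX_def bY_def, auto simp: ev_def bX_def bY_def poly_power)
  also have "multiplicity bY (bX * bY ^ m) = m"
    using gens0 prime_elem_multiplicity_mult_distrib[OF irreducible_imp_prime_elem[OF irreducibles(2)], of bX "bY ^ m"]
      multiplicity_prime_power[OF irreducible_imp_prime_elem[OF irreducibles(2)]] not_dvd_imp_multiplicity_0[OF not_dvd(2)]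
    by simp
  finally have X: "Q.ord_fibre xX = int m" by simp
  have "Q.ord_fibre xY = int (multiplicity bY 1) - int 1"
    by (rule Q.ord_fibre_transition) (auto simp: bY_def, auto simp: ev_def)
  then have Y: "Q.ord_fibre xY = -1" by simp
  let ?t = "1 + bY + bX * bY ^ (Suc m)"
  have nd: "\<not> bY dvd ?t"
  proof
    assume "bY dvd ?t"
    then have "zeros bY \<subseteq> zeros ?t" using zeros_subset_iff irreducibles by blast
    moreover have "(0, 0) \<in> zeros bY" by (simp add: zeros_def)
    ultimately have "(0, 0) \<in> zeros ?t" by blast
    then show False by (simp add: zeros_def)
  qed
  then have t0: "?t \<noteq> 0" by auto
  have "Q.ord_fibre xT = int (multiplicity bY ?t) - int 1"
    by (rule Q.ord_fibre_transition) (use t0 gens_nonzero(3) in \<open>auto simp: field_simps\<close>)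
  then have T: "Q.ord_fibre xT = -1" using nd by (simp add: not_dvd_imp_multiplicity_0)
  show ?thesis using gens_nonzero by (simp add: lmon_def Q.ord_fibre_mult Q.ord_fibre_powi X Y T del: One_nat_def)
qed

text \<open>The first three conditions are those at the exceptional divisor and at the two strict transforms,
  the last is the one at the fibre.\<close>

lemma lmon_in_Sec:
  assumes "0 \<le> i + floor_E n" "0 \<le> j + floor_2 n" "0 \<le> k + floor_3 n" "j + k \<le> int m * i"
  shows "lmon i j k \<in> Sec n"
  unfolding Sec_iff using assms by (simp add: ord_fibre_lmon val_lmon floor_at_def)

lemma const_in_Sec: "to_fract (bC c) \<in> Sec 0"
proof -
  have "0 \<le> \<lfloor>eval_pdivisor Dq 0 P\<rfloor>" for P
    using floor_eval(1-3)[of 0] floor_eval(4)[where P = P and n = 0]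
    by (cases "P \<in> {D\<^sub>3, D\<^sub>2, D\<^sub>E}") (auto simp: floor_E_def floor_2_def floor_3_def simp del: zero_le_floor)
  then show ?thesis using Q.sections_const by (simp add: Sec_def)
qed

lemma Sec_mult: "x \<in> Sec n \<Longrightarrow> y \<in> Sec k \<Longrightarrow> x * y \<in> Sec (n + k)"
  using Q.sections_mult[OF floor_eval_superadditive[OF Dq_polyhedral]] by (simp add: Sec_def flip: Q.mult_\<Phi>)

lemma Sec_add: "x \<in> Sec n \<Longrightarrow> y \<in> Sec n \<Longrightarrow> x + y \<in> Sec n"
  using Q.sections_add by (simp add: Sec_def flip: Q.add_\<Phi>)

lemma Sec_zero: "0 \<in> Sec n" by (simp add: Sec_iff)

lemma Sec_sum: "(\<And>i. i \<in> A \<Longrightarrow> f i \<in> Sec n) \<Longrightarrow> sum f A \<in> Sec n"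
  by (induction A rule: infinite_finite_induct) (auto simp: Sec_zero Sec_add)

text \<open>Multiplying with the local equations leaves a function without poles in the chart, that is, a
  polynomial \<open>g\<close>. In the other chart \<open>s\<^sup>i w\<^sup>j\<close> has order \<open>m i - j\<close> along the fibre, and distinct monomials
  of the same order differ in the exponent of \<open>s\<close>, so that they cannot cancel: the order of \<open>g\<close> is the
  least order of its monomials.\<close>

lemma Sec_decompose:
  assumes x: "x \<in> Sec n"
  obtains g where "x = to_fract g * lmon (- floor_E n) (- floor_2 n) (- floor_3 n)"
    "\<And>i j. coeff (coeff g j) i \<noteq> 0 \<Longrightarrow> int j \<le> int m * (int i - floor_E n) + floor_2 n + floor_3 n"
proof (cases "x = 0")
  case True then show thesis using that[of 0] by simp
next
  case False
  define y where "y = x * lmon (floor_E n) (floor_2 n) (floor_3 n)"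
  have "lmon (floor_E n) (floor_2 n) (floor_3 n) * lmon (- floor_E n) (- floor_2 n) (- floor_3 n) = 1"
    using gens_nonzero by (simp add: lmon_def power_int_minus field_simps)
  then have xy: "x = y * lmon (- floor_E n) (- floor_2 n) (- floor_3 n)" by (simp add: y_def mult.assoc)
  have y0: "y \<noteq> 0" using False lmon_nonzero by (simp add: y_def)
  have "0 \<le> val p y" if p: "irreducible p" for p
    using x False lmon_nonzero p unfolding Sec_iff y_def by (auto simp: val_mult val_lmon floor_at_def)
  then obtain g where g: "y = to_fract g" by (rule val_nonneg_imp_poly)
  have g0: "g \<noteq> 0" using y0 g by auto
  have ordg: "int m * floor_E n - floor_2 n - floor_3 n \<le> Q.ord_fibre (to_fract g)"
    using x False lmon_nonzero unfolding Sec_iff g[symmetric] y_def by (simp add: Q.ord_fibre_mult ord_fibre_lmon)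
  define M where "M = degree g"
  define I where "I = Max ((\<lambda>j. degree (coeff g j)) ` {..M})"
  \<comment> \<open>the numerator of \<open>g\<close> in the other chart, after multiplication with a power of the fibre coordinate\<close>
  define h where "h = (\<Sum>j\<le>M. \<Sum>i\<le>I. monom (monom (coeff (coeff g j) i) i) (m * i + M - j))"
  have gsum: "ev g (x, y) = (\<Sum>j\<le>M. \<Sum>i\<le>I. coeff (coeff g j) i * x ^ i * y ^ j)" for x y
  proof -
    have "ev g (x, y) = (\<Sum>j\<le>M. poly (coeff g j) x * y ^ j)"
      by (simp add: ev_def M_def poly_altdef[of g] poly_sum poly_power)
    also have "\<dots> = (\<Sum>j\<le>M. (\<Sum>i\<le>I. coeff (coeff g j) i * x ^ i) * y ^ j)"
    proof (rule sum.cong[OF refl], rule arg_cong2[where f = "(*)"])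
      fix j assume "j \<in> {..M}"
      then have "degree (coeff g j) \<le> I" unfolding I_def by (intro Max_ge) auto
      then show "poly (coeff g j) x = (\<Sum>i\<le>I. coeff (coeff g j) i * x ^ i)"
        unfolding poly_altdef by (intro sum.mono_neutral_left) (auto simp: coeff_eq_0)
    qed simp
    finally show ?thesis by (simp add: sum_distrib_right)
  qed
  have evh: "ev g (s * w ^ m, 1 / w) * w ^ M = ev h (s, w)" if w: "w \<noteq> 0" for s w
  proof -
    have st: "c * (s * w ^ m) ^ i * (1 / w) ^ j * w ^ M = c * s ^ i * w ^ (m * i + M - j)" if "j \<le> M" for c i j
    proof -
      have "m * i + M - j = m * i + (M - j)" using that by simp
      moreover have "(1 / w) ^ j * w ^ M = w ^ (M - j)" using that w by (simp add: power_divide power_diff)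
      ultimately show ?thesis by (simp add: power_mult_distrib power_add power_mult mult.assoc)
    qed
    then show ?thesis
      unfolding gsum h_def ev_sum ev_monom sum_distrib_right by (intro sum.cong refl st) simp
  qed
  have coeffh: "coeff (coeff h (m * i + M - j)) i = coeff (coeff g j) i" if ij: "j \<le> M" "i \<le> I" for i j
  proof -
    have "coeff (coeff h (m * i + M - j)) i = (\<Sum>j'\<le>M. \<Sum>i'\<le>I. if m * i' + M - j' = m * i + M - j \<and> i' = i then coeff (coeff g j') i' else 0)"
      unfolding h_def by (auto simp: coeff_sum intro!: sum.cong)
    also have "\<dots> = (\<Sum>j'\<le>M. \<Sum>i'\<le>I. if j' = j \<and> i' = i then coeff (coeff g j') i' else 0)"
      using ij by (intro sum.cong refl) (auto split: if_splits)
    also have "\<dots> = (\<Sum>j'\<le>M. if j' = j then coeff (coeff g j') i else 0)"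
      using ij by (intro sum.cong refl) (auto simp: sum.delta')
    also have "\<dots> = coeff (coeff g j) i" using ij by simp
    finally show ?thesis .
  qed
  have range: "j \<le> M \<and> i \<le> I" if "coeff (coeff g j) i \<noteq> 0" for i j
  proof
    have "coeff g j \<noteq> 0" using that by auto
    then show j: "j \<le> M" unfolding M_def by (rule le_degree)
    have "i \<le> degree (coeff g j)" using that by (rule le_degree)
    also have "\<dots> \<le> I" unfolding I_def using j by (intro Max_ge) auto
    finally show "i \<le> I" .
  qed
  obtain i0 j0 where "coeff (coeff g j0) i0 \<noteq> 0" using g0 by (metis leading_coeff_neq_0)
  then have "h \<noteq> 0" using coeffh range by (metis coeff_0)
  then have ord: "Q.ord_fibre (to_fract g) = int (multiplicity bY h) - int M"
    using g0 evh by (intro Q.ord_fibre_transition)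
  have low: "coeff h k = 0" if "k < multiplicity bY h" for k
  proof -
    have "bY ^ multiplicity bY h dvd h" by (rule multiplicity_dvd)
    moreover have "bY ^ n = monom 1 n" for n by (simp add: bY_def monom_altdef)
    ultimately show ?thesis using that by (simp add: monom_1_dvd_iff')
  qed
  show thesis
  proof (rule that)
    show "x = to_fract g * lmon (- floor_E n) (- floor_2 n) (- floor_3 n)" using xy g by simp
    fix i j assume nz: "coeff (coeff g j) i \<noteq> 0"
    then have ij: "j \<le> M" "i \<le> I" using range by auto
    then have "\<not> m * i + M - j < multiplicity bY h" using low coeffh[OF ij] nz by auto
    then have "int (multiplicity bY h) \<le> int m * int i + int M - int j" using ij by (simp flip: of_nat_mult of_nat_add)
    then show "int j \<le> int m * (int i - floor_E n) + floor_2 n + floor_3 n"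
      using ordg ord by (simp add: right_diff_distrib)
  qed
qed

end

section \<open>Isomorphisms of affine varieties\<close>

lemma regular_affine:
  "regular (affine V C) U f \<longleftrightarrow> openin (zariski V C) U \<and>
     (\<forall>p\<in>U. \<exists>W g h. openin (zariski V C) W \<and> p \<in> W \<and> W \<subseteq> U \<and>
        g \<in> polynomials C \<and> h \<in> polynomials C \<and> (\<forall>q\<in>W. h q \<noteq> 0 \<and> f q = g q / h q))"
  by (simp add: affine_def)

text \<open>A bijection of affine sets that matches the polynomial functions is an isomorphism, since the
  topology and the regular functions are defined from these functions alone.\<close>

lemma affine_isomorphism:
  assumes bij: "bij_betw \<Theta> V V'"
    and fwd: "\<And>g. g \<in> polynomials C' \<Longrightarrow> \<exists>f\<in>polynomials C. \<forall>p\<in>V. f p = g (\<Theta> p)"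
    and bwd: "\<And>f. f \<in> polynomials C \<Longrightarrow> \<exists>g\<in>polynomials C'. \<forall>p\<in>V. f p = g (\<Theta> p)"
  shows "isomorphism (affine V C) (affine V' C') \<Theta>"
proof -
  have im: "\<Theta> ` V = V'" and inj: "inj_on \<Theta> V" using bij by (auto simp: bij_betw_def)
  have pre: "openin (zariski V C) {p\<in>V. \<Theta> p \<in> U}" if U: "openin (zariski V' C') U" for U
    unfolding openin_zariski
  proof (intro conjI ballI)
    fix p assume p: "p \<in> {p\<in>V. \<Theta> p \<in> U}"
    then obtain g where g: "g \<in> polynomials C'" "g (\<Theta> p) \<noteq> 0" "{q\<in>V'. g q \<noteq> 0} \<subseteq> U"
      using U unfolding openin_zariski by blast
    obtain f where f: "f \<in> polynomials C" "\<forall>p\<in>V. f p = g (\<Theta> p)" using fwd[OF g(1)] by blast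
    show "\<exists>f\<in>polynomials C. f p \<noteq> 0 \<and> {q\<in>V. f q \<noteq> 0} \<subseteq> {p\<in>V. \<Theta> p \<in> U}"
      by (rule bexI[OF _ f(1)]) (use p g f im in auto)
  qed auto
  have img: "openin (zariski V' C') (\<Theta> ` W)" if W: "openin (zariski V C) W" for W
    unfolding openin_zariski
  proof (intro conjI ballI)
    have WV: "W \<subseteq> V" using W unfolding openin_zariski by blast
    then show "\<Theta> ` W \<subseteq> V'" using im by blast
    fix x assume "x \<in> \<Theta> ` W"
    then obtain p where p: "p \<in> W" "x = \<Theta> p" by blast
    then obtain f where f: "f \<in> polynomials C" "f p \<noteq> 0" "{q\<in>V. f q \<noteq> 0} \<subseteq> W"
      using W unfolding openin_zariski by blast
    obtain g where g: "g \<in> polynomials C'" "\<forall>p\<in>V. f p = g (\<Theta> p)" using bwd[OF f(1)] by blast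
    show "\<exists>g\<in>polynomials C'. g x \<noteq> 0 \<and> {q\<in>V'. g q \<noteq> 0} \<subseteq> \<Theta> ` W"
    proof (rule bexI[OF _ g(1)], intro conjI subsetI)
      show "g x \<noteq> 0" using p f(2) g(2) WV by auto
      fix y assume "y \<in> {q\<in>V'. g q \<noteq> 0}"
      then obtain q where "q \<in> V" "y = \<Theta> q" "f q \<noteq> 0" using im g(2) by auto
      then show "y \<in> \<Theta> ` W" using f(3) by blast
    qed
  qed
  have tops: "ztop (affine V C) = zariski V C" "ztop (affine V' C') = zariski V' C'" by (simp_all add: affine_def)
  have homeo: "homeomorphic_map (zariski V C) (zariski V' C') \<Theta>"
  proof (rule bijective_open_imp_homeomorphic_map)
    show "continuous_map (zariski V C) (zariski V' C') \<Theta>"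
      unfolding continuous_map_def using pre im by (auto simp: Pi_iff)
    show "open_map (zariski V C) (zariski V' C') \<Theta>" unfolding open_map_def using img by blast
  qed (use im inj in auto)
  have "regular (affine V' C') U f \<longleftrightarrow> regular (affine V C) (preim (affine V C) \<Theta> U) (f \<circ> \<Theta>)"
    if U: "openin (zariski V' C') U" for U f
  proof -
    have pU: "preim (affine V C) \<Theta> U = {p\<in>V. \<Theta> p \<in> U}" by (simp add: preim_def tops)
    have UV: "U \<subseteq> V'" using U unfolding openin_zariski by blast
    show ?thesis
    proof
      assume reg: "regular (affine V' C') U f"
      show "regular (affine V C) (preim (affine V C) \<Theta> U) (f \<circ> \<Theta>)"
        unfolding pU regular_affine
      proof (intro conjI pre[OF U] ballI)
        fix p assume p: "p \<in> {p\<in>V. \<Theta> p \<in> U}"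
        then obtain W g h where W: "openin (zariski V' C') W" "\<Theta> p \<in> W" "W \<subseteq> U" "g \<in> polynomials C'" "h \<in> polynomials C'"
          "\<forall>q\<in>W. h q \<noteq> 0 \<and> f q = g q / h q" using reg[unfolded regular_affine, THEN conjunct2, THEN bspec, of "\<Theta> p"] by blast
        obtain g' where g': "g' \<in> polynomials C" "\<forall>p\<in>V. g' p = g (\<Theta> p)" using fwd[OF W(4)] by blast
        obtain h' where h': "h' \<in> polynomials C" "\<forall>p\<in>V. h' p = h (\<Theta> p)" using fwd[OF W(5)] by blast
        have q: "h' r \<noteq> 0 \<and> (f \<circ> \<Theta>) r = g' r / h' r" if "r \<in> {p\<in>V. \<Theta> p \<in> W}" for r
          using that W(6)[THEN bspec, of "\<Theta> r"] g'(2)[THEN bspec, of r] h'(2)[THEN bspec, of r] by simp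
        have pW: "p \<in> {p\<in>V. \<Theta> p \<in> W}" using p W(2) by simp
        have sub: "{p\<in>V. \<Theta> p \<in> W} \<subseteq> {p\<in>V. \<Theta> p \<in> U}" using W(3) by blast
        show "\<exists>W g h. openin (zariski V C) W \<and> p \<in> W \<and> W \<subseteq> {p\<in>V. \<Theta> p \<in> U} \<and> g \<in> polynomials C \<and> h \<in> polynomials C \<and>
           (\<forall>q\<in>W. h q \<noteq> 0 \<and> (f \<circ> \<Theta>) q = g q / h q)"
          by (rule exI[of _ "{p\<in>V. \<Theta> p \<in> W}"], rule exI[of _ g'], rule exI[of _ h'],
              intro conjI ballI pre[OF W(1)] pW sub g'(1) h'(1) q[THEN conjunct1] q[THEN conjunct2])
      qed
    next
      assume reg: "regular (affine V C) (preim (affine V C) \<Theta> U) (f \<circ> \<Theta>)"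
      show "regular (affine V' C') U f"
        unfolding regular_affine
      proof (intro conjI U ballI)
        fix x assume x: "x \<in> U"
        then obtain p where p: "p \<in> V" "x = \<Theta> p" using UV im by blast
        then have pU': "p \<in> {p\<in>V. \<Theta> p \<in> U}" using x by simp
        obtain W g h where W: "openin (zariski V C) W" "p \<in> W" "W \<subseteq> {p\<in>V. \<Theta> p \<in> U}" "g \<in> polynomials C" "h \<in> polynomials C"
          "\<forall>q\<in>W. h q \<noteq> 0 \<and> (f \<circ> \<Theta>) q = g q / h q" using reg[unfolded pU regular_affine, THEN conjunct2, THEN bspec, OF pU']
          by (elim exE conjE) (rule that)
        obtain g' where g': "g' \<in> polynomials C'" "\<forall>p\<in>V. g p = g' (\<Theta> p)" using bwd[OF W(4)] by blast
        obtain h' where h': "h' \<in> polynomials C'" "\<forall>p\<in>V. h p = h' (\<Theta> p)" using bwd[OF W(5)] by blast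
        have q: "h' (\<Theta> q) \<noteq> 0 \<and> f (\<Theta> q) = g' (\<Theta> q) / h' (\<Theta> q)" if "q \<in> W" for q
        proof -
          have "q \<in> V" using that W(3) by blast
          then show ?thesis
            using that W(6)[THEN bspec, of q] g'(2)[THEN bspec, of q] h'(2)[THEN bspec, of q] by simp
        qed
        have xW: "x \<in> \<Theta> ` W" using p W(2) by blast
        have sub: "\<Theta> ` W \<subseteq> U" using W(3) by blast
        show "\<exists>W g h. openin (zariski V' C') W \<and> x \<in> W \<and> W \<subseteq> U \<and> g \<in> polynomials C' \<and> h \<in> polynomials C' \<and>
           (\<forall>q\<in>W. h q \<noteq> 0 \<and> f q = g q / h q)"
        proof (rule exI[of _ "\<Theta> ` W"], rule exI[of _ g'], rule exI[of _ h'], intro conjI img[OF W(1)] xW sub g'(1) h'(1))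
          show "\<forall>q\<in>\<Theta> ` W. h' q \<noteq> 0 \<and> f q = g' q / h' q" using q by simp
        qed
      qed
    qed
  qed
  then show ?thesis using homeo by (simp add: isomorphism_def tops)
qed

section \<open>A dense open subset of the threefold\<close>

text \<open>The product of the distances from \<open>z0\<close> to the \<open>n\<close> roots of \<open>c\<close> is the distance from \<open>z0\<^sup>n\<close> to \<open>c\<close>, so one
  of the roots is close.\<close>

lemma nearby_root:
  fixes c z0 :: complex
  assumes n: "n > 0" and \<delta>: "\<delta> > 0" and c: "dist c (z0 ^ n) < \<delta> ^ n"
  obtains z where "z ^ n = c" "dist z z0 < \<delta>"
proof -
  define p where "p = monom 1 n - [:c:]"
  obtain k where "n = Suc k" using n gr0_implies_Suc by blast
  then have cn: "coeff p n = 1" by (simp add: p_def)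
  have "degree p \<le> n" by (rule degree_le) (auto simp: p_def coeff_pCons split: nat.splits)
  moreover have "n \<le> degree p" by (rule le_degree) (simp add: cn)
  ultimately have deg: "degree p = n" by simp
  have "p \<noteq> 0" using cn by auto
  then obtain A where A: "size A = n" "p = smult (lead_coeff p) (\<Prod>x\<in>#A. [:-x, 1:])"
    using alg_closed_imp_factorization[of p] deg by auto
  then have pf: "p = (\<Prod>x\<in>#A. [:-x, 1:])" using cn deg by simp
  have val: "poly p z = z ^ n - c" for z by (simp add: p_def poly_monom)
  have prod: "poly (\<Prod>x\<in>#A. [:-x, 1:]) z = (\<Prod>x\<in>#A. z - x)" for A :: "complex multiset" and z
    by (induction A) (auto simp: algebra_simps)
  have "\<exists>z\<in>#A. dist z z0 < \<delta>"
  proof (rule ccontr)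
    assume far: "\<not> ?thesis"
    have "(\<forall>z\<in>#A. \<not> dist z z0 < \<delta>) \<Longrightarrow> \<delta> ^ size A \<le> norm (\<Prod>x\<in>#A. z0 - x)" for A
    proof (induction A)
      case (add x A)
      then have "\<delta> * \<delta> ^ size A \<le> norm (z0 - x) * norm (\<Prod>x\<in>#A. z0 - x)"
        using \<delta> by (intro mult_mono) (auto simp: dist_norm norm_minus_commute)
      then show ?case by (simp add: norm_mult)
    qed simp
    then have "\<delta> ^ n \<le> norm (poly p z0)" using far A(1) pf prod by auto
    then show False using c by (simp add: val dist_norm norm_minus_commute)
  qed
  then obtain z where z: "z \<in># A" "dist z z0 < \<delta>" by blast
  then have "(\<Prod>x\<in>#A. z - x) = 0" by (auto simp: prod_mset_zero_iff)
  then have "poly p z = 0" unfolding pf prod .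
  then have "z ^ n = c" by (simp add: val)
  then show thesis using that z by blast
qed

lemma open_minus_finite: fixes A :: "complex set" assumes "open A" "x \<in> A" "finite F" obtains y where "y \<in> A" "y \<notin> F"
proof -
  have "x islimpt A" using assms(1,2) by (intro interior_limit_point) (simp add: interior_open)
  then have "\<not> A \<subseteq> F" using assms(3) finite_subset islimpt_finite by blast
  then show thesis using that by blast
qed

lemma open_prodE:
  fixes Sec :: "('a::topological_space \<times> 'b::topological_space) set"
  assumes "open Sec" "(x, y) \<in> Sec" obtains A B where "open A" "open B" "x \<in> A" "y \<in> B" "A \<times> B \<subseteq> Sec"
proof -
  have "\<exists>A B. open A \<and> open B \<and> (x, y) \<in> A \<times> B \<and> A \<times> B \<subseteq> Sec" using assms unfolding open_prod_def by blast
  then show thesis using that by blast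
qed

definition threefold :: "nat \<Rightarrow> nat \<Rightarrow> nat \<Rightarrow> C4 set" where
  "threefold d \<alpha>\<^sub>2 \<alpha>\<^sub>3 = {(x, y, z, t). x + x ^ d * y + z ^ \<alpha>\<^sub>2 + t ^ \<alpha>\<^sub>3 = 0}"

definition coordsC4 :: "(C4 \<Rightarrow> complex) set" where
  "coordsC4 = {\<lambda>(x, y, z, t). x, \<lambda>(x, y, z, t). y, \<lambda>(x, y, z, t). z, \<lambda>(x, y, z, t). t}"

definition torus_part :: "nat \<Rightarrow> nat \<Rightarrow> nat \<Rightarrow> C4 set" where
  "torus_part d \<alpha>\<^sub>2 \<alpha>\<^sub>3 = {(x, y, z, t). (x, y, z, t) \<in> threefold d \<alpha>\<^sub>2 \<alpha>\<^sub>3 \<and> x \<noteq> 0 \<and> y \<noteq> 0 \<and> z \<noteq> 0 \<and> t \<noteq> 0}"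

lemma koras_russell_eq: "koras_russell d \<alpha>\<^sub>2 \<alpha>\<^sub>3 = affine (threefold d \<alpha>\<^sub>2 \<alpha>\<^sub>3) coordsC4"
  by (simp add: koras_russell_def threefold_def coordsC4_def)

lemma coordsC4_polynomials:
  "(\<lambda>(x, y, z, t). x) \<in> polynomials coordsC4" "(\<lambda>(x, y, z, t). y) \<in> polynomials coordsC4"
  "(\<lambda>(x, y, z, t). z) \<in> polynomials coordsC4" "(\<lambda>(x, y, z, t). t) \<in> polynomials coordsC4"
  by (intro polynomials.coord; simp add: coordsC4_def)+

lemma continuous_polynomial: "f \<in> polynomials coordsC4 \<Longrightarrow> continuous_on UNIV f"
proof (induction rule: polynomials.induct)
  case (coord f) then show ?case by (auto simp: coordsC4_def case_prod_unfold intro!: continuous_intros)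
qed (auto intro!: continuous_intros)

lemma sum4_eq_0D:
  fixes u :: complex assumes "u + v + w + r = 0" shows "w = - (u + v + r)"
proof -
  have "w + (u + v + r) = 0" using assms by (simp add: ac_simps)
  then show ?thesis by (simp only: eq_neg_iff_add_eq_0)
qed

text \<open>Polynomials are continuous, so it is enough to approximate a point of the threefold in the
  Euclidean topology: the coordinates \<open>x\<close>, \<open>y\<close>, \<open>t\<close> can be perturbed freely, and \<open>z\<close> follows by continuity
  of roots.\<close>

lemma torus_part_dense:
  assumes \<alpha>\<^sub>2: "\<alpha>\<^sub>2 > 0" and f: "f \<in> polynomials coordsC4" and van: "\<And>p. p \<in> torus_part d \<alpha>\<^sub>2 \<alpha>\<^sub>3 \<Longrightarrow> f p = 0" and p: "p \<in> threefold d \<alpha>\<^sub>2 \<alpha>\<^sub>3"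
  shows "f p = 0"
proof (rule ccontr)
  assume nz: "f p \<noteq> 0"
  obtain x0 y0 z0 t0 where p0: "p = (x0, y0, z0, t0)" by (cases p)
  have "open {p. f p \<noteq> 0}"
    using continuous_polynomial[OF f] by (intro open_Collect_neq continuous_intros) auto
  then obtain A B where A: "open A" "open B" "x0 \<in> A" "(y0, z0, t0) \<in> B" "A \<times> B \<subseteq> {p. f p \<noteq> 0}"
    by (rule open_prodE[of _ x0 "(y0, z0, t0)"]) (use nz in \<open>auto simp: p0\<close>)
  obtain B1 B2 where B: "open B1" "open B2" "y0 \<in> B1" "(z0, t0) \<in> B2" "B1 \<times> B2 \<subseteq> B"
    by (rule open_prodE[OF A(2,4)])
  obtain B3 B4 where B': "open B3" "open B4" "z0 \<in> B3" "t0 \<in> B4" "B3 \<times> B4 \<subseteq> B2"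
    by (rule open_prodE[OF B(2,4)])
  have fnz: "f (x, y, z, t) \<noteq> 0" if "x \<in> A" "y \<in> B1" "z \<in> B3" "t \<in> B4" for x y z t
    using that A(5) B(5) B'(5) by blast
  obtain \<delta> where \<delta>: "\<delta> > 0" "\<And>z. dist z z0 < \<delta> \<Longrightarrow> z \<in> B3" using B'(1,3) open_dist by blast
  define c where "c = (\<lambda>(x, y, t). - (x + x ^ d * y + t ^ \<alpha>\<^sub>3) :: complex)"
  have "open {p. dist (c p) (z0 ^ \<alpha>\<^sub>2) < \<delta> ^ \<alpha>\<^sub>2}"
    unfolding c_def case_prod_unfold by (intro open_Collect_less continuous_intros)
  moreover have "x0 + x0 ^ d * y0 + z0 ^ \<alpha>\<^sub>2 + t0 ^ \<alpha>\<^sub>3 = 0" using p by (simp add: p0 threefold_def)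
  then have "c (x0, y0, t0) = z0 ^ \<alpha>\<^sub>2" unfolding c_def case_prod_conv by (rule sum4_eq_0D[symmetric])
  then have "(x0, y0, t0) \<in> {p. dist (c p) (z0 ^ \<alpha>\<^sub>2) < \<delta> ^ \<alpha>\<^sub>2}" using \<delta> by simp
  ultimately obtain A1 A2 where A1: "open A1" "open A2" "x0 \<in> A1" "(y0, t0) \<in> A2" "A1 \<times> A2 \<subseteq> {p. dist (c p) (z0 ^ \<alpha>\<^sub>2) < \<delta> ^ \<alpha>\<^sub>2}"
    by (rule open_prodE)
  obtain A3 A4 where A3: "open A3" "open A4" "y0 \<in> A3" "t0 \<in> A4" "A3 \<times> A4 \<subseteq> A2"
    by (rule open_prodE[OF A1(2,4)])
  obtain x where x: "x \<in> A \<inter> A1" "x \<notin> {0}" by (rule open_minus_finite[of "A \<inter> A1" x0 "{0}"]) (use A A1 in auto)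
  obtain t where t: "t \<in> B4 \<inter> A4" "t \<notin> {0}" by (rule open_minus_finite[of "B4 \<inter> A4" t0 "{0}"]) (use B' A3 in auto)
  \<comment> \<open>the excluded value of \<open>y\<close> is the one that would force \<open>z = 0\<close>\<close>
  obtain y where y: "y \<in> B1 \<inter> A3" "y \<notin> {0, - (x + t ^ \<alpha>\<^sub>3) / x ^ d}"
    by (rule open_minus_finite[of "B1 \<inter> A3" y0 "{0, - (x + t ^ \<alpha>\<^sub>3) / x ^ d}"]) (use B A3 in auto)
  have "dist (c (x, y, t)) (z0 ^ \<alpha>\<^sub>2) < \<delta> ^ \<alpha>\<^sub>2" using x t y A1(5) A3(5) by blast
  then obtain z where z: "z ^ \<alpha>\<^sub>2 = c (x, y, t)" "dist z z0 < \<delta>" by (rule nearby_root[OF \<alpha>\<^sub>2 \<delta>(1)])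
  have "z \<in> B3" using z(2) by (rule \<delta>(2))
  then have "f (x, y, z, t) \<noteq> 0" using x y t by (intro fnz) auto
  moreover have "c (x, y, t) \<noteq> 0"
  proof
    assume "c (x, y, t) = 0"
    then have "y * x ^ d = - (x + t ^ \<alpha>\<^sub>3)" by (simp add: c_def algebra_simps add_eq_0_iff)
    then have "y = - (x + t ^ \<alpha>\<^sub>3) / x ^ d" using x by (simp add: eq_divide_eq)
    then show False using y by simp
  qed
  then have "z \<noteq> 0" using z(1) \<alpha>\<^sub>2 by (auto simp: zero_power)
  then have "(x, y, z, t) \<in> torus_part d \<alpha>\<^sub>2 \<alpha>\<^sub>3" using x y t z(1) by (simp add: torus_part_def threefold_def c_def)
  ultimately show False using van by blast
qed

section \<open>The coordinate ring of the threefold\<close>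

context koras_russell_data
begin

abbreviation "X \<equiv> threefold (Suc m) \<alpha>\<^sub>2 \<alpha>\<^sub>3"
abbreviation "X\<^sub>0 \<equiv> torus_part (Suc m) \<alpha>\<^sub>2 \<alpha>\<^sub>3"
abbreviation "B \<equiv> section_algebra Y Dq"

text \<open>The invariants \<open>s\<close> and \<open>w\<close>, and the function \<open>\<chi>\<close> of weight one.\<close>

definition quot_pt :: "C4 \<Rightarrow> C2" where "quot_pt = (\<lambda>(x, y, z, t). (x ^ m * y, t ^ \<alpha>\<^sub>3 / x))"
definition weight_one :: "C4 \<Rightarrow> complex" where "weight_one = (\<lambda>(x, y, z, t). z powi a * t powi b)"

text \<open>The value of the function \<open>x \<chi>\<^sup>n\<close> at a point with nonzero coordinates.\<close>

definition hvalue :: "int \<Rightarrow> ratpoly \<Rightarrow> C4 \<Rightarrow> complex" where "hvalue n x p = evf x (quot_pt p) * weight_one p powi n"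

lemma X\<^sub>0_theta:
  assumes "(x, y, z, t) \<in> X\<^sub>0" shows "1 + x ^ m * y + t ^ \<alpha>\<^sub>3 / x = - (z ^ \<alpha>\<^sub>2 / x)"
proof -
  have *: "x \<noteq> 0" "x + x ^ Suc m * y + z ^ \<alpha>\<^sub>2 + t ^ \<alpha>\<^sub>3 = 0" using assms by (auto simp: torus_part_def threefold_def)
  have e1: "u + v + r = - w" if "u + v + w + r = 0" for u v w r :: complex
    using sum4_eq_0D[OF that] by simp
  have e2: "L = - (w / u)" if "u \<noteq> 0" "u * L = - w" for u L w :: complex
    using that by (simp add: eq_divide_eq mult.commute flip: divide_minus_left)
  have "x * (1 + x ^ m * y + t ^ \<alpha>\<^sub>3 / x) = x + x ^ Suc m * y + t ^ \<alpha>\<^sub>3"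
    using *(1) by (simp add: distrib_left)
  also have "\<dots> = - (z ^ \<alpha>\<^sub>2)" using *(2) by (rule e1)
  finally show ?thesis by (rule e2[OF *(1)])
qed

lemma gens_at_X\<^sub>0:
  assumes p: "p \<in> X\<^sub>0"
  shows "evf xX (quot_pt p) \<noteq> 0" "evf xY (quot_pt p) \<noteq> 0" "evf xT (quot_pt p) \<noteq> 0"
proof -
  obtain x y z t where [simp]: "p = (x, y, z, t)" by (cases p)
  have nz: "x \<noteq> 0" "y \<noteq> 0" "z \<noteq> 0" "t \<noteq> 0" using p by (auto simp: torus_part_def)
  show "evf xX (quot_pt p) \<noteq> 0" "evf xY (quot_pt p) \<noteq> 0" using nz by (auto simp: quot_pt_def)
  have "ev (theta 1) (quot_pt p) = - (z ^ \<alpha>\<^sub>2 / x)" using X\<^sub>0_theta[of x y z t] p by (simp add: quot_pt_def)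
  then show "evf xT (quot_pt p) \<noteq> 0" using nz unfolding at_point_poly by auto
qed

lemma lmon_at_X\<^sub>0:
  assumes p: "p \<in> X\<^sub>0"
  shows "lmon i j k \<in> at_point (quot_pt p)"
    "evf (lmon i j k) (quot_pt p) = evf xX (quot_pt p) powi i * evf xY (quot_pt p) powi j * evf xT (quot_pt p) powi k"
proof -
  note g = gens_at_X\<^sub>0[OF p]
  note pw = at_point_powi[OF at_point_poly(1) g(1), of i] at_point_powi[OF at_point_poly(1) g(2), of j]
    at_point_powi[OF at_point_poly(1) g(3), of k]
  show "lmon i j k \<in> at_point (quot_pt p)" unfolding lmon_def by (intro at_point_mult(1) pw)
  show "evf (lmon i j k) (quot_pt p) = evf xX (quot_pt p) powi i * evf xY (quot_pt p) powi j * evf xT (quot_pt p) powi k"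
    unfolding lmon_def by (simp only: at_point_mult pw)
qed

text \<open>Substituting \<open>s = x\<^sup>m y\<close>, \<open>w = t^\<alpha>\<^sub>3 / x\<close>, \<open>\<theta> = - z^\<alpha>\<^sub>2 / x\<close> and \<open>\<chi> = z\<^sup>a t\<^sup>b\<close>.\<close>

lemma hvalue_lmon:
  assumes p: "(x, y, z, t) \<in> X\<^sub>0"
  shows "hvalue n (lmon i j k) (x, y, z, t) = (-1) powi k * x powi (int m * i - j - k) * y powi i
     * z powi (int \<alpha>\<^sub>2 * k + a * n) * t powi (int \<alpha>\<^sub>3 * j + b * n)"
proof -
  have nz: "x \<noteq> 0" "y \<noteq> 0" "z \<noteq> 0" "t \<noteq> 0" using p by (auto simp: torus_part_def)
  have ev: "evf xX (quot_pt (x, y, z, t)) = x powi int m * y" "evf xY (quot_pt (x, y, z, t)) = t powi int \<alpha>\<^sub>3 * x powi (-1)"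
    by (simp_all add: quot_pt_def power_int_minus divide_inverse)
  have "ev (theta 1) (quot_pt (x, y, z, t)) = (-1) * (z powi int \<alpha>\<^sub>2 * x powi (-1))"
    using X\<^sub>0_theta[OF p] by (simp add: quot_pt_def power_int_minus divide_inverse)
  then have evT: "evf xT (quot_pt (x, y, z, t)) = (-1) * (z powi int \<alpha>\<^sub>2 * x powi (-1))" by (simp only: at_point_poly(2))
  have m1: "(-1) * j = - j" for j :: int by simp
  have "hvalue n (lmon i j k) (x, y, z, t) = (x powi (int m * i) * y powi i) * (t powi (int \<alpha>\<^sub>3 * j) * x powi (- j))
     * ((-1) powi k * (z powi (int \<alpha>\<^sub>2 * k) * x powi (- k))) * (z powi (a * n) * t powi (b * n))"
    unfolding hvalue_def lmon_at_X\<^sub>0(2)[OF p] ev evT by (simp only: weight_one_def case_prod_conv power_int_mult_distrib power_int_mult[symmetric] m1)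
  also have "\<dots> = (-1) powi k * (x powi (int m * i) * x powi (- j) * x powi (- k)) * y powi i
     * (z powi (int \<alpha>\<^sub>2 * k) * z powi (a * n)) * (t powi (int \<alpha>\<^sub>3 * j) * t powi (b * n))" by (simp only: mult_ac)
  also have "\<dots> = (-1) powi k * x powi (int m * i - j - k) * y powi i
     * z powi (int \<alpha>\<^sub>2 * k + a * n) * t powi (int \<alpha>\<^sub>3 * j + b * n)"
    using nz by (simp add: power_int_add[symmetric])
  finally show ?thesis .
qed

lemma lmon_mult: "lmon i j k * lmon i' j' k' = lmon (i + i') (j + j') (k + k')"
  using gens_nonzero by (simp add: lmon_def power_int_add mult_ac)

lemma poly_as_lmon_sum:
  "to_fract g = (\<Sum>j\<le>degree g. \<Sum>i\<le>degree (coeff g j). to_fract (bC (coeff (coeff g j) i)) * lmon (int i) (int j) 0)"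
proof -
  have "g = (\<Sum>j\<le>degree g. \<Sum>i\<le>degree (coeff g j). bC (coeff (coeff g j) i) * bX ^ i * bY ^ j)"
  proof (rule ev_ext)
    fix q
    have "ev g q = (\<Sum>j\<le>degree g. poly (coeff g j) (fst q) * snd q ^ j)"
      by (simp add: ev_def poly_altdef[of g] poly_sum poly_power)
    then show "ev g q = ev (\<Sum>j\<le>degree g. \<Sum>i\<le>degree (coeff g j). bC (coeff (coeff g j) i) * bX ^ i * bY ^ j) q"
      by (simp add: ev_sum poly_altdef[of "coeff g _"] sum_distrib_right)
  qed
  then have "to_fract g = to_fract (\<Sum>j\<le>degree g. \<Sum>i\<le>degree (coeff g j). bC (coeff (coeff g j) i) * bX ^ i * bY ^ j)"
    by simp
  also have "\<dots> = (\<Sum>j\<le>degree g. \<Sum>i\<le>degree (coeff g j). to_fract (bC (coeff (coeff g j) i) * bX ^ i * bY ^ j))"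
  proof -
    have "to_fract (sum F A) = (\<Sum>i\<in>A. to_fract (F i))" for F :: "nat \<Rightarrow> bpoly" and A
      by (induction A rule: infinite_finite_induct) auto
    then show ?thesis by simp
  qed
  also have "\<dots> = (\<Sum>j\<le>degree g. \<Sum>i\<le>degree (coeff g j). to_fract (bC (coeff (coeff g j) i)) * lmon (int i) (int j) 0)"
  proof -
    have "to_fract (F ^ n) = to_fract F ^ n" for F :: bpoly and n by (induction n) auto
    then show ?thesis by (simp add: lmon_def mult.assoc)
  qed
  finally show ?thesis .
qed

lemma Sec_as_lmon_sum:
  assumes "x \<in> Sec n"
  obtains A :: "(nat \<times> nat) set" and c where "finite A"
    "x = (\<Sum>(i, j)\<in>A. to_fract (bC (c i j)) * lmon (int i - floor_E n) (int j - floor_2 n) (- floor_3 n))"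
    "\<And>i j. (i, j) \<in> A \<Longrightarrow> int j \<le> int m * (int i - floor_E n) + floor_2 n + floor_3 n"
proof -
  obtain g where g: "x = to_fract g * lmon (- floor_E n) (- floor_2 n) (- floor_3 n)"
    "\<And>i j. coeff (coeff g j) i \<noteq> 0 \<Longrightarrow> int j \<le> int m * (int i - floor_E n) + floor_2 n + floor_3 n"
    using Sec_decompose[OF assms] by blast
  define A0 where "A0 = (\<Union>j\<in>{..degree g}. \<Union>i\<in>{..degree (coeff g j)}. {(i, j)})"
  define A where "A = {(i, j)\<in>A0. coeff (coeff g j) i \<noteq> 0}"
  let ?F = "\<lambda>i j. to_fract (bC (coeff (coeff g j) i)) * lmon (int i - floor_E n) (int j - floor_2 n) (- floor_3 n)"
  have fin0: "finite A0" by (simp add: A0_def)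
  have "x = (\<Sum>j\<le>degree g. \<Sum>i\<le>degree (coeff g j). ?F i j)"
    unfolding g(1) poly_as_lmon_sum[of g] sum_distrib_right by (simp add: lmon_mult mult.assoc)
  also have "\<dots> = (\<Sum>(j, i)\<in>(SIGMA j:{..degree g}. {..degree (coeff g j)}). ?F i j)" by (simp add: sum.Sigma)
  also have "\<dots> = (\<Sum>(i, j)\<in>A0. ?F i j)"
    by (rule sum.reindex_bij_witness[of _ prod.swap prod.swap]) (auto simp: A0_def)
  also have "\<dots> = (\<Sum>(i, j)\<in>A. ?F i j)"
    using fin0 by (intro sum.mono_neutral_right) (auto simp: A_def)
  finally have "x = (\<Sum>(i, j)\<in>A. ?F i j)" .
  moreover have "finite A" using fin0 by (auto simp: A_def intro: finite_subset[OF _ fin0])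
  ultimately show thesis using that[of A "\<lambda>i j. coeff (coeff g j) i"] g(2) by (auto simp: A_def)
qed

lemma Sec_at_X\<^sub>0: assumes "x \<in> Sec n" "p \<in> X\<^sub>0" shows "x \<in> at_point (quot_pt p)"
proof -
  obtain A c where "finite A"
    "x = (\<Sum>(i, j)\<in>A. to_fract (bC (c i j)) * lmon (int i - floor_E n) (int j - floor_2 n) (- floor_3 n))"
    by (rule Sec_as_lmon_sum[OF assms(1)]) (rule that)
  then show ?thesis
    using at_point_sum[of A "\<lambda>(i, j). to_fract (bC (c i j)) * lmon (int i - floor_E n) (int j - floor_2 n) (- floor_3 n)" "quot_pt p"]
      lmon_at_X\<^sub>0(1)[OF assms(2)] at_point_mult(1)[OF at_point_poly(1)] by (auto simp: case_prod_unfold)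
qed

text \<open>After substitution all exponents are nonnegative, so that the function extends to the whole space.\<close>

lemma Sec_polynomial:
  assumes x: "x \<in> Sec n"
  obtains f where "f \<in> polynomials coordsC4" "\<And>p. p \<in> X\<^sub>0 \<Longrightarrow> f p = hvalue n x p"
proof -
  obtain A c where A: "finite A"
    "x = (\<Sum>(i, j)\<in>A. to_fract (bC (c i j)) * lmon (int i - floor_E n) (int j - floor_2 n) (- floor_3 n))"
    "\<And>i j. (i, j) \<in> A \<Longrightarrow> int j \<le> int m * (int i - floor_E n) + floor_2 n + floor_3 n"
    by (rule Sec_as_lmon_sum[OF x]) (rule that)
  define T where "T ij = (\<lambda>(x, y, z, t). c (fst ij) (snd ij) * ((-1) powi (- floor_3 n)
     * x ^ nat (int m * (int (fst ij) - floor_E n) - (int (snd ij) - floor_2 n) + floor_3 n) * y ^ nat (int (fst ij) - floor_E n)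
     * z ^ nat (int \<alpha>\<^sub>2 * (- floor_3 n) + a * n) * t ^ nat (int \<alpha>\<^sub>3 * (int (snd ij) - floor_2 n) + b * n)))" for ij :: "nat \<times> nat"
  have "T ij \<in> polynomials coordsC4" for ij
  proof -
    have "(\<lambda>p. c (fst ij) (snd ij) * ((-1) powi (- floor_3 n)
     * (\<lambda>(x, y, z, t). x) p ^ nat (int m * (int (fst ij) - floor_E n) - (int (snd ij) - floor_2 n) + floor_3 n) * (\<lambda>(x, y, z, t). y) p ^ nat (int (fst ij) - floor_E n)
     * (\<lambda>(x, y, z, t). z) p ^ nat (int \<alpha>\<^sub>2 * (- floor_3 n) + a * n) * (\<lambda>(x, y, z, t). t) p ^ nat (int \<alpha>\<^sub>3 * (int (snd ij) - floor_2 n) + b * n)))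
       \<in> polynomials coordsC4"
      by (intro polynomials.mult polynomials.const polynomials_power coordsC4_polynomials)
    then show ?thesis by (simp add: T_def case_prod_unfold)
  qed
  then have poly: "(\<lambda>p. \<Sum>ij\<in>A. T ij p) \<in> polynomials coordsC4" by (rule polynomials_sum)
  have floor_E: "floor_E n \<le> 0"
    unfolding floor_E_def using m \<alpha>\<^sub>2 \<alpha>\<^sub>3 by (simp add: div_neg_pos_less0 less_imp_le)
  have floor_3: "0 \<le> int \<alpha>\<^sub>2 * (- floor_3 n) + a * n"
  proof -
    have "int \<alpha>\<^sub>2 * floor_3 n + n * a mod int \<alpha>\<^sub>2 = n * a" unfolding floor_3_def by (rule mult_div_mod_eq)
    moreover have "0 \<le> n * a mod int \<alpha>\<^sub>2" using \<alpha>\<^sub>2 by (intro pos_mod_sign) simp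
    ultimately show ?thesis by (simp add: mult.commute[of a n])
  qed
  have floor_2: "0 \<le> int \<alpha>\<^sub>3 * (- floor_2 n) + b * n"
  proof -
    have "int \<alpha>\<^sub>3 * floor_2 n + n * b mod int \<alpha>\<^sub>3 = n * b" unfolding floor_2_def by (rule mult_div_mod_eq)
    moreover have "0 \<le> n * b mod int \<alpha>\<^sub>3" using \<alpha>\<^sub>3 by (intro pos_mod_sign) simp
    ultimately show ?thesis by (simp add: mult.commute[of b n])
  qed
  have "(\<Sum>ij\<in>A. T ij p) = hvalue n x p" if p: "p \<in> X\<^sub>0" for p
  proof -
    obtain x1 y z t where pe: "p = (x1, y, z, t)" by (cases p)
    have "hvalue n x p = (\<Sum>(i, j)\<in>A. evf (to_fract (bC (c i j)) * lmon (int i - floor_E n) (int j - floor_2 n) (- floor_3 n)) (quot_pt p)) * weight_one p powi n"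
      using at_point_sum[of A "\<lambda>(i, j). to_fract (bC (c i j)) * lmon (int i - floor_E n) (int j - floor_2 n) (- floor_3 n)" "quot_pt p"]
        lmon_at_X\<^sub>0(1)[OF p] at_point_mult(1)[OF at_point_poly(1)] unfolding hvalue_def A(2) by (auto simp: case_prod_unfold)
    also have "\<dots> = (\<Sum>(i, j)\<in>A. c i j * hvalue n (lmon (int i - floor_E n) (int j - floor_2 n) (- floor_3 n)) p)"
      using lmon_at_X\<^sub>0(1)[OF p] by (simp add: sum_distrib_right hvalue_def at_point_mult case_prod_unfold mult.assoc)
    also have "\<dots> = (\<Sum>ij\<in>A. T ij p)"
    proof (rule sum.cong[OF refl])
      fix ij assume ij: "ij \<in> A"
      obtain i j where e: "ij = (i, j)" by (cases ij)
      have 1: "0 \<le> int m * (int i - floor_E n) - (int j - floor_2 n) + floor_3 n" using A(3)[of i j] ij e by simp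
      have 2: "0 \<le> int i - floor_E n" using floor_E by simp
      have 3: "0 \<le> int \<alpha>\<^sub>3 * (int j - floor_2 n) + b * n"
      proof -
        have "0 \<le> int \<alpha>\<^sub>3 * int j + (int \<alpha>\<^sub>3 * (- floor_2 n) + b * n)" by (rule add_nonneg_nonneg[OF _ floor_2]) simp
        then show ?thesis by (simp add: algebra_simps)
      qed
      show "(case ij of (i, j) \<Rightarrow> c i j * hvalue n (lmon (int i - floor_E n) (int j - floor_2 n) (- floor_3 n)) p) = T ij p"
        unfolding e T_def pe case_prod_conv fst_conv snd_conv hvalue_lmon[OF p[unfolded pe]]
          power_int_nonneg_exp[OF 2] power_int_nonneg_exp[OF 3] power_int_nonneg_exp[OF floor_3]
        using power_int_nonneg_exp[OF 1, of x1] by simp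
    qed
    finally show ?thesis by simp
  qed
  with poly show thesis using that by blast
qed

end

section \<open>The section algebra is the coordinate ring\<close>

text \<open>Multiplied with a power of \<open>l\<close> the sum is a polynomial with infinitely many zeros.\<close>

lemma laurent_coefficients_vanish:
  fixes c :: "int \<Rightarrow> complex"
  assumes A: "finite A" and van: "\<And>l. l \<noteq> 0 \<Longrightarrow> (\<Sum>n\<in>A. l powi n * c n) = 0" and n: "n \<in> A"
  shows "c n = 0"
proof -
  obtain N where N: "\<And>n. n \<in> A \<Longrightarrow> - N \<le> n"
    using A by (metis Min_le minus_minus)
  define p where "p = (\<Sum>n\<in>A. monom (c n) (nat (n + N)))"
  have "poly p l = 0" if l: "l \<noteq> 0" for l
  proof -
    have "poly p l = (\<Sum>n\<in>A. l powi N * (l powi n * c n))"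
      unfolding p_def poly_sum poly_monom
    proof (rule sum.cong[OF refl])
      fix k assume "k \<in> A"
      then have "0 \<le> k + N" using N[of k] by simp
      then have "l ^ nat (k + N) = l powi (N + k)" by (simp add: power_int_nonneg_exp add.commute)
      then show "c k * l ^ nat (k + N) = l powi N * (l powi k * c k)" using l by (simp add: power_int_add)
    qed
    then show ?thesis using van[OF l] by (simp flip: sum_distrib_left)
  qed
  then have "- {0} \<subseteq> {l. poly p l = 0}" by auto
  moreover have "infinite (- {0 :: complex})" using infinite_UNIV_char_0 by (simp add: Compl_eq_Diff_UNIV)
  ultimately have "p = 0" using poly_roots_finite finite_subset by blast
  moreover have "coeff p (nat (n + N)) = c n"
  proof -
    have "coeff p (nat (n + N)) = (\<Sum>k\<in>A. if k = n then c k else 0)"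
      unfolding p_def coeff_sum coeff_monom
    proof (intro sum.cong refl)
      fix k assume "k \<in> A"
      then have "0 \<le> k + N" "0 \<le> n + N" using N[of k] N[OF n] by simp_all
      then have "nat (k + N) = nat (n + N) \<longleftrightarrow> k = n" by (simp add: eq_nat_nat_iff)
      then show "(if nat (k + N) = nat (n + N) then c k else 0) = (if k = n then c k else 0)" by simp
    qed
    then show ?thesis using A n by simp
  qed
  ultimately show ?thesis by simp
qed

context koras_russell_data
begin

text \<open>Computations with sections take place in the function field of the plane; this transports a family
  of its elements, one for each degree, to the function field of the quotient.\<close>

definition sect :: "(int \<Rightarrow> ratpoly) \<Rightarrow> int \<Rightarrow> (C2 \<times> C2 set) set ratfun" where "sect xs n = Q.\<Phi> False (xs n)"

definition Fin :: "(int \<Rightarrow> ratpoly) set" where "Fin = {xs. (\<forall>n. xs n \<in> Sec n) \<and> finite {n. xs n \<noteq> 0}}"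

lemma inj_sect: "inj sect"
proof (rule injI)
  fix xs ys assume "sect xs = sect ys"
  then have "sect xs n = sect ys n" for n by simp
  then show "xs = ys" by (simp add: sect_def fun_eq_iff)
qed

lemma sect_eq_zero_iff: "sect xs n = \<zero>\<^bsub>function_field Y\<^esub> \<longleftrightarrow> xs n = 0"
  by (simp add: sect_def Q.zero_K[of False])

lemma carrier_B: "carrier B = sect ` Fin"
proof (intro equalityI subsetI)
  fix s assume s: "s \<in> carrier B"
  then have sec: "s n \<in> sections Y (eval_pdivisor Dq n)" for n by (simp add: section_algebra_def Let_def)
  define xs where "xs n = (SOME x. s n = Q.\<Phi> False x)" for n
  have e: "s n = Q.\<Phi> False (xs n)" for n
  proof -
    have "s n \<in> carrier (function_field Y)" using sec[of n] by (simp add: sections_def)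
    then obtain x where "s n = Q.\<Phi> False x" by (rule Q.K_cases)
    then show ?thesis unfolding xs_def by (rule someI)
  qed
  have es: "s = sect xs" by (simp add: fun_eq_iff sect_def e)
  have "finite {n. sect xs n \<noteq> \<zero>\<^bsub>function_field Y\<^esub>}" using s es by (simp add: section_algebra_def Let_def)
  then have "xs \<in> Fin" using sec by (simp add: Fin_def Sec_def e sect_eq_zero_iff)
  then show "s \<in> sect ` Fin" using es by blast
next
  fix s assume "s \<in> sect ` Fin"
  then obtain xs where xs: "xs \<in> Fin" "s = sect xs" by blast
  then have "finite {n. sect xs n \<noteq> \<zero>\<^bsub>function_field Y\<^esub>}" by (simp add: Fin_def sect_eq_zero_iff)
  moreover have "sect xs n \<in> sections Y (eval_pdivisor Dq n)" for n using xs(1) by (simp add: Fin_def Sec_def sect_def)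
  ultimately show "s \<in> carrier B" using xs(2) by (simp add: section_algebra_def Let_def)
qed

lemma sect_in_carrier [simp]: "xs \<in> Fin \<Longrightarrow> sect xs \<in> carrier B" by (simp add: carrier_B)

definition convolve :: "(int \<Rightarrow> ratpoly) \<Rightarrow> (int \<Rightarrow> ratpoly) \<Rightarrow> int \<Rightarrow> ratpoly" where
  "convolve xs ys n = (\<Sum>i | xs i \<noteq> 0. xs i * ys (n - i))"

lemma mult_B: assumes "xs \<in> Fin" shows "sect xs \<otimes>\<^bsub>B\<^esub> sect ys = sect (convolve xs ys)"
proof
  fix n
  have fin: "finite {i. xs i \<noteq> 0}" using assms by (simp add: Fin_def)
  have "(sect xs \<otimes>\<^bsub>B\<^esub> sect ys) n = finsum (function_field Y) (\<lambda>i. sect xs i \<otimes>\<^bsub>function_field Y\<^esub> sect ys (n - i)) {i. sect xs i \<noteq> \<zero>\<^bsub>function_field Y\<^esub>}"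
    by (simp add: section_algebra_def Let_def)
  also have "\<dots> = finsum (function_field Y) (\<lambda>i. Q.\<Phi> False (xs i * ys (n - i))) {i. xs i \<noteq> 0}"
    by (simp only: sect_eq_zero_iff) (simp add: sect_def Q.mult_\<Phi>)
  also have "\<dots> = sect (convolve xs ys) n" using Q.finsum_\<Phi>[OF fin] by (simp add: sect_def convolve_def)
  finally show "(sect xs \<otimes>\<^bsub>B\<^esub> sect ys) n = sect (convolve xs ys) n" .
qed

lemma add_B: "sect xs \<oplus>\<^bsub>B\<^esub> sect ys = sect (\<lambda>n. xs n + ys n)"
  by (simp add: section_algebra_def Let_def fun_eq_iff sect_def Q.add_\<Phi>)

lemma smult_B: "c \<odot>\<^bsub>B\<^esub> sect xs = sect (\<lambda>n. to_fract (bC c) * xs n)"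
  by (simp add: section_algebra_def Let_def fun_eq_iff sect_def Q.smult_\<Phi>)

definition single :: "int \<Rightarrow> ratpoly \<Rightarrow> int \<Rightarrow> ratpoly" where "single k x n = (if n = k then x else 0)"

lemma one_B: "\<one>\<^bsub>B\<^esub> = sect (single 0 1)"
  by (simp add: section_algebra_def Let_def fun_eq_iff sect_def single_def Q.zero_K[of False] Q.one_K[of False])

lemma Fin_single: "x \<in> Sec k \<Longrightarrow> single k x \<in> Fin"
  by (auto simp: Fin_def single_def Sec_zero intro: finite_subset[of _ "{k}"])

lemma one_in_Sec: "1 \<in> Sec 0" using const_in_Sec[of 1] by simp

lemma convolve_support: "{n. convolve xs ys n \<noteq> 0} \<subseteq> (\<lambda>(i, j). i + j) ` ({n. xs n \<noteq> 0} \<times> {n. ys n \<noteq> 0})"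
proof
  fix n assume "n \<in> {n. convolve xs ys n \<noteq> 0}"
  then obtain i where "xs i \<noteq> 0" "xs i * ys (n - i) \<noteq> 0" unfolding convolve_def using sum.not_neutral_contains_not_neutral by force
  then have "(i, n - i) \<in> {n. xs n \<noteq> 0} \<times> {n. ys n \<noteq> 0}" by auto
  then show "n \<in> (\<lambda>(i, j). i + j) ` ({n. xs n \<noteq> 0} \<times> {n. ys n \<noteq> 0})" by force
qed

lemma Fin_convolve: assumes "xs \<in> Fin" "ys \<in> Fin" shows "convolve xs ys \<in> Fin"
proof -
  have "xs i * ys (n - i) \<in> Sec n" for i n using Sec_mult[of "xs i" i "ys (n - i)" "n - i"] assms by (simp add: Fin_def)
  then have "convolve xs ys n \<in> Sec n" for n unfolding convolve_def by (intro Sec_sum)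
  moreover have "finite {n. convolve xs ys n \<noteq> 0}"
    by (rule finite_subset[OF convolve_support]) (use assms in \<open>simp add: Fin_def\<close>)
  ultimately show ?thesis by (simp add: Fin_def)
qed

lemma Fin_add: assumes "xs \<in> Fin" "ys \<in> Fin" shows "(\<lambda>n. xs n + ys n) \<in> Fin"
proof -
  have "finite ({n. xs n \<noteq> 0} \<union> {n. ys n \<noteq> 0})" using assms by (simp add: Fin_def)
  then have "finite {n. xs n + ys n \<noteq> 0}" by (rule finite_subset[rotated]) auto
  then show ?thesis using assms Sec_add by (simp add: Fin_def)
qed

lemma Fin_weights: assumes "xs \<in> Fin" shows "(\<lambda>n. to_fract (bC (c n)) * xs n) \<in> Fin"
proof -
  have "to_fract (bC (c n)) * xs n \<in> Sec n" for n using Sec_mult[OF const_in_Sec, of "xs n" n] assms by (simp add: Fin_def)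
  moreover have "finite {n. xs n \<noteq> 0}" using assms by (simp add: Fin_def)
  then have "finite {n. to_fract (bC (c n)) * xs n \<noteq> 0}" by (rule finite_subset[rotated]) auto
  ultimately show ?thesis by (simp add: Fin_def)
qed

lemma hvalue_zero [simp]: "hvalue n 0 p = 0" using at_point_poly(2)[of 0 "quot_pt p"] by (simp add: hvalue_def)

text \<open>Evaluation of an element of the section algebra at a point with nonzero coordinates.\<close>

definition gvalue :: "(int \<Rightarrow> ratpoly) \<Rightarrow> C4 \<Rightarrow> complex" where "gvalue xs p = (\<Sum>n | xs n \<noteq> 0. hvalue n (xs n) p)"

lemma gvalue_superset: "finite C \<Longrightarrow> {n. xs n \<noteq> 0} \<subseteq> C \<Longrightarrow> gvalue xs p = (\<Sum>n\<in>C. hvalue n (xs n) p)"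
  unfolding gvalue_def by (rule sum.mono_neutral_left) auto

lemma gvalue_single: "gvalue (single k x) p = hvalue k x p"
  by (subst gvalue_superset[of "{k}"]) (auto simp: single_def)

lemma weight_one_nonzero: "p \<in> X\<^sub>0 \<Longrightarrow> weight_one p \<noteq> 0" by (auto simp: weight_one_def torus_part_def)

lemma hvalue_mult:
  assumes "x \<in> Sec n" "y \<in> Sec k" "p \<in> X\<^sub>0" shows "hvalue (n + k) (x * y) p = hvalue n x p * hvalue k y p"
  using at_point_mult[OF Sec_at_X\<^sub>0[OF assms(1,3)] Sec_at_X\<^sub>0[OF assms(2,3)]] weight_one_nonzero[OF assms(3)]
  by (simp add: hvalue_def power_int_add)

lemma hvalue_add:
  assumes "x \<in> Sec n" "y \<in> Sec n" "p \<in> X\<^sub>0" shows "hvalue n (x + y) p = hvalue n x p + hvalue n y p"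
  using at_point_add[OF Sec_at_X\<^sub>0[OF assms(1,3)] Sec_at_X\<^sub>0[OF assms(2,3)]] by (simp add: hvalue_def distrib_right)

lemma hvalue_sum:
  assumes "\<And>i. i \<in> A \<Longrightarrow> f i \<in> Sec n" "p \<in> X\<^sub>0" shows "hvalue n (sum f A) p = (\<Sum>i\<in>A. hvalue n (f i) p)"
  using assms(1) by (induction A rule: infinite_finite_induct) (auto simp: hvalue_add[OF _ Sec_sum assms(2)])

lemma hvalue_const: assumes "x \<in> Sec n" "p \<in> X\<^sub>0" shows "hvalue n (to_fract (bC c) * x) p = c * hvalue n x p"
  using at_point_mult(2)[OF at_point_poly(1) Sec_at_X\<^sub>0[OF assms]] by (simp add: hvalue_def)

lemma gvalue_convolve:
  assumes xs: "xs \<in> Fin" and ys: "ys \<in> Fin" and p: "p \<in> X\<^sub>0"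
  shows "gvalue (convolve xs ys) p = gvalue xs p * gvalue ys p"
proof -
  let ?A = "{n. xs n \<noteq> 0}" and ?B = "{n. ys n \<noteq> 0}"
  let ?C = "(\<lambda>(i, j). i + j) ` (?A \<times> ?B)"
  have fin: "finite ?A" "finite ?B" using xs ys by (auto simp: Fin_def)
  have inS: "xs n \<in> Sec n" "ys n \<in> Sec n" for n using xs ys by (auto simp: Fin_def)
  have hvalue_term: "hvalue n (xs i * ys (n - i)) p = hvalue i (xs i) p * hvalue (n - i) (ys (n - i)) p" for i n
    using hvalue_mult[OF inS(1)[of i] inS(2)[of "n - i"] p] by simp
  have "gvalue (convolve xs ys) p = (\<Sum>n\<in>?C. hvalue n (convolve xs ys n) p)"
    using fin convolve_support by (intro gvalue_superset) auto
  also have "\<dots> = (\<Sum>n\<in>?C. \<Sum>i\<in>?A. hvalue i (xs i) p * hvalue (n - i) (ys (n - i)) p)"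
  proof (rule sum.cong[OF refl])
    fix n
    have "xs i * ys (n - i) \<in> Sec n" for i using Sec_mult[OF inS(1)[of i] inS(2)[of "n - i"]] by simp
    then show "hvalue n (convolve xs ys n) p = (\<Sum>i\<in>?A. hvalue i (xs i) p * hvalue (n - i) (ys (n - i)) p)"
      unfolding convolve_def by (simp only: hvalue_sum[OF _ p] hvalue_term)
  qed
  also have "\<dots> = (\<Sum>i\<in>?A. \<Sum>n\<in>?C. hvalue i (xs i) p * hvalue (n - i) (ys (n - i)) p)" by (rule sum.swap)
  also have "\<dots> = (\<Sum>i\<in>?A. \<Sum>j\<in>?B. hvalue i (xs i) p * hvalue j (ys j) p)"
  proof (rule sum.cong[OF refl])
    fix i assume i: "i \<in> ?A"
    have "(\<Sum>j\<in>?B. hvalue i (xs i) p * hvalue j (ys j) p) = (\<Sum>n\<in>(\<lambda>j. i + j) ` ?B. hvalue i (xs i) p * hvalue (n - i) (ys (n - i)) p)"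
      by (subst sum.reindex) (auto simp: inj_on_def)
    also have "\<dots> = (\<Sum>n\<in>?C. hvalue i (xs i) p * hvalue (n - i) (ys (n - i)) p)"
    proof (rule sum.mono_neutral_left)
      show "finite ?C" using fin by simp
      show "(\<lambda>j. i + j) ` ?B \<subseteq> ?C" using i by force
      show "\<forall>n\<in>?C - (\<lambda>j. i + j) ` ?B. hvalue i (xs i) p * hvalue (n - i) (ys (n - i)) p = 0"
      proof
        fix n assume n: "n \<in> ?C - (\<lambda>j. i + j) ` ?B"
        have "ys (n - i) = 0"
        proof (rule ccontr)
          assume "ys (n - i) \<noteq> 0"
          then have "i + (n - i) \<in> (\<lambda>j. i + j) ` ?B" by blast
          then show False using n by simp
        qed
        then show "hvalue i (xs i) p * hvalue (n - i) (ys (n - i)) p = 0" by simp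
      qed
    qed
    finally show "(\<Sum>n\<in>?C. hvalue i (xs i) p * hvalue (n - i) (ys (n - i)) p) = (\<Sum>j\<in>?B. hvalue i (xs i) p * hvalue j (ys j) p)" by simp
  qed
  also have "\<dots> = gvalue xs p * gvalue ys p" by (simp add: gvalue_def sum_product)
  finally show ?thesis .
qed

lemma gvalue_add:
  assumes xs: "xs \<in> Fin" and ys: "ys \<in> Fin" and p: "p \<in> X\<^sub>0"
  shows "gvalue (\<lambda>n. xs n + ys n) p = gvalue xs p + gvalue ys p"
proof -
  let ?C = "{n. xs n \<noteq> 0} \<union> {n. ys n \<noteq> 0}"
  have fin: "finite ?C" using xs ys by (auto simp: Fin_def)
  have "gvalue (\<lambda>n. xs n + ys n) p = (\<Sum>n\<in>?C. hvalue n (xs n + ys n) p)" by (intro gvalue_superset fin) auto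
  also have "\<dots> = (\<Sum>n\<in>?C. hvalue n (xs n) p + hvalue n (ys n) p)"
    using xs ys p by (intro sum.cong refl hvalue_add) (auto simp: Fin_def)
  also have "\<dots> = gvalue xs p + gvalue ys p" using fin by (simp add: sum.distrib gvalue_superset[of ?C])
  finally show ?thesis .
qed

lemma gvalue_weights:
  assumes xs: "xs \<in> Fin" and p: "p \<in> X\<^sub>0"
  shows "gvalue (\<lambda>n. to_fract (bC (c n)) * xs n) p = (\<Sum>n | xs n \<noteq> 0. c n * hvalue n (xs n) p)"
proof -
  have fin: "finite {n. xs n \<noteq> 0}" using xs by (simp add: Fin_def)
  have "gvalue (\<lambda>n. to_fract (bC (c n)) * xs n) p = (\<Sum>n | xs n \<noteq> 0. hvalue n (to_fract (bC (c n)) * xs n) p)"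
    by (intro gvalue_superset fin) auto
  also have "\<dots> = (\<Sum>n | xs n \<noteq> 0. c n * hvalue n (xs n) p)"
    using xs p by (intro sum.cong refl hvalue_const) (auto simp: Fin_def)
  finally show ?thesis .
qed

lemma gvalue_polynomial:
  assumes xs: "xs \<in> Fin" obtains f where "f \<in> polynomials coordsC4" "\<And>p. p \<in> X\<^sub>0 \<Longrightarrow> f p = gvalue xs p"
proof -
  have "\<exists>f. f \<in> polynomials coordsC4 \<and> (\<forall>p\<in>X\<^sub>0. f p = hvalue n (xs n) p)" for n
  proof -
    have "xs n \<in> Sec n" using xs by (simp add: Fin_def)
    then obtain f where "f \<in> polynomials coordsC4" "\<And>p. p \<in> X\<^sub>0 \<Longrightarrow> f p = hvalue n (xs n) p"
      by (rule Sec_polynomial) (rule that)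
    then show ?thesis by (intro exI conjI ballI)
  qed
  then have "\<forall>n. \<exists>f. f \<in> polynomials coordsC4 \<and> (\<forall>p\<in>X\<^sub>0. f p = hvalue n (xs n) p)" by (rule allI)
  then obtain F where "\<forall>n. F n \<in> polynomials coordsC4 \<and> (\<forall>p\<in>X\<^sub>0. F n p = hvalue n (xs n) p)"
    by (rule exE[OF choice])
  then have F: "\<And>n. F n \<in> polynomials coordsC4" "\<And>n p. p \<in> X\<^sub>0 \<Longrightarrow> F n p = hvalue n (xs n) p" by simp_all
  show thesis
  proof (rule that)
    show "(\<lambda>p. \<Sum>n | xs n \<noteq> 0. F n p) \<in> polynomials coordsC4" by (intro polynomials_sum F)
  qed (simp add: gvalue_def F(2))
qed

text \<open>The polynomial function on the threefold that corresponds to an element of the section algebra. It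
  is determined on the threefold by its values at the points with nonzero coordinates.\<close>

definition coord_fun :: "(int \<Rightarrow> (C2 \<times> C2 set) set ratfun) \<Rightarrow> C4 \<Rightarrow> complex" where
  "coord_fun s = (SOME f. f \<in> polynomials coordsC4 \<and> (\<forall>xs\<in>Fin. s = sect xs \<longrightarrow> (\<forall>p\<in>X\<^sub>0. f p = gvalue xs p)))"

lemma coord_fun_sect:
  assumes "xs \<in> Fin" shows "coord_fun (sect xs) \<in> polynomials coordsC4" "p \<in> X\<^sub>0 \<Longrightarrow> coord_fun (sect xs) p = gvalue xs p"
proof -
  obtain f where f: "f \<in> polynomials coordsC4" "\<And>p. p \<in> X\<^sub>0 \<Longrightarrow> f p = gvalue xs p" using gvalue_polynomial[OF assms] by blast
  have "f \<in> polynomials coordsC4 \<and> (\<forall>ys\<in>Fin. sect xs = sect ys \<longrightarrow> (\<forall>p\<in>X\<^sub>0. f p = gvalue ys p))"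
  proof (intro conjI f(1) ballI impI)
    fix ys p assume e: "sect xs = sect ys" and p: "p \<in> X\<^sub>0"
    have "xs = ys" using e by (rule injD[OF inj_sect])
    then show "f p = gvalue ys p" using f(2)[OF p] by simp
  qed
  then have "coord_fun (sect xs) \<in> polynomials coordsC4 \<and> (\<forall>ys\<in>Fin. sect xs = sect ys \<longrightarrow> (\<forall>p\<in>X\<^sub>0. coord_fun (sect xs) p = gvalue ys p))"
    unfolding coord_fun_def
    by (rule someI[where P = "\<lambda>f. f \<in> polynomials coordsC4 \<and> (\<forall>ys\<in>Fin. sect xs = sect ys \<longrightarrow> (\<forall>p\<in>X\<^sub>0. f p = gvalue ys p))"])
  then show "coord_fun (sect xs) \<in> polynomials coordsC4" "p \<in> X\<^sub>0 \<Longrightarrow> coord_fun (sect xs) p = gvalue xs p" using assms by blast+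
qed

lemma X\<^sub>0_subset: "X\<^sub>0 \<subseteq> X" by (auto simp: torus_part_def)

lemma polynomial_eq_on_X:
  assumes "f \<in> polynomials coordsC4" "g \<in> polynomials coordsC4" "\<And>p. p \<in> X\<^sub>0 \<Longrightarrow> f p = g p" "p \<in> X"
  shows "f p = g p"
proof -
  have "(\<lambda>p. f p + (-1) * g p) \<in> polynomials coordsC4" by (intro polynomials.add polynomials.mult polynomials.const assms)
  from torus_part_dense[OF _ this _ assms(4)] show ?thesis using assms(3) \<alpha>\<^sub>2 by simp
qed

lemma coord_fun_eqI:
  assumes "xs \<in> Fin" "f \<in> polynomials coordsC4" "\<And>p. p \<in> X\<^sub>0 \<Longrightarrow> gvalue xs p = f p" "p \<in> X" shows "coord_fun (sect xs) p = f p"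
  by (rule polynomial_eq_on_X[OF coord_fun_sect(1)[OF assms(1)] assms(2) _ assms(4)]) (simp add: coord_fun_sect(2)[OF assms(1)] assms(3))

lemma B_closed:
  "s \<in> carrier B \<Longrightarrow> s' \<in> carrier B \<Longrightarrow> s \<otimes>\<^bsub>B\<^esub> s' \<in> carrier B"
  "s \<in> carrier B \<Longrightarrow> s' \<in> carrier B \<Longrightarrow> s \<oplus>\<^bsub>B\<^esub> s' \<in> carrier B"
  "s \<in> carrier B \<Longrightarrow> c \<odot>\<^bsub>B\<^esub> s \<in> carrier B" "\<one>\<^bsub>B\<^esub> \<in> carrier B"
proof -
  show "\<one>\<^bsub>B\<^esub> \<in> carrier B" unfolding one_B by (intro sect_in_carrier Fin_single one_in_Sec)
  assume "s \<in> carrier B"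
  then obtain xs where xs: "xs \<in> Fin" "s = sect xs" using carrier_B by blast
  show "c \<odot>\<^bsub>B\<^esub> s \<in> carrier B" unfolding xs(2) smult_B by (intro sect_in_carrier Fin_weights xs)
  assume "s' \<in> carrier B"
  then obtain ys where ys: "ys \<in> Fin" "s' = sect ys" using carrier_B by blast
  show "s \<otimes>\<^bsub>B\<^esub> s' \<in> carrier B" unfolding xs(2) ys(2) mult_B[OF xs(1)] by (intro sect_in_carrier Fin_convolve xs ys)
  show "s \<oplus>\<^bsub>B\<^esub> s' \<in> carrier B" unfolding xs(2) ys(2) add_B by (intro sect_in_carrier Fin_add xs ys)
qed

lemma coord_fun_hom:
  assumes p: "p \<in> X"
  shows "s \<in> carrier B \<Longrightarrow> s' \<in> carrier B \<Longrightarrow> coord_fun (s \<otimes>\<^bsub>B\<^esub> s') p = coord_fun s p * coord_fun s' p"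
    "s \<in> carrier B \<Longrightarrow> s' \<in> carrier B \<Longrightarrow> coord_fun (s \<oplus>\<^bsub>B\<^esub> s') p = coord_fun s p + coord_fun s' p"
    "s \<in> carrier B \<Longrightarrow> coord_fun (c \<odot>\<^bsub>B\<^esub> s) p = c * coord_fun s p" "coord_fun \<one>\<^bsub>B\<^esub> p = 1"
proof -
  show "coord_fun \<one>\<^bsub>B\<^esub> p = 1" unfolding one_B
  proof (rule coord_fun_eqI[OF Fin_single[OF one_in_Sec] polynomials.const _ p])
    show "gvalue (single 0 1) q = 1" for q using at_point_poly(2)[of 1 "quot_pt q"] by (simp add: gvalue_single hvalue_def)
  qed
  assume "s \<in> carrier B"
  then obtain xs where xs: "xs \<in> Fin" "s = sect xs" using carrier_B by blast
  show "coord_fun (c \<odot>\<^bsub>B\<^esub> s) p = c * coord_fun s p" unfolding xs(2) smult_B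
  proof (rule coord_fun_eqI[OF Fin_weights[OF xs(1)] _ _ p])
    show "(\<lambda>p. c * coord_fun (sect xs) p) \<in> polynomials coordsC4" by (intro polynomials.mult polynomials.const coord_fun_sect xs)
    show "gvalue (\<lambda>n. to_fract (bC c) * xs n) q = c * coord_fun (sect xs) q" if "q \<in> X\<^sub>0" for q
      using gvalue_weights[OF xs(1) that, of "\<lambda>_. c"] coord_fun_sect(2)[OF xs(1) that] by (simp add: gvalue_def sum_distrib_left)
  qed
  assume "s' \<in> carrier B"
  then obtain ys where ys: "ys \<in> Fin" "s' = sect ys" using carrier_B by blast
  show "coord_fun (s \<otimes>\<^bsub>B\<^esub> s') p = coord_fun s p * coord_fun s' p" unfolding xs(2) ys(2) mult_B[OF xs(1)]
  proof (rule coord_fun_eqI[OF Fin_convolve[OF xs(1) ys(1)] _ _ p])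
    show "(\<lambda>p. coord_fun (sect xs) p * coord_fun (sect ys) p) \<in> polynomials coordsC4" by (intro polynomials.mult coord_fun_sect xs ys)
  qed (simp add: gvalue_convolve xs ys coord_fun_sect)
  show "coord_fun (s \<oplus>\<^bsub>B\<^esub> s') p = coord_fun s p + coord_fun s' p" unfolding xs(2) ys(2) add_B
  proof (rule coord_fun_eqI[OF Fin_add[OF xs(1) ys(1)] _ _ p])
    show "(\<lambda>p. coord_fun (sect xs) p + coord_fun (sect ys) p) \<in> polynomials coordsC4" by (intro polynomials.add coord_fun_sect xs ys)
  qed (simp add: gvalue_add xs ys coord_fun_sect)
qed

abbreviation "act \<equiv> koras_russell_act (Suc m) \<alpha>\<^sub>2 \<alpha>\<^sub>3"

lemma act_X:
  assumes l: "l \<noteq> 0" and p: "p \<in> X" shows "act l p \<in> X"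
proof -
  obtain x y z t where [simp]: "p = (x, y, z, t)" by (cases p)
  have eq: "x + x ^ Suc m * y + z ^ \<alpha>\<^sub>2 + t ^ \<alpha>\<^sub>3 = 0" using p by (simp add: threefold_def)
  let ?e = "int \<alpha>\<^sub>2 * int \<alpha>\<^sub>3"
  have e: "?e * int (Suc m) + (- (int (Suc m) - 1) * int \<alpha>\<^sub>2 * int \<alpha>\<^sub>3) = ?e" by (simp add: algebra_simps)
  have "(l powi ?e * x) ^ Suc m * (l powi (- (int (Suc m) - 1) * int \<alpha>\<^sub>2 * int \<alpha>\<^sub>3) * y)
      = (l powi (?e * int (Suc m)) * l powi (- (int (Suc m) - 1) * int \<alpha>\<^sub>2 * int \<alpha>\<^sub>3)) * (x ^ Suc m * y)"
    by (simp only: power_mult_distrib power_int_power' mult_ac)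
  also have "\<dots> = l powi ?e * (x ^ Suc m * y)" using l by (simp only: power_int_add[OF disjI1[OF l], symmetric] e)
  finally have "l powi ?e * x + (l powi ?e * x) ^ Suc m * (l powi (- (int (Suc m) - 1) * int \<alpha>\<^sub>2 * int \<alpha>\<^sub>3) * y)
     + (l powi int \<alpha>\<^sub>3 * z) ^ \<alpha>\<^sub>2 + (l powi int \<alpha>\<^sub>2 * t) ^ \<alpha>\<^sub>3
     = l powi ?e * (x + x ^ Suc m * y + z ^ \<alpha>\<^sub>2 + t ^ \<alpha>\<^sub>3)"
    by (simp only: power_mult_distrib power_int_power' distrib_left mult.commute[of "int \<alpha>\<^sub>3" "int \<alpha>\<^sub>2"])
  then show ?thesis using eq by (simp only: \<open>p = _\<close> koras_russell_act_def threefold_def mem_Collect_eq case_prod_conv mult_zero_right)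
qed

lemma act_X\<^sub>0:
  assumes l: "l \<noteq> 0" and p: "p \<in> X\<^sub>0"
  shows "act l p \<in> X\<^sub>0" "quot_pt (act l p) = quot_pt p" "weight_one (act l p) = l * weight_one p"
proof -
  obtain x y z t where pe [simp]: "p = (x, y, z, t)" by (cases p)
  have nz: "x \<noteq> 0" "y \<noteq> 0" "z \<noteq> 0" "t \<noteq> 0" using p by (auto simp: torus_part_def)
  have "act l p \<in> X" using act_X[OF l] p X\<^sub>0_subset by blast
  then show "act l p \<in> X\<^sub>0" using nz l by (simp add: torus_part_def koras_russell_act_def)
  let ?e = "int \<alpha>\<^sub>2 * int \<alpha>\<^sub>3"
  have e: "?e * int m + (- (int (Suc m) - 1) * int \<alpha>\<^sub>2 * int \<alpha>\<^sub>3) = 0" by simp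
  have "(l powi ?e * x) ^ m * (l powi (- (int (Suc m) - 1) * int \<alpha>\<^sub>2 * int \<alpha>\<^sub>3) * y)
      = (l powi (?e * int m) * l powi (- (int (Suc m) - 1) * int \<alpha>\<^sub>2 * int \<alpha>\<^sub>3)) * (x ^ m * y)"
    by (simp only: power_mult_distrib power_int_power' mult_ac)
  also have "\<dots> = x ^ m * y" using l by (simp only: power_int_add[OF disjI1[OF l], symmetric] e power_int_0_right mult_1)
  finally have q1: "(l powi ?e * x) ^ m * (l powi (- (int (Suc m) - 1) * int \<alpha>\<^sub>2 * int \<alpha>\<^sub>3) * y) = x ^ m * y" .
  have q2: "(l powi int \<alpha>\<^sub>2 * t) ^ \<alpha>\<^sub>3 / (l powi ?e * x) = t ^ \<alpha>\<^sub>3 / x"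
    using l by (simp add: power_mult_distrib power_int_power' del: power_int_of_nat)
  show "quot_pt (act l p) = quot_pt p" using q1 q2 by (simp only: pe koras_russell_act_def quot_pt_def case_prod_conv)
  have "(l powi int \<alpha>\<^sub>3 * z) powi a * (l powi int \<alpha>\<^sub>2 * t) powi b
     = (l powi (int \<alpha>\<^sub>3 * a) * l powi (int \<alpha>\<^sub>2 * b)) * (z powi a * t powi b)"
    unfolding power_int_mult_distrib power_int_mult[symmetric] by (simp only: mult_ac)
  also have "\<dots> = l powi (a * int \<alpha>\<^sub>3 + b * int \<alpha>\<^sub>2) * (z powi a * t powi b)"
    using l by (simp only: power_int_add[OF disjI1[OF l]] mult.commute[of a] mult.commute[of b])
  also have "\<dots> = l * (z powi a * t powi b)" using bezout by simp
  finally show "weight_one (act l p) = l * weight_one p" by (simp only: pe koras_russell_act_def weight_one_def case_prod_conv)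
qed

lemma hvalue_act: "l \<noteq> 0 \<Longrightarrow> p \<in> X\<^sub>0 \<Longrightarrow> hvalue n x (act l p) = l powi n * hvalue n x p"
  by (simp add: hvalue_def act_X\<^sub>0 power_int_mult_distrib)

text \<open>The action multiplies the component of degree \<open>n\<close> with \<open>l\<^sup>n\<close>, so each component can be recovered
  from the values on an orbit. The invariants \<open>s\<close> and \<open>w\<close> take all values in an open subset of the plane
  already on the points with \<open>x = 1\<close>.\<close>

lemma gvalue_separates:
  assumes xs: "xs \<in> Fin" and ys: "ys \<in> Fin" and eq: "\<And>p. p \<in> X\<^sub>0 \<Longrightarrow> gvalue xs p = gvalue ys p"
  shows "xs = ys"
proof
  fix n
  let ?C = "insert n ({n. xs n \<noteq> 0} \<union> {n. ys n \<noteq> 0})"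
  have fin: "finite ?C" using xs ys by (auto simp: Fin_def)
  have same_value: "evf (xs n) (quot_pt p) = evf (ys n) (quot_pt p)" if p: "p \<in> X\<^sub>0" for p
  proof -
    have "hvalue n (xs n) p - hvalue n (ys n) p = 0"
    proof (rule laurent_coefficients_vanish[OF fin])
      fix l :: complex assume l: "l \<noteq> 0"
      have "(\<Sum>n\<in>?C. l powi n * (hvalue n (xs n) p - hvalue n (ys n) p))
          = (\<Sum>n\<in>?C. hvalue n (xs n) (act l p)) - (\<Sum>n\<in>?C. hvalue n (ys n) (act l p))"
        by (simp only: hvalue_act[OF l p] right_diff_distrib sum_subtractf)
      also have "\<dots> = gvalue xs (act l p) - gvalue ys (act l p)"
      proof -
        have "gvalue xs q = (\<Sum>n\<in>?C. hvalue n (xs n) q)" "gvalue ys q = (\<Sum>n\<in>?C. hvalue n (ys n) q)" for q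
          by (rule gvalue_superset[OF fin]; blast)+
        then show ?thesis by simp
      qed
      also have "\<dots> = 0" using eq act_X\<^sub>0(1)[OF l p] by simp
      finally show "(\<Sum>n\<in>?C. l powi n * (hvalue n (xs n) p - hvalue n (ys n) p)) = 0" .
    qed simp
    then show ?thesis using weight_one_nonzero[OF p] by (simp add: hvalue_def)
  qed
  show "xs n = ys n"
  proof (rule evf_eqI)
    let ?W = "{q. ev (bX * bY * theta 1) q \<noteq> 0}"
    show "zopen ?W" by (rule zopen_basic)
    have "bX * bY * theta 1 \<noteq> 0" using gens0 irreducible_theta[of 1] by auto
    then show "?W \<noteq> {}" using ev_nonzero by blast
    fix q assume q: "q \<in> ?W"
    define t where "t = some_root \<alpha>\<^sub>3 (snd q)"
    define z where "z = some_root \<alpha>\<^sub>2 (- (1 + fst q + snd q))"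
    have tz: "t ^ \<alpha>\<^sub>3 = snd q" "z ^ \<alpha>\<^sub>2 = - (1 + fst q + snd q)" using \<alpha>\<^sub>2 \<alpha>\<^sub>3 by (simp_all add: t_def z_def)
    have nz: "fst q \<noteq> 0" "snd q \<noteq> 0" "1 + fst q + snd q \<noteq> 0" using q by auto
    have "z ^ \<alpha>\<^sub>2 \<noteq> 0" "t ^ \<alpha>\<^sub>3 \<noteq> 0" unfolding tz using nz by (simp_all only: neg_equal_0_iff_equal not_False_eq_True)
    then have "z \<noteq> 0" "t \<noteq> 0" using \<alpha>\<^sub>2 \<alpha>\<^sub>3 by (auto simp: zero_power)
    then have p: "(1, fst q, z, t) \<in> X\<^sub>0" using nz by (simp add: torus_part_def threefold_def tz)
    moreover have "quot_pt (1, fst q, z, t) = q" by (simp add: quot_pt_def tz)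
    ultimately show "xs n \<in> at_point q \<and> ys n \<in> at_point q \<and> evf (xs n) q = evf (ys n) q"
      using same_value[OF p] Sec_at_X\<^sub>0[OF _ p, of "xs n" n] Sec_at_X\<^sub>0[OF _ p, of "ys n" n] xs ys by (auto simp: Fin_def)
  qed
qed

lemma coord_fun_separates:
  assumes "s \<in> carrier B" "s' \<in> carrier B" "\<And>p. p \<in> X \<Longrightarrow> coord_fun s p = coord_fun s' p" shows "s = s'"
proof -
  obtain xs ys where xs: "xs \<in> Fin" "s = sect xs" "ys \<in> Fin" "s' = sect ys" using assms carrier_B by blast
  have "gvalue xs p = gvalue ys p" if "p \<in> X\<^sub>0" for p
    using assms(3)[of p] coord_fun_sect(2)[OF xs(1) that] coord_fun_sect(2)[OF xs(3) that] X\<^sub>0_subset that xs by auto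
  then show ?thesis using gvalue_separates[OF xs(1,3)] xs by simp
qed

definition sign_const :: "int \<Rightarrow> ratpoly" where "sign_const k = to_fract (bC ((-1) powi k))"

text \<open>The components are \<open>x / \<chi>^(\<alpha>\<^sub>2 \<alpha>\<^sub>3)\<close>, \<open>y \<chi>^(m \<alpha>\<^sub>2 \<alpha>\<^sub>3)\<close>, \<open>z / \<chi>^\<alpha>\<^sub>3\<close> and \<open>t / \<chi>^\<alpha>\<^sub>2\<close>, written in terms of
  \<open>s\<close>, \<open>w\<close> and \<open>\<theta>\<close>. The signs come from \<open>z^\<alpha>\<^sub>2 = - \<theta> x\<close>.\<close>

definition "gen_x = single (int \<alpha>\<^sub>2 * int \<alpha>\<^sub>3) (sign_const (a * int \<alpha>\<^sub>3) * lmon 0 (- b * int \<alpha>\<^sub>2) (- a * int \<alpha>\<^sub>3))"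
definition "gen_y = single (- int m * int \<alpha>\<^sub>2 * int \<alpha>\<^sub>3) (sign_const (int m * a * int \<alpha>\<^sub>3) * lmon 1 (int m * b * int \<alpha>\<^sub>2) (int m * a * int \<alpha>\<^sub>3))"
definition "gen_z = single (int \<alpha>\<^sub>3) (sign_const b * lmon 0 (- b) b)"
definition "gen_t = single (int \<alpha>\<^sub>2) (sign_const a * lmon 0 a (- a))"

lemma sign_const_lmon_in_Sec: "lmon i j k \<in> Sec n \<Longrightarrow> sign_const r * lmon i j k \<in> Sec n"
  using Sec_mult[OF const_in_Sec, of "lmon i j k" n] by (simp add: sign_const_def)

lemma bezout_div: "int \<alpha>\<^sub>3 * a div int \<alpha>\<^sub>2 = - b" "int \<alpha>\<^sub>2 * b div int \<alpha>\<^sub>3 = - a"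
proof -
  have "int \<alpha>\<^sub>3 * a = 1 + (- b) * int \<alpha>\<^sub>2" using bezout by (simp add: mult.commute)
  moreover have "(1 + (- b) * int \<alpha>\<^sub>2) div int \<alpha>\<^sub>2 = - b" using \<alpha>\<^sub>2 by (subst div_mult_self1) auto
  ultimately show "int \<alpha>\<^sub>3 * a div int \<alpha>\<^sub>2 = - b" by simp
  have "int \<alpha>\<^sub>2 * b = 1 + (- a) * int \<alpha>\<^sub>3" using bezout by (simp add: mult.commute)
  moreover have "(1 + (- a) * int \<alpha>\<^sub>3) div int \<alpha>\<^sub>3 = - a" using \<alpha>\<^sub>3 by (subst div_mult_self1) auto
  ultimately show "int \<alpha>\<^sub>2 * b div int \<alpha>\<^sub>3 = - a" by simp
qed

lemma gens_in_Fin: "gen_x \<in> Fin" "gen_y \<in> Fin" "gen_z \<in> Fin" "gen_t \<in> Fin"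
proof -
  have pos: "int \<alpha>\<^sub>2 \<noteq> 0" "int \<alpha>\<^sub>3 \<noteq> 0" "0 < int m * int \<alpha>\<^sub>2 * int \<alpha>\<^sub>3" using \<alpha>\<^sub>2 \<alpha>\<^sub>3 m by auto
  show "gen_z \<in> Fin" unfolding gen_z_def using pos
    by (intro Fin_single sign_const_lmon_in_Sec lmon_in_Sec) (simp_all add: floor_E_def floor_2_def floor_3_def bezout_div)
  show "gen_t \<in> Fin" unfolding gen_t_def using pos
    by (intro Fin_single sign_const_lmon_in_Sec lmon_in_Sec) (simp_all add: floor_E_def floor_2_def floor_3_def bezout_div)
  have c3x: "floor_3 (int \<alpha>\<^sub>2 * int \<alpha>\<^sub>3) = a * int \<alpha>\<^sub>3" and c2x: "floor_2 (int \<alpha>\<^sub>2 * int \<alpha>\<^sub>3) = b * int \<alpha>\<^sub>2"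
  proof -
    have "int \<alpha>\<^sub>2 * int \<alpha>\<^sub>3 * a = (a * int \<alpha>\<^sub>3) * int \<alpha>\<^sub>2" "int \<alpha>\<^sub>2 * int \<alpha>\<^sub>3 * b = (b * int \<alpha>\<^sub>2) * int \<alpha>\<^sub>3" by (simp_all only: mult_ac)
    then show "floor_3 (int \<alpha>\<^sub>2 * int \<alpha>\<^sub>3) = a * int \<alpha>\<^sub>3" "floor_2 (int \<alpha>\<^sub>2 * int \<alpha>\<^sub>3) = b * int \<alpha>\<^sub>2"
      using pos by (simp_all only: floor_3_def floor_2_def nonzero_mult_div_cancel_right not_False_eq_True)
  qed
  show "gen_x \<in> Fin" unfolding gen_x_def using bezout
    by (intro Fin_single sign_const_lmon_in_Sec lmon_in_Sec) (simp_all add: c2x c3x floor_E_def)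
  let ?n = "- int m * int \<alpha>\<^sub>2 * int \<alpha>\<^sub>3"
  have c3y: "floor_3 ?n = - (int m * a * int \<alpha>\<^sub>3)" and c2y: "floor_2 ?n = - (int m * b * int \<alpha>\<^sub>2)"
  proof -
    have "?n * a = (- (int m * a * int \<alpha>\<^sub>3)) * int \<alpha>\<^sub>2" "?n * b = (- (int m * b * int \<alpha>\<^sub>2)) * int \<alpha>\<^sub>3" by (simp_all add: mult_ac)
    then show "floor_3 ?n = - (int m * a * int \<alpha>\<^sub>3)" "floor_2 ?n = - (int m * b * int \<alpha>\<^sub>2)"
      using pos by (simp_all only: floor_3_def floor_2_def nonzero_mult_div_cancel_right not_False_eq_True)
  qed
  have "?n = (- 1) * (int m * int \<alpha>\<^sub>2 * int \<alpha>\<^sub>3)" by simp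
  then have "?n div (int m * int \<alpha>\<^sub>2 * int \<alpha>\<^sub>3) = - 1" using pos by (metis less_irrefl nonzero_mult_div_cancel_right)
  then have cEy: "floor_E ?n = - 1" using pos by (simp add: floor_E_def)
  have "int m * b * int \<alpha>\<^sub>2 + int m * a * int \<alpha>\<^sub>3 = int m * (a * int \<alpha>\<^sub>3 + b * int \<alpha>\<^sub>2)" by (simp add: algebra_simps)
  then have le: "int m * b * int \<alpha>\<^sub>2 + int m * a * int \<alpha>\<^sub>3 \<le> int m * 1" by (simp only: bezout)
  show "gen_y \<in> Fin" unfolding gen_y_def
  proof (intro Fin_single sign_const_lmon_in_Sec lmon_in_Sec)
    show "0 \<le> 1 + floor_E ?n" unfolding cEy by simp
    show "0 \<le> int m * b * int \<alpha>\<^sub>2 + floor_2 ?n" unfolding c2y by simp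
    show "0 \<le> int m * a * int \<alpha>\<^sub>3 + floor_3 ?n" unfolding c3y by simp
    show "int m * b * int \<alpha>\<^sub>2 + int m * a * int \<alpha>\<^sub>3 \<le> int m * 1" by (rule le)
  qed
qed

lemma minus_one_powi_square: "(-1 :: complex) powi k * (-1) powi k = 1"
  by (simp flip: power_int_mult_distrib)

lemma minus_one_powi_minus: "(-1 :: complex) powi (- k) = (-1) powi k"
  by (simp add: power_int_minus flip: power_int_inverse)

lemma hvalue_sign_const_lmon:
  assumes "lmon i j k \<in> Sec n" and p: "(x, y, z, t) \<in> X\<^sub>0"
  shows "hvalue n (sign_const k * lmon i j k) (x, y, z, t) = x powi (int m * i - j - k) * y powi i
     * z powi (int \<alpha>\<^sub>2 * k + a * n) * t powi (int \<alpha>\<^sub>3 * j + b * n)"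
proof -
  have "hvalue n (sign_const k * lmon i j k) (x, y, z, t) = ((-1) powi k * (-1) powi k) * (x powi (int m * i - j - k) * y powi i
     * z powi (int \<alpha>\<^sub>2 * k + a * n) * t powi (int \<alpha>\<^sub>3 * j + b * n))"
    unfolding sign_const_def hvalue_const[OF assms] hvalue_lmon[OF p] by (simp only: mult.assoc)
  then show ?thesis by (simp only: minus_one_powi_square mult_1)
qed

lemma sign_const_minus: "sign_const (- k) = sign_const k" by (simp add: sign_const_def minus_one_powi_minus)

lemma single_in_Fin_iff: "single k x \<in> Fin \<Longrightarrow> x \<in> Sec k" by (auto simp: Fin_def single_def) (metis)

lemma sign_const_lmon_in_Sec_D: assumes "sign_const r * lmon i j k \<in> Sec n" shows "lmon i j k \<in> Sec n"
proof -
  have "sign_const r * sign_const r = to_fract (bC ((-1) powi r * (-1) powi r))"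
    by (simp only: sign_const_def to_fract_mult bC_simps(3))
  then have "sign_const r * sign_const r = 1" unfolding minus_one_powi_square by simp
  then have eq: "sign_const r * (sign_const r * lmon i j k) = lmon i j k" by (simp flip: mult.assoc)
  have "sign_const r \<in> Sec 0" unfolding sign_const_def by (rule const_in_Sec)
  then have "sign_const r * (sign_const r * lmon i j k) \<in> Sec (0 + n)" using assms by (rule Sec_mult)
  then show ?thesis by (simp only: eq add_0)
qed

lemma gvalue_gens:
  assumes p: "(x, y, z, t) \<in> X\<^sub>0"
  shows "gvalue gen_x (x, y, z, t) = x" "gvalue gen_y (x, y, z, t) = y" "gvalue gen_z (x, y, z, t) = z" "gvalue gen_t (x, y, z, t) = t"
proof -
  have mem: "lmon i j k \<in> Sec n" if "single n (sign_const r * lmon i j k) \<in> Fin" for n r i j k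
    using that single_in_Fin_iff sign_const_lmon_in_Sec_D by blast
  have 1: "int m * 0 - (- b * int \<alpha>\<^sub>2) - (- a * int \<alpha>\<^sub>3) = 1" "int \<alpha>\<^sub>2 * (- a * int \<alpha>\<^sub>3) + a * (int \<alpha>\<^sub>2 * int \<alpha>\<^sub>3) = 0"
     "int \<alpha>\<^sub>3 * (- b * int \<alpha>\<^sub>2) + b * (int \<alpha>\<^sub>2 * int \<alpha>\<^sub>3) = 0" using bezout by (simp_all add: algebra_simps)
  have "sign_const (a * int \<alpha>\<^sub>3) = sign_const (- a * int \<alpha>\<^sub>3)" using sign_const_minus[of "a * int \<alpha>\<^sub>3"] by simp
  then show "gvalue gen_x (x, y, z, t) = x"
    unfolding gen_x_def gvalue_single
    using hvalue_sign_const_lmon[OF mem[OF gens_in_Fin(1)[unfolded gen_x_def]] p] by (simp only: 1 power_int_0_right power_int_1_right mult_1 mult_1_right)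
  have "m * b * \<alpha>\<^sub>2 + m * a * \<alpha>\<^sub>3 = m * (a * int \<alpha>\<^sub>3 + b * int \<alpha>\<^sub>2)" by (simp add: algebra_simps)
  then have "m * b * \<alpha>\<^sub>2 + m * a * \<alpha>\<^sub>3 = m" by (simp add: bezout)
  then have 2: "int m * 1 - int m * b * int \<alpha>\<^sub>2 - int m * a * int \<alpha>\<^sub>3 = 0"
     "int \<alpha>\<^sub>2 * (int m * a * int \<alpha>\<^sub>3) + a * (- int m * int \<alpha>\<^sub>2 * int \<alpha>\<^sub>3) = 0"
     "int \<alpha>\<^sub>3 * (int m * b * int \<alpha>\<^sub>2) + b * (- int m * int \<alpha>\<^sub>2 * int \<alpha>\<^sub>3) = 0" by (simp_all add: algebra_simps)
  show "gvalue gen_y (x, y, z, t) = y"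
    unfolding gen_y_def gvalue_single hvalue_sign_const_lmon[OF mem[OF gens_in_Fin(2)[unfolded gen_y_def]] p]
    by (simp only: 2) simp
  have 3: "int m * 0 - (- b) - b = 0" "int \<alpha>\<^sub>2 * b + a * int \<alpha>\<^sub>3 = 1" "int \<alpha>\<^sub>3 * (- b) + b * int \<alpha>\<^sub>3 = 0"
    using bezout by (simp_all add: algebra_simps)
  show "gvalue gen_z (x, y, z, t) = z"
    unfolding gen_z_def gvalue_single hvalue_sign_const_lmon[OF mem[OF gens_in_Fin(3)[unfolded gen_z_def]] p]
    by (simp only: 3 power_int_0_right power_int_1_right mult_1 mult_1_right)
  have 4: "int m * 0 - a - (- a) = 0" "int \<alpha>\<^sub>2 * (- a) + a * int \<alpha>\<^sub>2 = 0" "int \<alpha>\<^sub>3 * a + b * int \<alpha>\<^sub>2 = 1"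
    using bezout by (simp_all add: algebra_simps)
  show "gvalue gen_t (x, y, z, t) = t"
    unfolding gen_t_def gvalue_single
    using hvalue_sign_const_lmon[OF mem[OF gens_in_Fin(4)[unfolded gen_t_def]] p] sign_const_minus[of a]
    by (simp only: 4 power_int_0_right power_int_1_right mult_1 mult_1_right)
qed

lemma coord_fun_gens:
  assumes "p \<in> X"
  shows "coord_fun (sect gen_x) p = (\<lambda>(x, y, z, t). x) p" "coord_fun (sect gen_y) p = (\<lambda>(x, y, z, t). y) p"
    "coord_fun (sect gen_z) p = (\<lambda>(x, y, z, t). z) p" "coord_fun (sect gen_t) p = (\<lambda>(x, y, z, t). t) p"
  by (rule coord_fun_eqI[OF gens_in_Fin(1) coordsC4_polynomials(1) _ assms] coord_fun_eqI[OF gens_in_Fin(2) coordsC4_polynomials(2) _ assms]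
      coord_fun_eqI[OF gens_in_Fin(3) coordsC4_polynomials(3) _ assms] coord_fun_eqI[OF gens_in_Fin(4) coordsC4_polynomials(4) _ assms];
      clarsimp simp: gvalue_gens)+

definition coords_of :: "((int \<Rightarrow> (C2 \<times> C2 set) set ratfun) \<Rightarrow> complex) \<Rightarrow> C4" where
  "coords_of h = (h (sect gen_x), h (sect gen_y), h (sect gen_z), h (sect gen_t))"

lemma spec_hom:
  assumes "h \<in> spec_points B"
  shows "s \<in> carrier B \<Longrightarrow> s' \<in> carrier B \<Longrightarrow> h (s \<otimes>\<^bsub>B\<^esub> s') = h s * h s'"
    "s \<in> carrier B \<Longrightarrow> s' \<in> carrier B \<Longrightarrow> h (s \<oplus>\<^bsub>B\<^esub> s') = h s + h s'"
    "s \<in> carrier B \<Longrightarrow> h (c \<odot>\<^bsub>B\<^esub> s) = c * h s" "h \<one>\<^bsub>B\<^esub> = 1" "h \<in> extensional (carrier B)"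
  using assms by (auto simp: spec_points_def ring_hom_def complex_ring_def)

text \<open>The section algebra maps onto the polynomial functions of the threefold, and its characters are
  computed by substituting the images of the four generators.\<close>

lemma polynomial_lift:
  assumes "f \<in> polynomials coordsC4"
  shows "\<exists>s\<in>carrier B. (\<forall>p\<in>X. coord_fun s p = f p) \<and> (\<forall>h\<in>spec_points B. h s = f (coords_of h))"
  using assms
proof (induction rule: polynomials.induct)
  case (coord f)
  then consider "f = (\<lambda>(x, y, z, t). x)" | "f = (\<lambda>(x, y, z, t). y)" | "f = (\<lambda>(x, y, z, t). z)" | "f = (\<lambda>(x, y, z, t). t)"
    by (auto simp: coordsC4_def)
  then show ?case
  proof cases
    case 1 show ?thesis by (intro bexI[of _ "sect gen_x"] conjI ballI) (simp_all add: 1 coord_fun_gens gens_in_Fin coords_of_def)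
  next
    case 2 show ?thesis by (intro bexI[of _ "sect gen_y"] conjI ballI) (simp_all add: 2 coord_fun_gens gens_in_Fin coords_of_def)
  next
    case 3 show ?thesis by (intro bexI[of _ "sect gen_z"] conjI ballI) (simp_all add: 3 coord_fun_gens gens_in_Fin coords_of_def)
  next
    case 4 show ?thesis by (intro bexI[of _ "sect gen_t"] conjI ballI) (simp_all add: 4 coord_fun_gens gens_in_Fin coords_of_def)
  qed
next
  case (const c)
  show ?case by (rule bexI[of _ "c \<odot>\<^bsub>B\<^esub> \<one>\<^bsub>B\<^esub>"]) (simp_all add: coord_fun_hom spec_hom B_closed)
next
  case (add f g)
  then obtain s s' where "s \<in> carrier B" "s' \<in> carrier B" "\<forall>p\<in>X. coord_fun s p = f p" "\<forall>p\<in>X. coord_fun s' p = g p"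
     "\<forall>h\<in>spec_points B. h s = f (coords_of h)" "\<forall>h\<in>spec_points B. h s' = g (coords_of h)" by blast
  then show ?case by (intro bexI[of _ "s \<oplus>\<^bsub>B\<^esub> s'"]) (simp_all add: coord_fun_hom spec_hom B_closed)
next
  case (mult f g)
  then obtain s s' where "s \<in> carrier B" "s' \<in> carrier B" "\<forall>p\<in>X. coord_fun s p = f p" "\<forall>p\<in>X. coord_fun s' p = g p"
     "\<forall>h\<in>spec_points B. h s = f (coords_of h)" "\<forall>h\<in>spec_points B. h s' = g (coords_of h)" by blast
  then show ?case by (intro bexI[of _ "s \<otimes>\<^bsub>B\<^esub> s'"]) (simp_all add: coord_fun_hom spec_hom B_closed)
qed

text \<open>An element of the section algebra is determined by its function on the threefold. Applied to the
  defining equation this shows that the images of the generators are the coordinates of a point of the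
  threefold.\<close>

lemma spec_point_eval:
  assumes h: "h \<in> spec_points B" shows "coords_of h \<in> X" "s \<in> carrier B \<Longrightarrow> h s = coord_fun s (coords_of h)"
proof -
  have lift_eq: "h s = f (coords_of h)" if s: "s \<in> carrier B" "f \<in> polynomials coordsC4" "\<And>p. p \<in> X \<Longrightarrow> coord_fun s p = f p" for s f
  proof -
    obtain s' where s': "s' \<in> carrier B" "\<forall>p\<in>X. coord_fun s' p = f p" "\<forall>h\<in>spec_points B. h s' = f (coords_of h)"
      using polynomial_lift[OF s(2)] by blast
    then have "s = s'" using s by (intro coord_fun_separates) auto
    then show ?thesis using s'(3) h by blast
  qed
  show "h s = coord_fun s (coords_of h)" if s: "s \<in> carrier B"
  proof (rule lift_eq[OF s])
    obtain xs where "xs \<in> Fin" "s = sect xs" using s carrier_B by blast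
    then show "coord_fun s \<in> polynomials coordsC4" using coord_fun_sect(1) by blast
  qed simp
  let ?x = "\<lambda>(x, y, z, t). x :: complex" and ?y = "\<lambda>(x, y, z, t). y :: complex"
    and ?z = "\<lambda>(x, y, z, t). z :: complex" and ?t = "\<lambda>(x, y, z, t). t :: complex"
  let ?f = "\<lambda>p. ?x p + ?x p ^ Suc m * ?y p + ?z p ^ \<alpha>\<^sub>2 + ?t p ^ \<alpha>\<^sub>3"
  have zero: "0 \<odot>\<^bsub>B\<^esub> \<one>\<^bsub>B\<^esub> \<in> carrier B" by (simp add: B_closed)
  have "h (0 \<odot>\<^bsub>B\<^esub> \<one>\<^bsub>B\<^esub>) = ?f (coords_of h)"
  proof (rule lift_eq[OF zero])
    show "?f \<in> polynomials coordsC4" by (intro polynomials.add polynomials.mult polynomials_power coordsC4_polynomials)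
    show "coord_fun (0 \<odot>\<^bsub>B\<^esub> \<one>\<^bsub>B\<^esub>) p = ?f p" if "p \<in> X" for p
      using that coord_fun_hom(3)[OF that B_closed(4), of 0] by (auto simp: threefold_def)
  qed
  then have "?f (coords_of h) = 0" using spec_hom(3)[OF h B_closed(4), of 0] by simp
  then show "coords_of h \<in> X" by (simp add: threefold_def coords_of_def)
qed

definition \<Theta> :: "C4 \<Rightarrow> (int \<Rightarrow> (C2 \<times> C2 set) set ratfun) \<Rightarrow> complex" where
  "\<Theta> p = restrict (\<lambda>s. coord_fun s p) (carrier B)"

lemma \<Theta>_in_spec: assumes "p \<in> X" shows "\<Theta> p \<in> spec_points B"
  unfolding spec_points_def
  by (auto simp: ring_hom_def complex_ring_def \<Theta>_def B_closed coord_fun_hom[OF assms])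

lemma coords_of_\<Theta>: assumes "p \<in> X" shows "coords_of (\<Theta> p) = p"
  using coord_fun_gens[OF assms] by (cases p) (simp add: coords_of_def \<Theta>_def gens_in_Fin)

lemma bij_\<Theta>: "bij_betw \<Theta> X (spec_points B)"
proof (rule bij_betw_byWitness[where f' = coords_of])
  show "\<forall>p\<in>X. coords_of (\<Theta> p) = p" by (simp add: coords_of_\<Theta>)
  show "\<forall>h\<in>spec_points B. \<Theta> (coords_of h) = h"
  proof
    fix h assume h: "h \<in> spec_points B"
    show "\<Theta> (coords_of h) = h"
      by (rule extensionalityI[where A = "carrier B"]) (simp_all add: \<Theta>_def spec_hom(5)[OF h] spec_point_eval(2)[OF h])
  qed
  show "\<Theta> ` X \<subseteq> spec_points B" using \<Theta>_in_spec by blast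
  show "coords_of ` spec_points B \<subseteq> X" using spec_point_eval(1) by blast
qed

lemma isomorphism_\<Theta>: "isomorphism (koras_russell (Suc m) \<alpha>\<^sub>2 \<alpha>\<^sub>3) (SS Y Dq) \<Theta>"
  unfolding koras_russell_eq SS_def Spec_def
proof (rule affine_isomorphism[OF bij_\<Theta>])
  fix g assume "g \<in> polynomials {\<lambda>h. h s |s. s \<in> carrier B}"
  then show "\<exists>f\<in>polynomials coordsC4. \<forall>p\<in>X. f p = g (\<Theta> p)"
  proof (induction rule: polynomials.induct)
    case (coord g)
    then obtain s where s: "s \<in> carrier B" "g = (\<lambda>h. h s)" by blast
    then obtain xs where xs: "xs \<in> Fin" "s = sect xs" using carrier_B by blast
    show ?case by (rule bexI[of _ "coord_fun s"]) (use s xs coord_fun_sect(1) in \<open>auto simp: \<Theta>_def\<close>)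
  next
    case (const c) show ?case by (intro bexI[of _ "\<lambda>_. c"] polynomials.const) simp
  next
    case (add f g)
    then obtain f' g' where "f' \<in> polynomials coordsC4" "g' \<in> polynomials coordsC4" "\<forall>p\<in>X. f' p = f (\<Theta> p)" "\<forall>p\<in>X. g' p = g (\<Theta> p)" by blast
    then show ?case by (intro bexI[of _ "\<lambda>p. f' p + g' p"] polynomials.add) auto
  next
    case (mult f g)
    then obtain f' g' where "f' \<in> polynomials coordsC4" "g' \<in> polynomials coordsC4" "\<forall>p\<in>X. f' p = f (\<Theta> p)" "\<forall>p\<in>X. g' p = g (\<Theta> p)" by blast
    then show ?case by (intro bexI[of _ "\<lambda>p. f' p * g' p"] polynomials.mult) auto
  qed
next
  fix f assume "f \<in> polynomials coordsC4"
  then obtain s where s: "s \<in> carrier B" "\<forall>p\<in>X. coord_fun s p = f p" using polynomial_lift by blast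
  have "(\<lambda>h. h s) \<in> polynomials {\<lambda>h. h s |s. s \<in> carrier B}" using s(1) by (intro polynomials.coord) blast
  then show "\<exists>g\<in>polynomials {\<lambda>h. h s |s. s \<in> carrier B}. \<forall>p\<in>X. f p = g (\<Theta> p)"
    by (rule bexI[rotated]) (use s in \<open>simp add: \<Theta>_def\<close>)
qed

lemma polynomial_act:
  assumes "f \<in> polynomials coordsC4" shows "(\<lambda>p. f (act l p)) \<in> polynomials coordsC4"
  using assms
proof (induction rule: polynomials.induct)
  case (coord f)
  have "(\<lambda>p. c * (\<lambda>(x, y, z, t). x) p) \<in> polynomials coordsC4" "(\<lambda>p. c * (\<lambda>(x, y, z, t). y) p) \<in> polynomials coordsC4"
    "(\<lambda>p. c * (\<lambda>(x, y, z, t). z) p) \<in> polynomials coordsC4" "(\<lambda>p. c * (\<lambda>(x, y, z, t). t) p) \<in> polynomials coordsC4" for c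
    by (intro polynomials.mult polynomials.const coordsC4_polynomials)+
  then show ?case using coord by (auto simp: coordsC4_def koras_russell_act_def case_prod_unfold)
qed (auto intro: polynomials.intros)

lemma \<Theta>_equivariant:
  assumes l: "l \<noteq> 0" and p: "p \<in> X" shows "\<Theta> (act l p) = SS_act Y Dq l (\<Theta> p)"
proof
  fix s
  show "\<Theta> (act l p) s = SS_act Y Dq l (\<Theta> p) s"
  proof (cases "s \<in> carrier B")
    case False then show ?thesis by (simp add: \<Theta>_def SS_act_def)
  next
    case True
    then obtain xs where xs: "xs \<in> Fin" "s = sect xs" using carrier_B by blast
    let ?ys = "\<lambda>n. to_fract (bC (l powi n)) * xs n"
    have ys: "?ys \<in> Fin" by (rule Fin_weights[OF xs(1)])
    have eq: "(\<lambda>n. (l powi n) \<odot>\<^bsub>function_field Y\<^esub> s n) = sect ?ys" unfolding xs(2) by (simp add: sect_def Q.smult_\<Phi> fun_eq_iff)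
    have "coord_fun (sect ?ys) p = coord_fun s (act l p)"
    proof (rule coord_fun_eqI[OF ys _ _ p])
      show "(\<lambda>p. coord_fun s (act l p)) \<in> polynomials coordsC4" using xs coord_fun_sect(1) by (intro polynomial_act) simp
      fix q assume q: "q \<in> X\<^sub>0"
      have "gvalue ?ys q = (\<Sum>n | xs n \<noteq> 0. l powi n * hvalue n (xs n) q)" by (rule gvalue_weights[OF xs(1) q])
      also have "\<dots> = gvalue xs (act l q)" by (simp add: gvalue_def hvalue_act[OF l q])
      also have "\<dots> = coord_fun s (act l q)" unfolding xs(2) by (rule coord_fun_sect(2)[OF xs(1) act_X\<^sub>0(1)[OF l q], symmetric])
      finally show "gvalue ?ys q = coord_fun s (act l q)" .
    qed
    then show ?thesis using True ys by (simp add: \<Theta>_def SS_act_def eq)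
  qed
qed

lemma isomorphic: "isomorphic_Cstar (koras_russell (Suc m) \<alpha>\<^sub>2 \<alpha>\<^sub>3) act (SS Y Dq) (SS_act Y Dq)"
  unfolding isomorphic_Cstar_def
  using isomorphism_\<Theta> \<Theta>_equivariant by (auto simp: koras_russell_eq affine_def intro!: exI[of _ \<Theta>])

end

theorem proposition3p3:
  fixes d \<alpha>\<^sub>2 \<alpha>\<^sub>3 :: nat and a b :: int
  defines "D \<equiv> formal_sum
      [({of_int a / of_nat \<alpha>\<^sub>2}, strict_transform {(u, v). u + v + v ^ d = 0}),
       ({of_int b / of_nat \<alpha>\<^sub>3}, strict_transform {(u, v). u = 0}),
       ({0 .. 1 / (of_nat \<alpha>\<^sub>2 * of_nat \<alpha>\<^sub>3)}, exc)]"
  assumes "2 \<le> d" and "2 \<le> \<alpha>\<^sub>2" and "\<alpha>\<^sub>2 < \<alpha>\<^sub>3" and "coprime \<alpha>\<^sub>2 \<alpha>\<^sub>3"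
    and "a * int \<alpha>\<^sub>3 + b * int \<alpha>\<^sub>2 = 1"
  shows "\<exists>D\<^sub>3 D\<^sub>2 D'.
      prime_divisor (Bl_quot (d - 1)) D\<^sub>3 \<and> prime_divisor (Bl_quot (d - 1)) D\<^sub>2 \<and>
      D' = formal_sum
        [({of_int a / of_nat \<alpha>\<^sub>2}, D\<^sub>3),
         ({of_int b / of_nat \<alpha>\<^sub>3}, D\<^sub>2),
         ({0 .. 1 / (of_nat (d - 1) * of_nat \<alpha>\<^sub>2 * of_nat \<alpha>\<^sub>3)}, exc_quot (d - 1))] \<and>
      polyhedral_divisor (Bl_quot (d - 1)) D' \<and>
      D = pullback_pdivisor Bl (Bl_quot (d - 1)) (quot_map_mu (d - 1)) D' \<and>
      isomorphic_Cstar (koras_russell d \<alpha>\<^sub>2 \<alpha>\<^sub>3) (koras_russell_act d \<alpha>\<^sub>2 \<alpha>\<^sub>3)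
        (SS (Bl_quot (d - 1)) D') (SS_act (Bl_quot (d - 1)) D')"
proof -
  define m where "m = d - 1"
  have d: "d = Suc m" using assms(2) by (simp add: m_def)
  interpret koras_russell_data m \<alpha>\<^sub>2 \<alpha>\<^sub>3 a b
    by unfold_locales (use assms d in auto)
  have "D = pullback_pdivisor Bl (Bl_quot m) (quot_map_mu m) Dq"
    unfolding D_def d pullback_Dq strict_transform_u strict_transform_uvd exc_eq ..
  moreover have "Dq = formal_sum [({of_int a / of_nat \<alpha>\<^sub>2}, D\<^sub>3), ({of_int b / of_nat \<alpha>\<^sub>3}, D\<^sub>2),
         ({0 .. 1 / (of_nat m * of_nat \<alpha>\<^sub>2 * of_nat \<alpha>\<^sub>3)}, exc_quot m)]"
    unfolding Dq_def D\<^sub>E_def exc_quot_eq ..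
  ultimately show ?thesis
    using D_prime Dq_polyhedral isomorphic unfolding m_def[symmetric] d[symmetric] by blast
qed

end
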